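(* Let $\rho:\mathbb{R}^d\to(0,\infty)$ be a critical radius function. Let $\theta>0$, $0<\theta'<\theta$, $0\le\alpha<d$, $1<p\le q<\infty$ and $1/p-1/q\le\alpha/d$. Assume that $\Phi$ is a Young function with $\bar\Phi\in B_{p,q}$. If a pair $(U,V)$ of matrix weights satisfies $$[U,V]_{p,q,\alpha,\psi_{\theta'},\Phi}:=\sup_Q\frac{|Q|^{\alpha/d+1/q-1/p}}{\psi_{\theta'/3}(Q)^{1-\alpha/d}}\Big(\frac1{|Q|}\int_Q\|U(x)^{1/q}V^{-1/q}\|_{\Phi,Q}^q\,dx\Big)^{1/q}<\infty,$$ then $$\|M_{U,V,\psi_\theta,\alpha}\vec f\|_{L^q}\lesssim[U,V]_{p,q,\alpha,\psi_{\theta'},\Phi}\|\vec f\|_{L^p}\qquad\text{for all }\vec f\in L^p(\mathbb{R}^d,\mathbb{C}^n).$$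
   Context: Critical radius function: $\rho:\mathbb{R}^d\to(0,\infty)$ for which there are constants $C_0,N_0>0$ with $C_0^{-1}\rho(x)(1+\frac{|x-y|}{\rho(x)})^{-N_0}\le\rho(y)\le C_0\rho(x)(1+\frac{|x-y|}{\rho(x)})^{\frac{N_0}{N_0+1}}$ for all $x,y\in\mathbb{R}^d$. For a cube $Q\subset\mathbb{R}^d$ with center $x_Q$ and side-length $l_Q$, $\psi_\theta(Q):=(1+l_Q/\rho(x_Q))^\theta$. A matrix weight $W:\mathbb{R}^d\to\mathbb{C}^{n\times n}$ is a self-adjoint matrix function with locally integrable entries which is positive definite almost everywhere; powers are defined by the spectral calculus. A Young function is a continuous, increasing, convex $\Phi:[0,\infty)\to[0,\infty)$ with $\Phi(0)=0$ and $\lim_{t\to\infty}\Phi(t)/t=\infty$; its complementary function is $\bar\Phi(t)=\sup_{s>0}\{st-\Phi(s)\}$. For $1<p\le q<\infty$, a Young function $A$ is in $B_{p,q}$ if $\int_1^\infty\frac{A(t)^{q/p}}{t^q}\frac{dt}{t}<\infty$. The localized Orlicz norm is $\|f\|_{\Phi,Q}:=\inf\{\lambda>0:\frac1{|Q|}\int_Q\Phi(|f(y)|/\lambda)dy\le1\}$. $\|U(x)^{1/q}V^{-1/q}\|_{\Phi,Q}$ is the Orlicz norm of $y\mapsto|U(x)^{1/q}V(y)^{-1/q}|_{op}$, where $|\cdot|_{op}$ is the operator norm. The supremum is over all cubes $Q$. $$M_{U,V,\psi_\theta,\alpha}\vec f(x):=\sup_{Q\ni x}\frac{1}{(\psi_\theta(Q)|Q|)^{1-\alpha/d}}\int_Q|U(x)^{1/q}V(y)^{-1/q}\vec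 f(y)|dy .$$ $\|\vec f\|_{L^p}=\||\vec f|\|_{L^p(\mathbb{R}^d)}$ (unweighted). $A\lesssim B$ means $A\le CB$ with $C$ independent of $U,V,\vec f$ (it may depend on $d,n,p,q,\alpha,\theta,\theta',\rho,\Phi$). *)

theory Defs
  imports "HOL-Analysis.Analysis"
begin

subsection \<open>Critical radius functions and cubes\<close>

definition critical_radius :: "(real^'d::finite \<Rightarrow> real) \<Rightarrow> bool" where
  "critical_radius \<rho> \<longleftrightarrow> (\<forall>x. 0 < \<rho> x) \<and>
     (\<exists>C0 N0. 0 < C0 \<and> 0 < N0 \<and>
       (\<forall>x y. inverse C0 * \<rho> x * (1 + dist x y / \<rho> x) powr (- N0) \<le> \<rho> y \<and>
              \<rho> y \<le> C0 * \<rho> x * (1 + dist x y / \<rho> x) powr (N0 / (N0 + 1))))"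

text \<open>The closed cube with sides parallel to the axes, centre \<open>c\<close> and side-length \<open>l\<close>.\<close>

definition cube :: "real^'d::finite \<Rightarrow> real \<Rightarrow> (real^'d) set" where
  "cube c l = {x. \<forall>i. \<bar>x $ i - c $ i\<bar> \<le> l / 2}"

definition psi :: "(real^'d::finite \<Rightarrow> real) \<Rightarrow> real \<Rightarrow> real^'d \<Rightarrow> real \<Rightarrow> real" where
  "psi \<rho> \<theta> c l = (1 + l / \<rho> c) powr \<theta>"


subsection \<open>Matrix weights\<close>

definition cadjoint :: "complex^'n::finite^'n \<Rightarrow> complex^'n^'n" where
  "cadjoint A = (\<chi> i j. cnj (A $ j $ i))"

definition self_adjoint_mat :: "complex^'n::finite^'n \<Rightarrow> bool" where
  "self_adjoint_mat A \<longleftrightarrow> cadjoint A = A"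

text \<open>On complex vectors \<open>\<bullet>\<close> is the real part of the Hermitian inner product,
  and \<open>\<langle>A z, z\<rangle>\<close> is real for self-adjoint \<open>A\<close>.\<close>

definition pos_def_mat :: "complex^'n::finite^'n \<Rightarrow> bool" where
  "pos_def_mat A \<longleftrightarrow> self_adjoint_mat A \<and> (\<forall>z. z \<noteq> 0 \<longrightarrow> 0 < (A *v z) \<bullet> z)"

definition unitary_mat :: "complex^'n::finite^'n \<Rightarrow> bool" where
  "unitary_mat P \<longleftrightarrow> P ** cadjoint P = mat 1 \<and> cadjoint P ** P = mat 1"

definition real_diag_mat :: "('n::finite \<Rightarrow> real) \<Rightarrow> complex^'n^'n" where
  "real_diag_mat D = (\<chi> i j. if i = j then of_real (D i) else 0)"

text \<open>Spectral calculus: \<open>g(A) = P diag(g(D\<^sub>i)) P\<^sup>*\<close> for any unitary diagonalisation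
  \<open>A = P diag(D\<^sub>i) P\<^sup>*\<close>; independence of the diagonalisation is proved below.
  The value is unspecified if \<open>A\<close> is not self-adjoint.\<close>

definition spectral_fun :: "(real \<Rightarrow> real) \<Rightarrow> complex^'n::finite^'n \<Rightarrow> complex^'n^'n" where
  "spectral_fun g A = (THE B. \<exists>P D. unitary_mat P \<and>
     A = P ** real_diag_mat D ** cadjoint P \<and>
     B = P ** real_diag_mat (\<lambda>i. g (D i)) ** cadjoint P)"

lemma real_diag_mat_left: "(real_diag_mat D ** R) $ i $ j = of_real (D i) * R $ i $ j"
  by (simp add: real_diag_mat_def matrix_matrix_mult_def if_distrib if_distribR cong: if_cong)

lemma real_diag_mat_right: "(R ** real_diag_mat D) $ i $ j = R $ i $ j * of_real (D j)"
  by (simp add: real_diag_mat_def matrix_matrix_mult_def if_distrib if_distribR cong: if_cong)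

lemma spectral_fun_unique:
  fixes P Q :: "complex^'n::finite^'n"
  assumes P: "unitary_mat P" and Q: "unitary_mat Q"
    and eq: "P ** real_diag_mat D ** cadjoint P = Q ** real_diag_mat E ** cadjoint Q"
  shows "P ** real_diag_mat (\<lambda>i. g (D i)) ** cadjoint P
       = Q ** real_diag_mat (\<lambda>i. g (E i)) ** cadjoint Q"
proof -
  define R where "R = cadjoint Q ** P"
  have PP: "cadjoint P ** P = mat 1" "P ** cadjoint P = mat 1"
    and QQ: "cadjoint Q ** Q = mat 1" "Q ** cadjoint Q = mat 1"
    using P Q by (auto simp: unitary_mat_def)
  have "cadjoint Q ** (P ** real_diag_mat D ** cadjoint P) ** P
      = cadjoint Q ** (Q ** real_diag_mat E ** cadjoint Q) ** P"
    by (simp add: eq)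
  moreover have "cadjoint Q ** (P ** real_diag_mat D ** cadjoint P) ** P
      = R ** real_diag_mat D ** (cadjoint P ** P)"
    by (simp only: R_def matrix_mul_assoc)
  moreover have "cadjoint Q ** (Q ** real_diag_mat E ** cadjoint Q) ** P
      = (cadjoint Q ** Q) ** real_diag_mat E ** R"
    by (simp only: R_def matrix_mul_assoc)
  ultimately have RD: "R ** real_diag_mat D = real_diag_mat E ** R"
    by (simp add: PP QQ)
  have "R $ i $ j * of_real (D j) = of_real (E i) * R $ i $ j" for i j
    using RD by (metis real_diag_mat_left real_diag_mat_right)
  hence "R $ i $ j * of_real (g (D j)) = of_real (g (E i)) * R $ i $ j" for i j
    by (metis mult.commute mult_cancel_right mult_zero_left mult_zero_right of_real_eq_iff)
  hence RG: "R ** real_diag_mat (\<lambda>i. g (D i)) = real_diag_mat (\<lambda>i. g (E i)) ** R"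
    by (simp add: vec_eq_iff real_diag_mat_left real_diag_mat_right)
  have "Q ** (R ** real_diag_mat (\<lambda>i. g (D i))) ** cadjoint P
      = (Q ** cadjoint Q) ** P ** real_diag_mat (\<lambda>i. g (D i)) ** cadjoint P"
    by (simp only: R_def matrix_mul_assoc)
  moreover have "Q ** (real_diag_mat (\<lambda>i. g (E i)) ** R) ** cadjoint P
      = Q ** real_diag_mat (\<lambda>i. g (E i)) ** cadjoint Q ** (P ** cadjoint P)"
    by (simp only: R_def matrix_mul_assoc)
  ultimately show ?thesis
    by (simp add: RG PP QQ)
qed

lemma spectral_fun_eq:
  assumes "unitary_mat P" and "A = P ** real_diag_mat D ** cadjoint P"
  shows "spectral_fun g A = P ** real_diag_mat (\<lambda>i. g (D i)) ** cadjoint P"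
  unfolding spectral_fun_def
  by (rule the_equality) (use assms spectral_fun_unique in blast)+

definition mat_powr :: "complex^'n::finite^'n \<Rightarrow> real \<Rightarrow> complex^'n^'n" where
  "mat_powr A s = spectral_fun (\<lambda>t. t powr s) A"

definition matrix_weight :: "(real^'d::finite \<Rightarrow> complex^'n::finite^'n) \<Rightarrow> bool" where
  "matrix_weight W \<longleftrightarrow> (\<forall>x. self_adjoint_mat (W x)) \<and>
     (\<forall>i j K. compact K \<longrightarrow> set_integrable lebesgue K (\<lambda>x. W x $ i $ j)) \<and>
     (AE x in lebesgue. pos_def_mat (W x))"

definition op_norm :: "complex^'n::finite^'n \<Rightarrow> real" where
  "op_norm A = onorm (\<lambda>z. A *v z)"


subsection \<open>Lebesgue norms\<close>

text \<open>Real powers on \<open>[0, \<infinity>]\<close>, for positive exponents.\<close>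

definition epowr :: "ennreal \<Rightarrow> real \<Rightarrow> ennreal" where
  "epowr x a = (if x = \<infinity> then \<infinity> else ennreal (enn2real x powr a))"

definition Lp_norm :: "real \<Rightarrow> (real^'d::finite \<Rightarrow> ennreal) \<Rightarrow> ennreal" where
  "Lp_norm p g = epowr (\<integral>\<^sup>+x. epowr (g x) p \<partial>lebesgue) (1 / p)"

definition in_Lp :: "real \<Rightarrow> (real^'d::finite \<Rightarrow> complex^'n::finite) \<Rightarrow> bool" where
  "in_Lp p f \<longleftrightarrow> f \<in> borel_measurable lebesgue \<and> Lp_norm p (\<lambda>x. ennreal (norm (f x))) < \<infinity>"

definition mean_on :: "(real^'d::finite) set \<Rightarrow> (real^'d \<Rightarrow> ennreal) \<Rightarrow> ennreal" where
  "mean_on Q g = (\<integral>\<^sup>+y\<in>Q. g y \<partial>lebesgue) / emeasure lebesgue Q"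


subsection \<open>Young functions\<close>

text \<open>Young functions live on \<open>[0, \<infinity>)\<close>; their values at negative reals are irrelevant.
  ``Increasing'' is meant in the weak sense, so that the complementary function of
  a Young function is again one.\<close>

definition young :: "(real \<Rightarrow> real) \<Rightarrow> bool" where
  "young \<Phi> \<longleftrightarrow> (\<forall>t\<ge>0. 0 \<le> \<Phi> t) \<and> continuous_on {0..} \<Phi> \<and> mono_on {0..} \<Phi> \<and>
     convex_on {0..} \<Phi> \<and> \<Phi> 0 = 0 \<and> filterlim (\<lambda>t. \<Phi> t / t) at_top at_top"

text \<open>For a Young function \<open>\<Phi>\<close> and \<open>t \<ge> 0\<close> the supremum is finite, because \<open>\<Phi>\<close> grows superlinearly.\<close>

definition complementary :: "(real \<Rightarrow> real) \<Rightarrow> real \<Rightarrow> real" where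
  "complementary \<Phi> t = (SUP s\<in>{0<..}. s * t - \<Phi> s)"

definition B_class :: "real \<Rightarrow> real \<Rightarrow> (real \<Rightarrow> real) set" where
  "B_class p q = {A. young A \<and>
     (\<integral>\<^sup>+t\<in>{1..}. ennreal (A t powr (q / p) / t powr q * (1 / t)) \<partial>lborel) < \<infinity>}"

text \<open>The norm takes the value \<open>\<infinity>\<close> if no \<open>r\<close> is admissible.\<close>

definition orlicz_norm ::
  "(real \<Rightarrow> real) \<Rightarrow> (real^'d::finite) set \<Rightarrow> (real^'d \<Rightarrow> real) \<Rightarrow> ennreal" where
  "orlicz_norm \<Phi> Q f =
     Inf {ennreal r | r. 0 < r \<and> mean_on Q (\<lambda>y. ennreal (\<Phi> (\<bar>f y\<bar> / r))) \<le> 1}"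


subsection \<open>The bump constant and the maximal operator\<close>

text \<open>The parameter \<open>\<theta>\<close> below is the index of the constant, so the weight that appears is
  \<open>\<psi>\<close> with exponent \<open>\<theta>/3\<close>.\<close>

definition bump_const ::
  "(real^'d::finite \<Rightarrow> real) \<Rightarrow> real \<Rightarrow> real \<Rightarrow> real \<Rightarrow> real \<Rightarrow> (real \<Rightarrow> real) \<Rightarrow>
   (real^'d \<Rightarrow> complex^'n::finite^'n) \<Rightarrow> (real^'d \<Rightarrow> complex^'n^'n) \<Rightarrow> ennreal" where
  "bump_const \<rho> p q \<alpha> \<theta> \<Phi> U V =
     (SUP (c, l) \<in> UNIV \<times> {0<..}.
        ennreal (measure lebesgue (cube c l) powr (\<alpha> / CARD('d) + 1 / q - 1 / p)
                 / psi \<rho> (\<theta> / 3) c l powr (1 - \<alpha> / CARD('d))) *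
        epowr (mean_on (cube c l) (\<lambda>x.
          epowr (orlicz_norm \<Phi> (cube c l)
                   (\<lambda>y. op_norm (mat_powr (U x) (1 / q) ** mat_powr (V y) (- 1 / q)))) q)) (1 / q))"

definition maximal_op ::
  "(real^'d::finite \<Rightarrow> real) \<Rightarrow> real \<Rightarrow> real \<Rightarrow> real \<Rightarrow>
   (real^'d \<Rightarrow> complex^'n::finite^'n) \<Rightarrow> (real^'d \<Rightarrow> complex^'n^'n) \<Rightarrow>
   (real^'d \<Rightarrow> complex^'n) \<Rightarrow> real^'d \<Rightarrow> ennreal" where
  "maximal_op \<rho> q \<alpha> \<theta> U V f x =
     (SUP (c, l) \<in> {(c, l). 0 < l \<and> x \<in> cube c l}.
        (\<integral>\<^sup>+y\<in>cube c l.
           ennreal (norm ((mat_powr (U x) (1 / q) ** mat_powr (V y) (- 1 / q)) *v f y)) \<partial>lebesgue)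
        / ennreal ((psi \<rho> \<theta> c l * measure lebesgue (cube c l)) powr (1 - \<alpha> / CARD('d))))"

end

theory Submission
  imports Defs
begin

text \<open>
  Write \<open>g = V\<^sup>-\<^sup>1\<^sup>/\<^sup>q f\<close> and \<open>W = U\<^sup>1\<^sup>/\<^sup>q\<close>. Cubes are sorted by the dyadic size \<open>2 powr j\<close> of \<open>1 + l / \<rho> c\<close>; each
  lies in a comparable cube of one of \<open>2^d\<close> shifted dyadic grids. Since the bump condition is
  applied to a dilate with the same centre, no comparison of \<open>\<psi>\<close> at different centres is needed, and
  the bounds for the levels sum geometrically because \<open>\<theta>' / 3 < \<theta>\<close>.

  For a fixed grid and level one shows \<open>\<integral> sup\<^sub>Q H\<^sub>Q\<^sup>q \<le> C \<integral> \<tau>\<close>, where \<open>H\<^sub>Q x = |Q| powr (\<alpha>/d)\<close> times the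
  average of \<open>|W x g|\<close> over \<open>Q\<close> and \<open>\<tau>\<close> is the \<open>q\<close>-th power of a dyadic fractional Orlicz maximal function of \<open>|f|\<close>.
  This is an induction over finite laminar families: inside a maximal cube \<open>Q\<^sub>0\<close> all cubes outside
  a stopping set of at most half the measure satisfy \<open>H\<^sub>Q x \<le> C H\<^sub>Q\<^sub>0 x\<close> for every \<open>x\<close>, and on \<open>Q\<^sub>0\<close> itself
  Hoelder's inequality for Orlicz norms and the bump condition bound \<open>\<integral> H\<^sub>Q\<^sub>0\<^sup>q\<close>. The class \<open>B\<^sub>p\<^sub>,\<^sub>q\<close> makes the
  Orlicz maximal function bounded from \<open>L\<^sup>p\<close> to \<open>L\<^sup>q\<close>.
\<close>

subsection \<open>Real powers of extended nonnegative reals\<close>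

text \<open>The obstacle is that the kernel \<open>norm (W x *v g y)\<close> does not split into a
  function of \<open>x\<close> times a function of \<open>y\<close>: a scalar stopping time for it
  would depend on \<open>x\<close>. The stopping sets have to serve all linear maps at once. On a
  finite-dimensional space a seminorm is known up to constants from its values on a well-chosen
  basis, so finitely many scalar conditions on \<open>\<bar>b \<bullet> g y\<bar>\<close> suffice,
  and a threshold proportional to the number of directions keeps the stopping sets within half of
  \<open>Q0\<close>. That half is what closes the recursion: the local bound on \<open>Q0\<close> is
  charged to the part of \<open>Q0\<close> outside the stopping sets, and the parts charged at
  different stages are disjoint, so \<open>\<tau>\<close> is integrated only once and no constant
  accumulates. Orlicz norms of \<open>f\<close> are replaced by integer levels, which turns the
  integral in \<open>B_class\<close> into a sum over integers. The Orlicz norm of the kernel, a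
  function of \<open>x\<close>, is handled as an upper bound inside lower integrals.\<close>

lemma epowr_ennreal [simp]: "0 \<le> a \<Longrightarrow> epowr (ennreal a) s = ennreal (a powr s)"
  by (simp add: epowr_def)

lemma epowr_top [simp]: "epowr \<infinity> s = \<infinity>" "epowr top s = top"
  by (simp_all add: epowr_def)

lemma epowr_zero [simp]: "epowr 0 s = 0"
  using epowr_ennreal[of 0 s] by simp

lemma epowr_mono: "0 \<le> s \<Longrightarrow> x \<le> y \<Longrightarrow> epowr x s \<le> epowr y s"
  by (cases x; cases y) (auto intro!: ennreal_leI powr_mono2 simp: top_unique)

lemma epowr_epowr: "epowr (epowr x a) b = epowr x (a * b)"
  by (cases x) (auto simp: powr_powr)

lemma epowr_1 [simp]: "epowr x 1 = x"
  by (cases x) auto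

lemma epowr_inverse:
  assumes "0 < s" shows "epowr (epowr x s) (1 / s) = x" "epowr (epowr x (1 / s)) s = x"
  using assms by (simp_all add: epowr_epowr)

lemma epowr_mult:
  assumes "0 < s" shows "epowr (x * y) s = epowr x s * epowr y s"
proof -
  have *: "epowr (x * top) s = epowr x s * top" for x
    using assms by (cases "x = 0"; cases x) (auto simp: ennreal_mult_top)
  show ?thesis
  proof (cases x)
    case (real a)
    show ?thesis
      using * [of x] real by (cases y) (auto simp: powr_mult simp flip: ennreal_mult)
  next
    case top
    then show ?thesis using * [of y] by (simp add: mult.commute)
  qed
qed

lemma epowr_le_iff:
  assumes "0 < s" shows "epowr x s \<le> y \<longleftrightarrow> x \<le> epowr y (1 / s)"
proof
  assume "epowr x s \<le> y"
  then have "epowr (epowr x s) (1 / s) \<le> epowr y (1 / s)" using assms by (intro epowr_mono) auto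
  then show "x \<le> epowr y (1 / s)" by (simp only: epowr_inverse[OF assms])
next
  assume "x \<le> epowr y (1 / s)"
  then have "epowr x s \<le> epowr (epowr y (1 / s)) s" using assms by (intro epowr_mono) auto
  then show "epowr x s \<le> y" by (simp only: epowr_inverse[OF assms])
qed

lemma epowr_less_top [simp]: "epowr x s < top \<longleftrightarrow> x < top"
  by (cases x) auto

lemma borel_measurable_epowr [measurable]: "(\<lambda>x. epowr x s) \<in> borel_measurable borel"
  unfolding epowr_def by measurable

lemma set_nn_integral_eq_mean_on:
  assumes "emeasure lebesgue Q \<noteq> 0" "emeasure lebesgue Q < \<infinity>"
  shows "(\<integral>\<^sup>+x\<in>Q. g x \<partial>lebesgue) = mean_on Q g * emeasure lebesgue Q"
  using assms unfolding mean_on_def by (simp add: ennreal_divide_times ennreal_divide_self)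

subsection \<open>Lower integrals\<close>

text \<open>In the next two lemmas \<open>v\<close> is not assumed measurable, so its \<open>nn_integral\<close> is only a
  lower integral.\<close>

lemma nn_integral_le_add:
  assumes [measurable]: "u \<in> borel_measurable M" "w \<in> borel_measurable M"
    and le: "\<And>x. x \<in> space M \<Longrightarrow> u x \<le> v x + w x"
  shows "(\<integral>\<^sup>+x. u x \<partial>M) \<le> (\<integral>\<^sup>+x. v x \<partial>M) + (\<integral>\<^sup>+x. w x \<partial>M)"
proof -
  \<comment> \<open>In \<open>ennreal\<close>, \<open>top - top\<close> is \<open>top\<close>, so
    where \<open>w\<close> is infinite the difference could exceed \<open>v\<close>; 0 is the safe
    value there. This makes \<open>\<delta>\<close> a measurable minorant of
    \<open>v\<close>.\<close>
  define \<delta> where "\<delta> x = (if w x = top then 0 else u x - w x)" for x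
  have [measurable]: "\<delta> \<in> borel_measurable M" unfolding \<delta>_def by measurable
  have "(\<integral>\<^sup>+x. u x \<partial>M) \<le> (\<integral>\<^sup>+x. \<delta> x + w x \<partial>M)"
  proof (intro nn_integral_mono)
    show "u x \<le> \<delta> x + w x" for x
      by (cases "u x"; cases "w x")
        (auto simp: \<delta>_def ennreal_minus ennreal_minus_if simp flip: ennreal_plus intro!: ennreal_leI)
  qed
  also have "\<dots> = (\<integral>\<^sup>+x. \<delta> x \<partial>M) + (\<integral>\<^sup>+x. w x \<partial>M)"
    by (rule nn_integral_add) auto
  also have "\<dots> \<le> (\<integral>\<^sup>+x. v x \<partial>M) + (\<integral>\<^sup>+x. w x \<partial>M)"
    using le by (intro add_right_mono nn_integral_mono)
      (auto simp: \<delta>_def ennreal_minus_le_iff add.commute)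
  finally show ?thesis .
qed

lemma nn_integral_le_cmult:
  assumes [measurable]: "u \<in> borel_measurable M" and c: "0 < c"
    and le: "\<And>x. x \<in> space M \<Longrightarrow> u x \<le> ennreal c * v x"
  shows "(\<integral>\<^sup>+x. u x \<partial>M) \<le> ennreal c * (\<integral>\<^sup>+x. v x \<partial>M)"
proof -
  have [simp]: "ennreal c * (ennreal (1 / c) * z) = z" "ennreal (1 / c) * (ennreal c * z) = z" for z
    using c by (simp_all flip: mult.assoc ennreal_mult)
  have "(\<integral>\<^sup>+x. u x \<partial>M) = ennreal c * (\<integral>\<^sup>+x. ennreal (1 / c) * u x \<partial>M)"
    by (simp add: nn_integral_cmult)
  also have "\<dots> \<le> ennreal c * (\<integral>\<^sup>+x. v x \<partial>M)"
  proof (intro mult_left_mono nn_integral_mono)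
    fix x assume "x \<in> space M"
    then have "ennreal (1 / c) * u x \<le> ennreal (1 / c) * (ennreal c * v x)"
      using le by (intro mult_left_mono) auto
    then show "ennreal (1 / c) * u x \<le> v x" by simp
  qed simp
  finally show ?thesis .
qed

text \<open>Monotone convergence along an enumeration of \<open>I\<close>. It allows the maximal
  estimates to be proved by induction over finite families and then applied to a whole grid.\<close>

lemma nn_integral_countable_SUP_le:
  fixes h :: "'i \<Rightarrow> 'a \<Rightarrow> ennreal"
  assumes "countable I" and m: "\<And>i. i \<in> I \<Longrightarrow> h i \<in> borel_measurable M"
    and le: "\<And>J. finite J \<Longrightarrow> J \<subseteq> I \<Longrightarrow> (\<integral>\<^sup>+x. (SUP i\<in>J. h i x) \<partial>M) \<le> B"
  shows "(\<integral>\<^sup>+x. (SUP i\<in>I. h i x) \<partial>M) \<le> B"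
proof (cases "I = {}")
  case False
  define J where "J n = from_nat_into I ` {..<n}" for n
  have J: "finite (J n)" "J n \<subseteq> I" for n
    using from_nat_into[OF False] by (auto simp: J_def)
  have UJ: "(\<Union>n. J n) = I"
  proof (intro equalityI subsetI)
    fix i assume "i \<in> I"
    then obtain n where "from_nat_into I n = i" using assms(1) by (metis from_nat_into_surj)
    then show "i \<in> (\<Union>n. J n)" by (auto simp: J_def intro!: exI[of _ "Suc n"])
  qed (use J in auto)
  have "(SUP i\<in>I. h i x) = (SUP n. SUP i\<in>J n. h i x)" for x
    unfolding UJ[symmetric] by (simp add: SUP_UNION)
  then have "(\<integral>\<^sup>+x. (SUP i\<in>I. h i x) \<partial>M) = (\<integral>\<^sup>+x. (SUP n. SUP i\<in>J n. h i x) \<partial>M)"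
    by simp
  also have "\<dots> = (SUP n. \<integral>\<^sup>+x. (SUP i\<in>J n. h i x) \<partial>M)"
  proof (rule nn_integral_monotone_convergence_SUP)
    show "incseq (\<lambda>n x. SUP i\<in>J n. h i x)"
      by (intro incseq_SucI le_funI SUP_subset_mono) (auto simp: J_def)
    show "(\<lambda>x. SUP i\<in>J n. h i x) \<in> borel_measurable M" for n
      using J m by (intro borel_measurable_SUP) (auto intro: countable_finite)
  qed
  also have "\<dots> \<le> B" using J le by (intro SUP_least) auto
  finally show ?thesis .
qed (use le[of "{}"] in simp)

subsection \<open>Laminar families\<close>

text \<open>The abstract form of dyadic nestedness. The maximal estimates below use nothing else
  about cubes than this and their finite positive measure.\<close>

definition laminar :: "'x set set \<Rightarrow> bool" where
  "laminar \<F> \<longleftrightarrow> (\<forall>A\<in>\<F>. \<forall>B\<in>\<F>. A \<inter> B = {} \<or> A \<subseteq> B \<or> B \<subseteq> A)"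

lemma laminar_subset: "laminar \<F> \<Longrightarrow> \<G> \<subseteq> \<F> \<Longrightarrow> laminar \<G>"
  unfolding laminar_def by blast

text \<open>The members that are maximal for inclusion: distinct ones are not nested, so laminarity
  makes them disjoint, and finiteness puts every member below one of them.\<close>

lemma laminar_disjoint_subfamily:
  assumes "finite \<F>" "laminar \<F>"
  obtains \<M> where "\<M> \<subseteq> \<F>" "disjoint \<M>" "\<And>A. A \<in> \<F> \<Longrightarrow> \<exists>B\<in>\<M>. A \<subseteq> B"
proof
  let ?M = "{A\<in>\<F>. \<forall>B\<in>\<F>. A \<subseteq> B \<longrightarrow> A = B}"
  show "?M \<subseteq> \<F>" by (rule Collect_restrict)
  show "disjoint ?M"
  proof (rule disjointI)
    fix A B assume "A \<in> ?M" "B \<in> ?M" "A \<noteq> B"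
    then have "A \<in> \<F>" "B \<in> \<F>" "\<not> A \<subseteq> B" "\<not> B \<subseteq> A" by simp_all metis+
    then show "A \<inter> B = {}" using assms(2) unfolding laminar_def by metis
  qed
  fix A assume "A \<in> \<F>"
  from finite_has_maximal2[OF assms(1) this] show "\<exists>B\<in>?M. A \<subseteq> B" by simp metis
qed

text \<open>A weak (1,1) bound with constant one: the maximal members are disjoint and already cover
  the union, so no covering constant is lost.\<close>

lemma laminar_weak_type:
  fixes \<phi> :: "'x \<Rightarrow> real"
  assumes fin: "finite \<S>" and lam: "laminar \<S>" and S: "\<S> \<subseteq> sets M" and X: "X \<in> sets M" "\<Union>\<S> \<subseteq> X"
    and fm: "\<And>Q. Q \<in> \<S> \<Longrightarrow> emeasure M Q < \<infinity>"
    and int: "set_integrable M X \<phi>" and pos: "\<And>y. 0 \<le> \<phi> y" and c: "0 \<le> c"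
    and le: "\<And>Q. Q \<in> \<S> \<Longrightarrow> c * measure M Q \<le> (LINT y:Q|M. \<phi> y)"
  shows "c * measure M (\<Union>\<S>) \<le> (LINT y:X|M. \<phi> y)"
proof -
  obtain \<M> where M0: "\<M> \<subseteq> \<S>" "disjoint \<M>" "\<And>A. A \<in> \<S> \<Longrightarrow> \<exists>B\<in>\<M>. A \<subseteq> B"
    by (fact laminar_disjoint_subfamily[OF fin lam])
  have "\<Union>\<S> \<subseteq> \<Union>\<M>"
    by (rule Union_least) (use M0(3) in \<open>metis Union_upper order_trans\<close>)
  with M0 have M: "\<M> \<subseteq> \<S>" "disjoint \<M>" "\<Union>\<M> = \<Union>\<S>" by (auto intro!: antisym Union_mono)
  have finM: "finite \<M>" using M(1) fin finite_subset by blast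
  have intQ: "integrable M (\<lambda>y. indicator Q y *\<^sub>R \<phi> y)" if "Q \<in> \<M>" for Q
    using set_integrable_subset[OF int, of Q] that S M X unfolding set_integrable_def by blast
  have "c * measure M (\<Union>\<S>) \<le> c * (\<Sum>Q\<in>\<M>. measure M Q)"
  proof (intro mult_left_mono c)
    have "measure M (\<Union>Q\<in>\<M>. Q) \<le> (\<Sum>Q\<in>\<M>. measure M Q)"
      using finM M S fm by (intro measure_UNION_le) auto
    then show "measure M (\<Union>\<S>) \<le> (\<Sum>Q\<in>\<M>. measure M Q)" using M(3) by simp
  qed
  also have "\<dots> \<le> (\<Sum>Q\<in>\<M>. LINT y:Q|M. \<phi> y)"
    using le M unfolding sum_distrib_left by (intro sum_mono) blast
  also have "\<dots> = (LINT y|M. (\<Sum>Q\<in>\<M>. indicator Q y *\<^sub>R \<phi> y))"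
    using intQ unfolding set_lebesgue_integral_def by (subst Bochner_Integration.integral_sum) auto
  also have "\<dots> \<le> (LINT y:X|M. \<phi> y)"
    unfolding set_lebesgue_integral_def
  proof (rule integral_mono)
    show "integrable M (\<lambda>y. \<Sum>Q\<in>\<M>. indicator Q y *\<^sub>R \<phi> y)"
      using intQ by (intro Bochner_Integration.integrable_sum) auto
    show "integrable M (\<lambda>y. indicator X y *\<^sub>R \<phi> y)" using int by (simp add: set_integrable_def)
    fix y
    have "(\<Sum>Q\<in>\<M>. indicator Q y) = (indicator (\<Union>\<M>) y :: real)"
      using finM M(2) by (intro indicator_UN_disjoint[of \<M> "\<lambda>Q. Q", simplified, symmetric])
        (auto simp: disjoint_family_on_def disjoint_def)
    then have "(\<Sum>Q\<in>\<M>. indicator Q y *\<^sub>R \<phi> y) = indicator (\<Union>\<M>) y * \<phi> y"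
      by (simp add: sum_distrib_right[symmetric])
    also have "\<dots> \<le> indicator X y *\<^sub>R \<phi> y"
      using M X pos by (auto simp: indicator_def)
    finally show "(\<Sum>Q\<in>\<M>. indicator Q y *\<^sub>R \<phi> y) \<le> indicator X y *\<^sub>R \<phi> y" .
  qed
  finally show ?thesis .
qed

subsection \<open>A basis adapted to a seminorm\<close>

text \<open>The basis vectors are chosen greedily: each one minimises the seminorm on the unit
  sphere of the orthogonal complement of its predecessors.\<close>

lemma seminorm_adapted_basis:
  fixes \<nu> :: "'a::euclidean_space \<Rightarrow> real"
  assumes tri: "\<And>x y. \<nu> (x + y) \<le> \<nu> x + \<nu> y" and hom: "\<And>c x. \<nu> (c *\<^sub>R x) = \<bar>c\<bar> * \<nu> x"
    and "subspace S"
  shows "\<exists>B\<subseteq>S. finite B \<and> card B = dim S \<and>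
    (\<forall>v\<in>S. (\<Sum>b\<in>B. (v \<bullet> b) *\<^sub>R b) = v \<and> (\<forall>b\<in>B. \<bar>v \<bullet> b\<bar> * \<nu> b \<le> 2 ^ dim S * \<nu> v))"
  using \<open>subspace S\<close>
proof (induction "dim S" arbitrary: S)
  case 0
  then have "S \<subseteq> {0}" by (metis dim_eq_0)
  then show ?case using "0.hyps" by (intro exI[of _ "{}"]) auto
next
  case (Suc n)
  have \<nu>0: "\<nu> 0 = 0" using hom[of 0 0] by simp
  have pos: "0 \<le> \<nu> v" for v
    using tri[of v "(-1) *\<^sub>R v"] hom[of "-1" v] \<nu>0 by simp
  have "convex_on UNIV \<nu>"
  proof (rule convex_onI)
    fix t x y assume "0 < t" "t < (1::real)"
    then show "\<nu> ((1 - t) *\<^sub>R x + t *\<^sub>R y) \<le> (1 - t) * \<nu> x + t * \<nu> y"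
      using tri[of "(1 - t) *\<^sub>R x" "t *\<^sub>R y"] by (simp add: hom)
  qed simp
  then have cont: "continuous_on UNIV \<nu>" by (intro convex_on_continuous) auto
  have "S \<noteq> {0}" using Suc.hyps(2) by auto
  then obtain z where z: "z \<in> S" "z \<noteq> 0" using subspace_0[OF Suc.prems] by blast
  have "compact (sphere 0 1 \<inter> S)"
    by (intro compact_Int_closed closed_subspace Suc.prems) auto
  moreover have "(1 / norm z) *\<^sub>R z \<in> sphere 0 1 \<inter> S"
    using z Suc.prems by (auto intro: subspace_scale)
  then have "sphere 0 1 \<inter> S \<noteq> {}" by blast
  ultimately have "\<exists>x\<in>sphere 0 1 \<inter> S. \<forall>y\<in>sphere 0 1 \<inter> S. \<nu> x \<le> \<nu> y"
    by (intro continuous_attains_inf continuous_on_subset[OF cont]) simp_all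
  then obtain e where e: "norm e = 1" "e \<in> S" and
    min: "\<And>y. y \<in> S \<Longrightarrow> norm y = 1 \<Longrightarrow> \<nu> e \<le> \<nu> y"
    by auto
  have ee: "e \<bullet> e = 1" using e by (simp add: norm_eq_1)
  define S' where "S' = {y \<in> S. \<forall>x\<in>span {e}. orthogonal x y}"
  have S'e: "y \<in> S \<Longrightarrow> y \<bullet> e = 0 \<Longrightarrow> y \<in> S'" "y \<in> S' \<Longrightarrow> y \<in> S \<and> y \<bullet> e = 0" for y
    by (auto simp: S'_def orthogonal_def span_singleton inner_commute)
  have "dim S' + dim (span {e}) = dim S"
    unfolding S'_def using e Suc.prems
    by (intro dim_subspace_orthogonal_to_vectors) (auto simp: span_minimal)
  moreover have "dim (span {e}) = 1" using e by (auto simp: dim_span)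
  ultimately have "n = dim S'" using Suc.hyps(2) by simp
  moreover have "subspace S'"
  proof (rule subspaceI)
    show "0 \<in> S'" by (rule S'e(1)) (simp_all add: subspace_0[OF Suc.prems])
    show "x + y \<in> S'" if "x \<in> S'" "y \<in> S'" for x y
      using S'e(2)[OF that(1)] S'e(2)[OF that(2)]
      by (intro S'e(1)) (simp_all add: subspace_add[OF Suc.prems] inner_add_left)
    show "c *\<^sub>R x \<in> S'" if "x \<in> S'" for c x
      using S'e(2)[OF that] by (intro S'e(1)) (simp_all add: subspace_scale[OF Suc.prems])
  qed
  ultimately obtain B where B: "B \<subseteq> S'" "finite B" "card B = n" and
    BS: "\<And>v. v \<in> S' \<Longrightarrow> (\<Sum>b\<in>B. (v \<bullet> b) *\<^sub>R b) = v"
    "\<And>v b. v \<in> S' \<Longrightarrow> b \<in> B \<Longrightarrow> \<bar>v \<bullet> b\<bar> * \<nu> b \<le> 2 ^ n * \<nu> v"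
    using Suc.hyps(1)[of S'] by metis
  have eB: "e \<notin> B" using B(1) S'e(2) ee by fastforce
  have "(\<Sum>b\<in>insert e B. (v \<bullet> b) *\<^sub>R b) = v \<and>
      (\<forall>b\<in>insert e B. \<bar>v \<bullet> b\<bar> * \<nu> b \<le> 2 ^ Suc n * \<nu> v)" if v: "v \<in> S" for v
  proof -
    define w where "w = v - (v \<bullet> e) *\<^sub>R e"
    have w: "w \<in> S'"
      using v e Suc.prems ee unfolding w_def
      by (intro S'e(1)) (auto intro: subspace_diff subspace_scale simp: inner_diff_left)
    have wb: "w \<bullet> b = v \<bullet> b" if "b \<in> B" for b
      using that B(1) S'e(2) unfolding w_def by (auto simp: inner_diff_left inner_commute[of e])
    have "(\<Sum>b\<in>insert e B. (v \<bullet> b) *\<^sub>R b) = (v \<bullet> e) *\<^sub>R e + (\<Sum>b\<in>B. (w \<bullet> b) *\<^sub>R b)"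
      using B(2) eB by (simp add: wb)
    also have "\<dots> = v" using BS(1)[OF w] by (simp add: w_def)
    finally have 1: "(\<Sum>b\<in>insert e B. (v \<bullet> b) *\<^sub>R b) = v" .
    have "norm v * \<nu> e \<le> \<nu> v"
    proof (cases "v = 0")
      case False
      have "\<nu> e \<le> \<nu> ((1 / norm v) *\<^sub>R v)"
        using v False Suc.prems by (intro min) (auto intro: subspace_scale)
      then show ?thesis using False by (simp add: hom field_simps)
    qed (simp add: \<nu>0)
    moreover have "\<bar>v \<bullet> e\<bar> * \<nu> e \<le> norm v * \<nu> e"
      using Cauchy_Schwarz_ineq2[of v e] e pos by (intro mult_right_mono) auto
    ultimately have 2: "\<bar>v \<bullet> e\<bar> * \<nu> e \<le> \<nu> v" by linarith
    \<comment> \<open>Projecting off \<open>e\<close> at most doubles the seminorm, because the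
      removed component costs no more than \<open>\<nu> v\<close> by the minimality of
      \<open>e\<close>. This doubling in each dimension is the source of
      \<open>2 ^ dim S\<close>.\<close>
    have "\<nu> w \<le> \<nu> v + \<nu> ((- (v \<bullet> e)) *\<^sub>R e)" using tri[of v "(- (v \<bullet> e)) *\<^sub>R e"] by (simp add: w_def)
    then have 3: "\<nu> w \<le> 2 * \<nu> v" using 2 hom[of "- (v \<bullet> e)" e] by simp
    have "\<bar>v \<bullet> b\<bar> * \<nu> b \<le> 2 ^ Suc n * \<nu> v" if "b \<in> B" for b
    proof -
      have "\<bar>v \<bullet> b\<bar> * \<nu> b \<le> 2 ^ n * \<nu> w" using BS(2)[OF w that] wb[OF that] by simp
      also have "\<dots> \<le> 2 ^ n * (2 * \<nu> v)" using 3 by (intro mult_left_mono) auto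
      finally show ?thesis by simp
    qed
    moreover have "\<nu> v \<le> 2 ^ Suc n * \<nu> v"
      using mult_right_mono[OF one_le_power[of "2::real" "Suc n"] pos[of v]] by simp
    ultimately show ?thesis using 1 2 by (metis insert_iff order_trans)
  qed
  moreover have "insert e B \<subseteq> S" "finite (insert e B)" "card (insert e B) = dim S"
    using B e S'e(2) eB Suc.hyps(2) by auto
  ultimately show ?case unfolding Suc.hyps(2)[symmetric] by blast
qed


subsection \<open>Averages over laminar families\<close>

definition avg :: "'x measure \<Rightarrow> 'x set \<Rightarrow> ('x \<Rightarrow> real) \<Rightarrow> real" where
  "avg M Q u = (LINT y:Q|M. u y) / measure M Q"

lemma avg_nonneg: "(\<And>y. 0 \<le> u y) \<Longrightarrow> 0 \<le> avg M Q u"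
  unfolding avg_def set_lebesgue_integral_def by (intro divide_nonneg_nonneg integral_nonneg_AE) auto

lemma avg_mono:
  assumes "set_integrable M Q u" "set_integrable M Q v" "\<And>y. u y \<le> v y"
  shows "avg M Q u \<le> avg M Q v"
  unfolding avg_def using assms by (intro divide_right_mono set_integral_mono) auto

lemma avg_sum:
  assumes "\<And>i. i \<in> I \<Longrightarrow> set_integrable M Q (u i)"
  shows "avg M Q (\<lambda>y. \<Sum>i\<in>I. u i y) = (\<Sum>i\<in>I. avg M Q (u i))"
  using assms unfolding avg_def set_lebesgue_integral_def set_integrable_def
  by (simp add: sum_divide_distrib sum_distrib_left)

lemma set_integrable_inner_abs:
  fixes g :: "'x \<Rightarrow> 'a::euclidean_space"
  assumes "set_integrable M Q g" shows "set_integrable M Q (\<lambda>y. \<bar>v \<bullet> g y\<bar>)"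
proof -
  have "integrable M (\<lambda>y. \<bar>v \<bullet> (indicator Q y *\<^sub>R g y)\<bar>)"
    using assms unfolding set_integrable_def by (intro integrable_abs integrable_inner_right) auto
  then show ?thesis unfolding set_integrable_def by (simp add: abs_mult)
qed

lemma set_integrable_norm_linear:
  fixes g :: "'x \<Rightarrow> 'a::euclidean_space" and T :: "'a \<Rightarrow> 'b::euclidean_space"
  assumes "set_integrable M Q g" "linear T" shows "set_integrable M Q (\<lambda>y. norm (T (g y)))"
proof -
  have "integrable M (\<lambda>y. norm (T (indicator Q y *\<^sub>R g y)))"
    using assms unfolding set_integrable_def
    by (intro integrable_norm integrable_bounded_linear[of T] linear_linear[THEN iffD2]) auto
  then show ?thesis unfolding set_integrable_def using assms(2) by (simp add: linear_scale)
qed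

text \<open>Applied to the seminorm \<open>v \<mapsto> avg M Q0 \<bar>v \<bullet> g\<bar>\<close>, an adapted basis reduces the control of all
  linear \<open>T\<close> to finitely many scalar stopping conditions.\<close>

lemma stopping_directions:
  fixes g :: "'x \<Rightarrow> 'a::euclidean_space"
  assumes g: "set_integrable M Q0 g" and Q0: "Q0 \<in> sets M"
  obtains B :: "'a set" where "finite B" "card B = DIM('a)"
    "\<And>Q (T :: 'a \<Rightarrow> 'b::euclidean_space). Q \<in> sets M \<Longrightarrow> Q \<subseteq> Q0 \<Longrightarrow> linear T \<Longrightarrow>
      (\<And>b. b \<in> B \<Longrightarrow> avg M Q (\<lambda>y. \<bar>b \<bullet> g y\<bar>) \<le> 2 * DIM('a) * avg M Q0 (\<lambda>y. \<bar>b \<bullet> g y\<bar>)) \<Longrightarrow>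
      avg M Q (\<lambda>y. norm (T (g y)))
        \<le> real DIM('b) * (DIM('a) * (2 * DIM('a) * 2 ^ DIM('a))) * avg M Q0 (\<lambda>y. norm (T (g y)))"
proof -
  define \<nu> where "\<nu> Q v = avg M Q (\<lambda>y. \<bar>v \<bullet> g y\<bar>)" for Q v
  have pos: "0 \<le> \<nu> Q v" for Q v unfolding \<nu>_def by (intro avg_nonneg) auto
  have tri: "\<nu> Q (v + w) \<le> \<nu> Q v + \<nu> Q w" if "set_integrable M Q g" for Q v w
  proof -
    have *: "set_integrable M Q (\<lambda>y. \<bar>v \<bullet> g y\<bar>)" for v by (rule set_integrable_inner_abs[OF that])
    have "\<nu> Q (v + w) \<le> avg M Q (\<lambda>y. \<bar>v \<bullet> g y\<bar> + \<bar>w \<bullet> g y\<bar>)"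
      unfolding \<nu>_def
    proof (rule avg_mono)
      show "\<bar>(v + w) \<bullet> g y\<bar> \<le> \<bar>v \<bullet> g y\<bar> + \<bar>w \<bullet> g y\<bar>" for y by (simp add: inner_add_left)
    qed (intro * set_integral_add(1))+
    also have "\<dots> = \<nu> Q v + \<nu> Q w"
      unfolding \<nu>_def avg_def using * by (simp add: set_integral_add(2) add_divide_distrib)
    finally show ?thesis .
  qed
  have hom: "\<nu> Q (c *\<^sub>R v) = \<bar>c\<bar> * \<nu> Q v" for Q c v
    unfolding \<nu>_def avg_def by (simp add: abs_mult)
  have zero: "\<nu> Q 0 = 0" for Q using hom[of Q 0 0] by simp
  obtain B :: "'a set" where B: "finite B" "card B = DIM('a)"
    and rep: "\<And>v. (\<Sum>b\<in>B. (v \<bullet> b) *\<^sub>R b) = v"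
    and est: "\<And>v b. b \<in> B \<Longrightarrow> \<bar>v \<bullet> b\<bar> * \<nu> Q0 b \<le> 2 ^ DIM('a) * \<nu> Q0 v"
    using seminorm_adapted_basis[of "\<nu> Q0" UNIV] tri[OF g] hom by (auto simp: dim_UNIV)
  show ?thesis
  proof (rule that[OF B])
    fix Q and T :: "'a \<Rightarrow> 'b"
    assume Q: "Q \<in> sets M" "Q \<subseteq> Q0" and T: "linear T"
      and small: "\<And>b. b \<in> B \<Longrightarrow> avg M Q (\<lambda>y. \<bar>b \<bullet> g y\<bar>) \<le> 2 * DIM('a) * avg M Q0 (\<lambda>y. \<bar>b \<bullet> g y\<bar>)"
    have gQ: "set_integrable M Q g" by (rule set_integrable_subset[OF g Q])
    have sum_le: "\<nu> Q (\<Sum>b\<in>F. c b *\<^sub>R b) \<le> (\<Sum>b\<in>F. \<bar>c b\<bar> * \<nu> Q b)" if "finite F" for F c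
      using that
    proof induction
      case (insert b F)
      then show ?case using tri[OF gQ, of "c b *\<^sub>R b" "\<Sum>b\<in>F. c b *\<^sub>R b"] by (simp add: hom)
    qed (simp add: zero)
    \<comment> \<open>Expand \<open>v\<close> in \<open>B\<close>: each of the
      \<open>DIM('a)\<close> terms pays the threshold \<open>2 * DIM('a)\<close> for passing from
      \<open>Q\<close> to \<open>Q0\<close>, and \<open>2 ^ DIM('a)\<close> for the adapted
      basis.\<close>
    have est': "\<nu> Q v \<le> DIM('a) * (2 * DIM('a) * 2 ^ DIM('a)) * \<nu> Q0 v" for v
    proof -
      have "\<nu> Q v \<le> (\<Sum>b\<in>B. \<bar>v \<bullet> b\<bar> * \<nu> Q b)" using sum_le[OF B(1), of "\<lambda>b. v \<bullet> b"] by (simp add: rep)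
      also have "\<dots> \<le> (\<Sum>b\<in>B. 2 * DIM('a) * 2 ^ DIM('a) * \<nu> Q0 v)"
      proof (rule sum_mono)
        fix b assume b: "b \<in> B"
        have "\<bar>v \<bullet> b\<bar> * \<nu> Q b \<le> \<bar>v \<bullet> b\<bar> * (2 * DIM('a) * \<nu> Q0 b)"
          using small[OF b] by (intro mult_left_mono) (auto simp: \<nu>_def)
        also have "\<dots> = 2 * DIM('a) * (\<bar>v \<bullet> b\<bar> * \<nu> Q0 b)" by simp
        also have "\<dots> \<le> 2 * DIM('a) * (2 ^ DIM('a) * \<nu> Q0 v)"
          using est[OF b] by (intro mult_left_mono) auto
        finally show "\<bar>v \<bullet> b\<bar> * \<nu> Q b \<le> 2 * DIM('a) * 2 ^ DIM('a) * \<nu> Q0 v" by simp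
      qed
      also have "\<dots> = DIM('a) * (2 * DIM('a) * 2 ^ DIM('a)) * \<nu> Q0 v" using B by simp
      finally show ?thesis .
    qed
    let ?K = "real DIM('a) * (2 * DIM('a) * 2 ^ DIM('a))"
    \<comment> \<open>Every coordinate of \<open>T (g y)\<close> is a scalar product with
      \<open>g y\<close>, so the bound for all directions \<open>v\<close> applies to it; summing
      over the coordinates costs \<open>DIM('b)\<close>.\<close>
    have adj: "T (g y) \<bullet> b = adjoint T b \<bullet> g y" for y b
      using adjoint_works[OF T, of "g y" b] by (simp add: inner_commute)
    have "avg M Q (\<lambda>y. norm (T (g y))) \<le> avg M Q (\<lambda>y. \<Sum>b\<in>Basis. \<bar>adjoint T b \<bullet> g y\<bar>)"
    proof (rule avg_mono)
      show "set_integrable M Q (\<lambda>y. norm (T (g y)))" by (rule set_integrable_norm_linear[OF gQ T])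
      show "set_integrable M Q (\<lambda>y. \<Sum>b\<in>Basis. \<bar>adjoint T b \<bullet> g y\<bar>)"
        using set_integrable_inner_abs[OF gQ] unfolding set_integrable_def scaleR_sum_right
        by (intro Bochner_Integration.integrable_sum)
      show "norm (T (g y)) \<le> (\<Sum>b\<in>Basis. \<bar>adjoint T b \<bullet> g y\<bar>)" for y
        using norm_le_l1[of "T (g y)"] by (simp add: adj)
    qed
    also have "\<dots> = (\<Sum>b\<in>Basis. \<nu> Q (adjoint T b))"
      unfolding \<nu>_def by (intro avg_sum set_integrable_inner_abs[OF gQ])
    also have "\<dots> \<le> (\<Sum>b\<in>(Basis :: 'b set). ?K * avg M Q0 (\<lambda>y. norm (T (g y))))"
    proof (rule sum_mono)
      fix b :: 'b assume b: "b \<in> Basis"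
      have "\<nu> Q0 (adjoint T b) \<le> avg M Q0 (\<lambda>y. norm (T (g y)))"
        unfolding \<nu>_def adj[symmetric]
      proof (rule avg_mono)
        show "set_integrable M Q0 (\<lambda>y. \<bar>T (g y) \<bullet> b\<bar>)"
          unfolding adj by (rule set_integrable_inner_abs[OF g])
        show "set_integrable M Q0 (\<lambda>y. norm (T (g y)))" by (rule set_integrable_norm_linear[OF g T])
        show "\<bar>T (g y) \<bullet> b\<bar> \<le> norm (T (g y))" for y by (rule Basis_le_norm[OF b])
      qed
      then have "?K * \<nu> Q0 (adjoint T b) \<le> ?K * avg M Q0 (\<lambda>y. norm (T (g y)))"
        by (intro mult_left_mono) auto
      with est'[of "adjoint T b"] show "\<nu> Q (adjoint T b) \<le> ?K * avg M Q0 (\<lambda>y. norm (T (g y)))"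
        unfolding of_nat_mult by linarith
    qed
    finally show "avg M Q (\<lambda>y. norm (T (g y)))
        \<le> real DIM('b) * (DIM('a) * (2 * DIM('a) * 2 ^ DIM('a))) * avg M Q0 (\<lambda>y. norm (T (g y)))"
      by simp
  qed
qed

text \<open>Induction on the family: a maximal set \<open>Q0\<close> dominates, up to a constant, every smaller set
  that lies in no stopping set, and the stopping sets cover at most half of \<open>Q0\<close>.\<close>

proposition laminar_maximal_bound:
  fixes g :: "'x \<Rightarrow> 'a::euclidean_space" and W :: "'x \<Rightarrow> 'a \<Rightarrow> 'b::euclidean_space"
    and M :: "'x measure" and a :: "'x set \<Rightarrow> real" and \<tau> :: "'x \<Rightarrow> ennreal"
  defines "H \<equiv> \<lambda>Q x. a Q * avg M Q (\<lambda>y. norm (W x (g y)))"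
    and "K \<equiv> real DIM('b) * (DIM('a) * (2 * DIM('a) * 2 ^ DIM('a)))"
  assumes "finite \<F>" and lam: "laminar \<F>" and sets: "\<F> \<subseteq> sets M"
    and meas: "\<And>Q. Q \<in> \<F> \<Longrightarrow> 0 < measure M Q"
    and g: "\<And>Q. Q \<in> \<F> \<Longrightarrow> set_integrable M Q g" and W: "\<And>x. linear (W x)"
    and a: "\<And>Q. 0 \<le> a Q" "\<And>Q Q'. Q \<in> \<F> \<Longrightarrow> Q' \<in> \<F> \<Longrightarrow> Q \<subseteq> Q' \<Longrightarrow> a Q \<le> a Q'"
    and H[measurable]: "\<And>Q. Q \<in> \<F> \<Longrightarrow> H Q \<in> borel_measurable M"
    and \<tau>[measurable]: "\<tau> \<in> borel_measurable M" and q: "0 < q"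
    and local: "\<And>Q y. Q \<in> \<F> \<Longrightarrow> y \<in> Q \<Longrightarrow>
      (\<integral>\<^sup>+x\<in>Q. ennreal (H Q x powr q) \<partial>M) \<le> B * emeasure M Q * \<tau> y"
  shows "(\<integral>\<^sup>+x. (SUP Q\<in>\<F>. ennreal (H Q x powr q) * indicator Q x) \<partial>M)
    \<le> ennreal (2 * K powr q) * B * (\<integral>\<^sup>+x\<in>\<Union>\<F>. \<tau> x \<partial>M)"
proof -
  define h where "h Q x = ennreal (H Q x powr q) * indicator Q x" for Q x
  have hm: "h Q \<in> borel_measurable M" if "Q \<in> \<F>" for Q
  proof -
    have [measurable]: "H Q \<in> borel_measurable M" "Q \<in> sets M" using that H sets by auto
    show ?thesis unfolding h_def by measurable
  qed
  have supm: "(\<lambda>x. SUP Q\<in>\<G>. h Q x) \<in> borel_measurable M" if "\<G> \<subseteq> \<F>" for \<G>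
    using that hm finite_subset[OF that \<open>finite \<F>\<close>]
    by (intro borel_measurable_SUP) (auto intro: countable_finite)
  \<comment> \<open>Positive \<open>measure\<close> forces finite \<open>emeasure\<close>, since
    \<open>measure\<close> takes the value 0 on sets of infinite measure.\<close>
  have em: "emeasure M Q = ennreal (measure M Q)" if "Q \<in> \<F>" for Q
    using meas[OF that] by (intro emeasure_eq_ennreal_measure) (auto simp: measure_def)
  have K: "0 \<le> K" by (simp add: K_def)
  have "(\<integral>\<^sup>+x. (SUP Q\<in>\<G>. h Q x) \<partial>M) \<le> ennreal (2 * K powr q) * B * (\<integral>\<^sup>+x\<in>\<Union>\<G>. \<tau> x \<partial>M)"
    if "finite \<G>" "\<G> \<subseteq> \<F>" for \<G>
    using that
  proof (induction rule: finite_psubset_induct)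
    case (psubset \<G>)
    show ?case
    proof (cases "\<G> = {}")
      case False
      then obtain Q0 where Q0: "Q0 \<in> \<G>" and max: "\<And>Q. Q \<in> \<G> \<Longrightarrow> Q0 \<subseteq> Q \<Longrightarrow> Q0 = Q"
        using finite_has_maximal[OF psubset.hyps] by metis
      have Q0F: "Q0 \<in> \<F>" using Q0 psubset.prems by (rule subsetD[rotated])
      have Q0s[measurable]: "Q0 \<in> sets M" using Q0F sets by (rule subsetD[rotated])
      have m0: "0 < measure M Q0" by (rule meas[OF Q0F])
      obtain D :: "'a set" where D: "finite D" "card D = DIM('a)"
        and small: "\<And>Q (T :: 'a \<Rightarrow> 'b). Q \<in> sets M \<Longrightarrow> Q \<subseteq> Q0 \<Longrightarrow> linear T \<Longrightarrow>
          (\<And>b. b \<in> D \<Longrightarrow> avg M Q (\<lambda>y. \<bar>b \<bullet> g y\<bar>) \<le> 2 * DIM('a) * avg M Q0 (\<lambda>y. \<bar>b \<bullet> g y\<bar>)) \<Longrightarrow>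
          avg M Q (\<lambda>y. norm (T (g y))) \<le> K * avg M Q0 (\<lambda>y. norm (T (g y)))"
        unfolding K_def by (fact stopping_directions[OF g[OF Q0F] Q0s, where 'b='b])
      define \<S> where "\<S> b = {Q\<in>\<G>. Q \<subseteq> Q0 \<and>
        2 * DIM('a) * avg M Q0 (\<lambda>y. \<bar>b \<bullet> g y\<bar>) < avg M Q (\<lambda>y. \<bar>b \<bullet> g y\<bar>)}" for b
      define St where "St = (\<Union>b\<in>D. \<S> b)"
      have SG: "\<S> b \<subseteq> \<G>" for b by (auto simp: \<S>_def)
      have SF: "\<S> b \<subseteq> \<F>" for b using SG psubset.prems by (rule order_trans)
      have SM: "\<S> b \<subseteq> sets M" for b using SG psubset.prems sets by blast
      have finS: "finite (\<S> b)" for b using SG psubset.hyps finite_subset by blast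
      have half: "2 * DIM('a) * measure M (\<Union>(\<S> b)) \<le> measure M Q0" for b
      proof -
        let ?\<phi> = "\<lambda>y. \<bar>b \<bullet> g y\<bar>"
        have int: "set_integrable M Q0 ?\<phi>" by (rule set_integrable_inner_abs[OF g[OF Q0F]])
        have pos: "0 \<le> avg M Q0 ?\<phi>" by (rule avg_nonneg) simp
        have mQ: "0 < measure M Q" if "Q \<in> \<S> b" for Q using that SG psubset.prems meas by blast
        have *: "2 * DIM('a) * avg M Q0 ?\<phi> * measure M (\<Union>(\<S> b)) \<le> (LINT y:Q0|M. ?\<phi> y)"
        proof (rule laminar_weak_type[OF finS _ SM Q0s _ _ int])
          show "laminar (\<S> b)" using lam SG psubset.prems by (blast intro: laminar_subset)
          show "emeasure M Q < \<infinity>" if "Q \<in> \<S> b" for Q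
            using em[OF subsetD[OF SF that]] by simp
          show "2 * DIM('a) * avg M Q0 ?\<phi> * measure M Q \<le> (LINT y:Q|M. ?\<phi> y)" if "Q \<in> \<S> b" for Q
          proof -
            have "2 * DIM('a) * avg M Q0 ?\<phi> \<le> avg M Q ?\<phi>" using that by (simp add: \<S>_def)
            then show ?thesis using mQ[OF that] by (simp add: avg_def[of M Q] field_simps)
          qed
        qed (use pos in \<open>auto simp: \<S>_def\<close>)
        show ?thesis
        \<comment> \<open>If the average over \<open>Q0\<close> vanishes, the weak-type bound is
          void. In that case the integral over each subset vanishes too, so the strict inequality
          defining \<open>\<S> b\<close> is never met.\<close>
        proof (cases "avg M Q0 ?\<phi> = 0")
          case True
          then have zero: "(LINT y:Q0|M. ?\<phi> y) = 0" using m0 by (simp add: avg_def)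
          have "\<S> b = {}"
          proof (rule ccontr)
            assume "\<S> b \<noteq> {}"
            then obtain Q where Q: "Q \<in> \<S> b" by blast
            have "(LINT y:Q|M. ?\<phi> y) \<le> (LINT y:Q0|M. ?\<phi> y)"
              unfolding set_lebesgue_integral_def
            proof (rule integral_mono)
              have "Q \<subseteq> Q0" using Q by (simp add: \<S>_def)
              then show "indicat_real Q y *\<^sub>R ?\<phi> y \<le> indicat_real Q0 y *\<^sub>R ?\<phi> y" for y
                by (auto simp: indicator_def)
              show "integrable M (\<lambda>y. indicat_real Q y *\<^sub>R ?\<phi> y)"
                using set_integrable_subset[OF int subsetD[OF SM Q] \<open>Q \<subseteq> Q0\<close>] by (simp add: set_integrable_def)
            qed (use int in \<open>simp add: set_integrable_def\<close>)
            then have "avg M Q ?\<phi> \<le> 0" using mQ[OF Q] zero by (simp add: avg_def divide_nonpos_pos)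
            then show False using Q True by (simp add: \<S>_def)
          qed
          then show ?thesis by simp
        next
          case False
          have "avg M Q0 ?\<phi> * (2 * DIM('a) * measure M (\<Union>(\<S> b))) \<le> avg M Q0 ?\<phi> * measure M Q0"
            using * m0 by (simp add: avg_def[of M Q0] mult_ac)
          then show ?thesis using False pos by (simp add: mult_le_cancel_left)
        qed
      qed
      define Oo where "Oo = \<Union>St"
      have UOo: "Oo = (\<Union>b\<in>D. \<Union>(\<S> b))" by (auto simp: Oo_def St_def)
      have OoM[measurable]: "Oo \<in> sets M"
        unfolding UOo using D finS SM by (intro sets.finite_UN sets.finite_Union) auto
      have OoQ0: "Oo \<subseteq> Q0" by (auto simp: UOo \<S>_def)
      have "measure M Oo \<le> (\<Sum>b\<in>D. measure M (\<Union>(\<S> b)))"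
        unfolding UOo
      proof (rule measure_UNION_le[OF D(1)])
        show US: "\<Union>(\<S> b) \<in> sets M" for b using finS SM by (intro sets.finite_Union) auto
      qed
      then have "2 * measure M Oo \<le> 2 * (\<Sum>b\<in>D. measure M (\<Union>(\<S> b)))" by simp
      also have "\<dots> \<le> (\<Sum>b\<in>D. measure M Q0 / DIM('a))"
        unfolding sum_distrib_left using half by (intro sum_mono) (simp add: field_simps)
      also have "\<dots> = measure M Q0" using D by simp
      finally have Oo_half: "2 * measure M Oo \<le> measure M Q0" by simp
      define E where "E = Q0 - Oo"
      have EM[measurable]: "E \<in> sets M" unfolding E_def by measurable
      have E_half: "emeasure M Q0 \<le> 2 * emeasure M E"
      proof -
        have fQ0: "Q0 \<in> fmeasurable M" using em[OF Q0F] by (intro fmeasurableI) auto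
        have "measure M E = measure M Q0 - measure M Oo"
          unfolding E_def using fQ0 OoQ0 by (intro measurable_measure_Diff) auto
        moreover have "E \<in> fmeasurable M" unfolding E_def using fQ0 by (intro fmeasurable.Diff fmeasurable_Diff) auto
        ultimately have "measure M Q0 \<le> 2 * measure M E" "emeasure M E = ennreal (measure M E)"
          using Oo_half by (simp_all add: emeasure_eq_measure2)
        then have "emeasure M Q0 \<le> ennreal (2 * measure M E)" using em[OF Q0F] by (simp add: ennreal_leI)
        also have "\<dots> = 2 * emeasure M E"
          using \<open>emeasure M E = _\<close> by (simp add: ennreal_mult)
        finally show ?thesis .
      qed
      \<comment> \<open>The sets left to the induction. Those not inside \<open>Q0\<close> are
        disjoint from it, by laminarity and the maximality of \<open>Q0\<close>; the others lie in
        stopping sets. All of them avoid \<open>E\<close>.\<close>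
      define \<G>' where "\<G>' = {Q\<in>\<G>. \<not> Q \<subseteq> Q0 \<or> (\<exists>Q'\<in>St. Q \<subseteq> Q')}"
      \<comment> \<open>The threshold is at least 1, so \<open>Q0\<close> cannot strictly exceed its
        own average and is no stopping set. Hence \<open>Q0\<close> leaves the family and the
        induction progresses.\<close>
      have Q0St: "\<not> Q0 \<subseteq> Q'" if "Q' \<in> St" for Q'
      proof
        assume "Q0 \<subseteq> Q'"
        moreover have "Q' \<in> \<G>" using that SG by (auto simp: St_def)
        ultimately have "Q' = Q0" using max by blast
        with that obtain b where "b \<in> D" "Q0 \<in> \<S> b" by (auto simp: St_def)
        then have "2 * DIM('a) * avg M Q0 (\<lambda>y. \<bar>b \<bullet> g y\<bar>) < avg M Q0 (\<lambda>y. \<bar>b \<bullet> g y\<bar>)" by (simp add: \<S>_def)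
        moreover have "0 \<le> avg M Q0 (\<lambda>y. \<bar>b \<bullet> g y\<bar>)" by (intro avg_nonneg) simp
        moreover have "1 \<le> 2 * real DIM('a)" using DIM_ge_Suc0[where 'a='a] by linarith
        ultimately show False using mult_right_mono[of 1 "2 * real DIM('a)" "avg M Q0 (\<lambda>y. \<bar>b \<bullet> g y\<bar>)"] by linarith
      qed
      have G': "\<G>' \<subset> \<G>" using Q0 Q0St by (auto simp: \<G>'_def)
      then have G'F: "\<G>' \<subseteq> \<F>" using psubset.prems by blast
      have disj: "\<Union>\<G>' \<inter> E = {}"
      proof -
        have "Q \<inter> E = {}" if Q: "Q \<in> \<G>'" for Q
        proof (cases "Q \<subseteq> Q0")
          case True
          then show ?thesis using Q by (auto simp: \<G>'_def E_def Oo_def)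
        next
          case False
          have "Q \<in> \<G>" using Q by (simp add: \<G>'_def)
          then have "Q \<inter> Q0 = {}"
            using lam psubset.prems Q0F False max[of Q] unfolding laminar_def by (metis order_refl subsetD)
          then show ?thesis by (auto simp: E_def)
        qed
        then show ?thesis by blast
      qed
      have dom: "(SUP Q\<in>\<G>. h Q x) \<le> ennreal (K powr q) * h Q0 x + (SUP Q\<in>\<G>'. h Q x)" for x
      proof (rule SUP_least)
        fix Q assume Q: "Q \<in> \<G>"
        show "h Q x \<le> ennreal (K powr q) * h Q0 x + (SUP Q\<in>\<G>'. h Q x)"
        proof (cases "Q \<in> \<G>'")
          case True
          then have "h Q x \<le> (SUP Q\<in>\<G>'. h Q x)" by (rule SUP_upper)
          then show ?thesis by (rule order_trans) simp
        next
          case False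
          then have Qs: "Q \<subseteq> Q0" and ns: "Q \<notin> St" using Q by (auto simp: \<G>'_def)
          have QF: "Q \<in> \<F>" using Q psubset.prems by blast
          have av: "avg M Q (\<lambda>y. norm (W x (g y))) \<le> K * avg M Q0 (\<lambda>y. norm (W x (g y)))"
            using QF sets Qs ns Q by (intro small W) (auto simp: St_def \<S>_def not_less)
          have nn: "0 \<le> avg M P (\<lambda>y. norm (W x (g y)))" for P by (intro avg_nonneg) simp
          have "H Q x \<le> a Q0 * (K * avg M Q0 (\<lambda>y. norm (W x (g y))))"
            unfolding H_def using av a(1) a(2)[OF QF Q0F Qs] nn by (intro mult_mono) auto
          then have "H Q x \<le> K * H Q0 x" by (simp add: H_def mult_ac)
          then have "H Q x powr q \<le> (K * H Q0 x) powr q"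
            using q nn a(1) by (intro powr_mono2) (auto simp: H_def)
          also have "\<dots> = K powr q * H Q0 x powr q"
            using K nn a(1) by (intro powr_mult) 
          finally have "h Q x \<le> ennreal (K powr q) * h Q0 x"
            using Qs by (auto simp: h_def indicator_def ennreal_leI simp flip: ennreal_mult)
          then show ?thesis by (rule order_trans) simp
        qed
      qed
      \<comment> \<open>The local hypothesis bounds the integral over \<open>Q0\<close> by the value
        of \<open>\<tau>\<close> at any single point. Integrating that bound over \<open>y\<close>
        in \<open>E\<close> and cancelling \<open>emeasure M Q0\<close> against
        \<open>emeasure M E\<close> loses only a factor 2.\<close>
      have loc: "(\<integral>\<^sup>+x. h Q0 x \<partial>M) \<le> 2 * B * (\<integral>\<^sup>+x\<in>E. \<tau> x \<partial>M)"
      proof -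
        let ?I = "\<integral>\<^sup>+x. h Q0 x \<partial>M"
        have "?I * emeasure M Q0 \<le> ?I * (2 * emeasure M E)" by (intro mult_left_mono E_half) simp
        also have "\<dots> = 2 * (\<integral>\<^sup>+x. ?I * indicator E x \<partial>M)" 
          by (subst nn_integral_cmult_indicator) (simp_all add: mult_ac)
        also have "\<dots> \<le> 2 * (\<integral>\<^sup>+x. (B * emeasure M Q0) * (\<tau> x * indicator E x) \<partial>M)"
        proof (intro mult_left_mono nn_integral_mono)
          fix x
          show "?I * indicator E x \<le> (B * emeasure M Q0) * (\<tau> x * indicator E x)"
            using local[OF Q0F, of x] by (cases "x \<in> E") (auto simp: E_def h_def)
        qed simp
        also have "\<dots> = emeasure M Q0 * (2 * B * (\<integral>\<^sup>+x\<in>E. \<tau> x \<partial>M))"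
          by (subst nn_integral_cmult) (auto simp: mult_ac)
        finally have "emeasure M Q0 * ?I \<le> emeasure M Q0 * (2 * B * (\<integral>\<^sup>+x\<in>E. \<tau> x \<partial>M))"
          by (simp add: mult.commute)
        then show ?thesis using m0 em[OF Q0F] by (subst (asm) ennreal_mult_le_mult_iff) auto
      qed
      have [measurable]: "h Q0 \<in> borel_measurable M" by (rule hm[OF Q0F])
      have [measurable]: "\<Union>\<G>' \<in> sets M"
        using G' psubset.hyps G'F sets by (intro sets.finite_Union) (auto intro: finite_subset)
      have "(\<integral>\<^sup>+x. (SUP Q\<in>\<G>. h Q x) \<partial>M)
          \<le> (\<integral>\<^sup>+x. ennreal (K powr q) * h Q0 x + (SUP Q\<in>\<G>'. h Q x) \<partial>M)"
        by (intro nn_integral_mono dom)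
      also have "\<dots> = ennreal (K powr q) * (\<integral>\<^sup>+x. h Q0 x \<partial>M) + (\<integral>\<^sup>+x. (SUP Q\<in>\<G>'. h Q x) \<partial>M)"
        using supm[OF G'F] by (subst nn_integral_add) (auto simp: nn_integral_cmult)
      also have "\<dots> \<le> ennreal (K powr q) * (2 * B * (\<integral>\<^sup>+x\<in>E. \<tau> x \<partial>M))
          + ennreal (2 * K powr q) * B * (\<integral>\<^sup>+x\<in>\<Union>\<G>'. \<tau> x \<partial>M)"
        by (intro add_mono mult_left_mono loc psubset.IH G' G'F) auto
      also have "\<dots> = ennreal (2 * K powr q) * B * ((\<integral>\<^sup>+x\<in>E. \<tau> x \<partial>M) + (\<integral>\<^sup>+x\<in>\<Union>\<G>'. \<tau> x \<partial>M))"
        by (simp add: ennreal_mult distrib_left mult_ac)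
      also have "(\<integral>\<^sup>+x\<in>E. \<tau> x \<partial>M) + (\<integral>\<^sup>+x\<in>\<Union>\<G>'. \<tau> x \<partial>M)
          = (\<integral>\<^sup>+x. \<tau> x * indicator E x + \<tau> x * indicator (\<Union>\<G>') x \<partial>M)"
        by (rule nn_integral_add[symmetric]) measurable
      also have "\<dots> \<le> (\<integral>\<^sup>+x\<in>\<Union>\<G>. \<tau> x \<partial>M)"
      proof (rule nn_integral_mono)
        fix x
        have "\<not> (x \<in> E \<and> x \<in> \<Union>\<G>')" "x \<in> E \<or> x \<in> \<Union>\<G>' \<Longrightarrow> x \<in> \<Union>\<G>"
          using disj G' Q0 by (auto simp: E_def)
        then show "\<tau> x * indicator E x + \<tau> x * indicator (\<Union>\<G>') x \<le> \<tau> x * indicator (\<Union>\<G>) x"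
          by (auto simp: indicator_def)
      qed
      finally show ?thesis by (simp add: mult_left_mono)
    qed (simp add: bot_ennreal)
  qed
  from this[OF \<open>finite \<F>\<close> order_refl] show ?thesis by (simp add: h_def)
qed

subsection \<open>Inequalities for sums of powers\<close>

text \<open>Each term is at most the total, so one may write \<open>x i powr r\<close> as
  \<open>x i\<close> times a power that is bounded by the same power of the total.\<close>

lemma sum_powr_le_powr_sum:
  fixes x :: "'i \<Rightarrow> real"
  assumes "\<And>i. i \<in> I \<Longrightarrow> 0 \<le> x i" and r: "1 \<le> r"
  shows "(\<Sum>i\<in>I. x i powr r) \<le> (\<Sum>i\<in>I. x i) powr r"
proof (cases "finite I")
  case True
  let ?S = "\<Sum>i\<in>I. x i"
  have split: "z powr r = z * z powr (r - 1)" if "0 \<le> z" for z :: real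
    using that by (simp add: powr_mult_base)
  have "(\<Sum>i\<in>I. x i powr r) \<le> (\<Sum>i\<in>I. x i * ?S powr (r - 1))"
  proof (rule sum_mono)
    fix i assume i: "i \<in> I"
    have "x i \<le> ?S" using True i assms(1) by (intro member_le_sum) auto
    then show "x i powr r \<le> x i * ?S powr (r - 1)"
      using assms(1)[OF i] r unfolding split[OF assms(1)[OF i]]
      by (intro mult_left_mono powr_mono2) auto
  qed
  also have "\<dots> = ?S powr r"
    using assms by (simp add: split sum_nonneg flip: sum_distrib_right)
  finally show ?thesis .
qed simp

text \<open>The proof tests against the dual sequence.\<close>

lemma Minkowski_sum_integral:
  fixes a :: "'i \<Rightarrow> 'x \<Rightarrow> real"
  assumes fin: "finite K" and r: "1 \<le> r"
    and int: "\<And>k. k \<in> K \<Longrightarrow> integrable M (a k)" and pos: "\<And>k x. 0 \<le> a k x"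
    and s: "integrable M s" "\<And>x. 0 \<le> s x"
    and le: "\<And>x. (\<Sum>k\<in>K. a k x powr r) \<le> s x powr r"
  shows "(\<Sum>k\<in>K. (LINT x|M. a k x) powr r) \<le> (LINT x|M. s x) powr r"
proof -
  define \<beta> where "\<beta> k = (LINT x|M. a k x)" for k
  define X where "X = (\<Sum>k\<in>K. \<beta> k powr r)"
  have \<beta>: "0 \<le> \<beta> k" for k unfolding \<beta>_def using pos by (intro integral_nonneg_AE) auto
  have X: "0 \<le> X" unfolding X_def by (intro sum_nonneg) auto
  show ?thesis
  proof (cases "r = 1 \<or> X = 0")
    case False
    then have r1: "1 < r" and X0: "0 < X" using r X by auto
    define r' where "r' = r / (r - 1)"
    have r': "1 < r'" "1 / r + 1 / r' = 1" using r1 by (auto simp: r'_def field_simps)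
    \<comment> \<open>The extremal dual sequence: its sum of \<open>r'\<close>-th powers is 1 and
      its pairing with \<open>\<beta>\<close> is \<open>X powr (1 / r)\<close>. The cases
      \<open>r = 1\<close> and \<open>X = 0\<close> are separate because there is no finite dual
      exponent, respectively no normalisation.\<close>
    define w where "w k = \<beta> k powr (r - 1) / X powr ((r - 1) / r)" for k
    have w: "0 \<le> w k" for k by (simp add: w_def)
    have wr: "w k powr r' = \<beta> k powr r / X" for k
      using r1 X0 by (simp add: w_def powr_divide powr_powr r'_def)
    have sw: "(\<Sum>k\<in>K. w k powr r') = 1"
      using X0 unfolding wr by (simp add: X_def flip: sum_divide_distrib)
    have pw: "(\<Sum>k\<in>K. w k * a k x) \<le> s x" for x
    proof (cases "s x = 0")
      case True
      then have "(\<Sum>k\<in>K. a k x powr r) = 0"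
        using le[of x] by (intro antisym sum_nonneg) auto
      then have "a k x = 0" if "k \<in> K" for k
        using that fin by (subst (asm) sum_nonneg_eq_0_iff) auto
      then show ?thesis using s(2) by simp
    next
      case False
      then have sx: "0 < s x" using s(2)[of x] by simp
      \<comment> \<open>Hoelder's inequality at the point \<open>x\<close>, obtained from Young's
        inequality after dividing by \<open>s x\<close>.\<close>
      have "(\<Sum>k\<in>K. w k * (a k x / s x)) \<le> (\<Sum>k\<in>K. (a k x / s x) powr r / r + w k powr r' / r')"
      proof (rule sum_mono)
        fix k
        show "w k * (a k x / s x) \<le> (a k x / s x) powr r / r + w k powr r' / r'"
          using Youngs_inequality[OF r1 r'(1) r'(2), of "a k x / s x" "w k"] pos[of k x] w[of k] sx
          by (simp add: mult.commute)
      qed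
      also have "\<dots> = (\<Sum>k\<in>K. a k x powr r) / s x powr r / r + 1 / r'"
        using pos sx sw by (simp add: sum.distrib powr_divide sum_divide_distrib[symmetric])
      also have "\<dots> \<le> 1 / r + 1 / r'"
        using le[of x] sx r1 by (intro add_right_mono divide_right_mono) (simp_all add: divide_le_eq)
      finally show ?thesis using sx r' by (simp add: sum_divide_distrib[symmetric] divide_le_eq)
    qed
    have "(\<Sum>k\<in>K. w k * \<beta> k) = (LINT x|M. (\<Sum>k\<in>K. w k * a k x))"
      unfolding \<beta>_def using int by (subst Bochner_Integration.integral_sum) auto
    also have "\<dots> \<le> (LINT x|M. s x)"
      using int s pw by (intro integral_mono Bochner_Integration.integrable_sum) auto
    finally have 1: "(\<Sum>k\<in>K. w k * \<beta> k) \<le> (LINT x|M. s x)" .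
    have "w k * \<beta> k = \<beta> k powr r / X powr ((r - 1) / r)" for k
      using \<beta>[of k] by (simp add: w_def powr_mult_base[of "\<beta> k" "r - 1", simplified] mult.commute)
    then have "(\<Sum>k\<in>K. w k * \<beta> k) = X powr 1 / X powr ((r - 1) / r)"
      using X by (simp add: X_def sum_divide_distrib)
    also have "\<dots> = X powr (1 / r)"
      unfolding powr_diff[symmetric] using r1 by (simp add: field_simps)
    finally have "X powr (1 / r) \<le> (LINT x|M. s x)" using 1 by simp
    then have "(X powr (1 / r)) powr r \<le> (LINT x|M. s x) powr r"
      using r1 by (intro powr_mono2) auto
    then show ?thesis using r1 X0 by (simp add: powr_powr X_def \<beta>_def)
  next
    case True
    then show ?thesis
    proof
      assume r: "r = 1"
      have "(\<Sum>k\<in>K. \<beta> k) = (LINT x|M. (\<Sum>k\<in>K. a k x))"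
        unfolding \<beta>_def using int by (subst Bochner_Integration.integral_sum) auto
      also have "\<dots> \<le> (LINT x|M. s x)"
        using int s le pos r by (intro integral_mono Bochner_Integration.integrable_sum) auto
      finally have "(\<Sum>k\<in>K. \<beta> k) \<le> (LINT x|M. s x)" .
      moreover have "0 \<le> (LINT x|M. s x)" using s by (intro integral_nonneg_AE) auto
      ultimately show ?thesis using r \<beta> by (simp add: \<beta>_def)
    next
      assume "X = 0" then show ?thesis by (simp add: X_def \<beta>_def)
    qed
  qed
qed


subsection \<open>Young functions of class \<open>B_class\<close>\<close>

lemma young_nonneg: "young A \<Longrightarrow> 0 \<le> t \<Longrightarrow> 0 \<le> A t"
  by (simp add: young_def)

lemma young_mono: "young A \<Longrightarrow> 0 \<le> s \<Longrightarrow> s \<le> t \<Longrightarrow> A s \<le> A t"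
  by (auto simp: young_def mono_on_def)

lemma young_borel_measurable:
  assumes A: "young A" and h[measurable]: "h \<in> borel_measurable M" and "\<And>x. 0 \<le> h x"
  shows "(\<lambda>x. A (h x)) \<in> borel_measurable M"
proof -
  \<comment> \<open>A Young function may be arbitrary at negative arguments; composing with
    \<open>max 0\<close> gives a continuous function on the whole line that agrees with it along
    \<open>h\<close>.\<close>
  have "continuous_on UNIV (\<lambda>t. A (max 0 t))"
  proof (rule continuous_on_compose2[of "{0..}" A])
    show "continuous_on {0..} A" using A by (simp add: young_def)
    show "continuous_on UNIV (\<lambda>t::real. max 0 t)" by (intro continuous_intros)
  qed auto
  from borel_measurable_continuous_on[OF this h] show ?thesis
    using assms(3) by (simp add: max_absorb2)
qed

text \<open>Convexity and \<open>A 0 = 0\<close> give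
  \<open>A \<epsilon> \<le> \<epsilon> * A 1\<close>. The value 1 / 2 will let the region where the
  argument is below \<open>\<epsilon>\<close> be absorbed into half of the measure of a set.\<close>

lemma young_small_value:
  assumes "young A" obtains \<epsilon> where "0 < \<epsilon>" "\<epsilon> \<le> 1" "A \<epsilon> \<le> 1 / 2"
proof
  define \<epsilon> where "\<epsilon> = 1 / (2 * (A 1 + 1))"
  have A1: "0 \<le> A 1" using assms by (simp add: young_nonneg)
  then show e: "0 < \<epsilon>" "\<epsilon> \<le> 1" by (auto simp: \<epsilon>_def)
  have "A ((1 - \<epsilon>) *\<^sub>R 0 + \<epsilon> *\<^sub>R 1) \<le> (1 - \<epsilon>) * A 0 + \<epsilon> * A 1"
    using assms e by (intro convex_onD[of "{0..}"]) (auto simp: young_def)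
  also have "\<dots> = A 1 / (2 * (A 1 + 1))" using assms by (simp add: young_def \<epsilon>_def)
  also have "\<dots> \<le> 1 / 2" using A1 by (simp add: field_simps)
  finally show "A \<epsilon> \<le> 1 / 2" by simp
qed

text \<open>The integral in \<open>B_class\<close>, discretised. With
  \<open>u = t / 2 powr k\<close>, a term of the sum equals
  \<open>t powr q * A u powr (q / p) / u powr q\<close>, which is comparable to
  \<open>t powr q\<close> times the integral over the interval from \<open>u\<close> to
  \<open>2 * u\<close>. For different \<open>k\<close> these intervals are disjoint, and the cutoff
  \<open>\<epsilon>\<close> keeps them away from the origin.\<close>

lemma B_class_lacunary_sum:
  fixes p q \<epsilon> :: real
  assumes A: "A \<in> B_class p q" and p: "0 < p" "p \<le> q" and e: "0 < \<epsilon>" "\<epsilon> \<le> 1"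
  obtains C where "0 < C" "\<And>(K :: int set) t. finite K \<Longrightarrow> 0 \<le> t \<Longrightarrow>
    (\<Sum>k\<in>K. (if \<epsilon> * 2 powr k < t then 2 powr (k * p) * A (t / 2 powr k) else 0) powr (q / p)) \<le> C * t powr q"
proof -
  have yA: "young A" using A by (simp add: B_class_def)
  define F where "F s = A s powr (q / p) / s powr q * (1 / s)" for s
  have [measurable]: "(\<lambda>s. A (max 0 s)) \<in> borel_measurable borel"
    by (rule young_borel_measurable[OF yA]) auto
  have Fm[measurable]: "(\<lambda>s. ennreal (F s) * indicator {\<epsilon><..} s) \<in> borel_measurable borel"
  proof -
    have "(\<lambda>s. ennreal (F s) * indicator {\<epsilon><..} s)
        = (\<lambda>s. ennreal (A (max 0 s) powr (q / p) / s powr q * (1 / s)) * indicator {\<epsilon><..} s)"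
      using e by (auto simp: F_def indicator_def fun_eq_iff max_absorb2)
    also have "\<dots> \<in> borel_measurable borel" by measurable
    finally show ?thesis .
  qed
  define J where "J = (\<integral>\<^sup>+s. ennreal (F s) * indicator {\<epsilon><..} s \<partial>lborel)"
  \<comment> \<open>The integral in \<open>B_class\<close> starts at 1; between
    \<open>\<epsilon>\<close> and 1 the integrand is simply bounded.\<close>
  have "J \<le> (\<integral>\<^sup>+s. ennreal (F s) * indicator {1..} s \<partial>lborel)
      + (\<integral>\<^sup>+(s::real). ennreal (A 1 powr (q / p) / \<epsilon> powr q * (1 / \<epsilon>)) * indicator {0..1} s \<partial>lborel)"
    unfolding J_def
  proof (rule nn_integral_le_add)
    fix s :: real
    have "F s \<le> A 1 powr (q / p) / \<epsilon> powr q * (1 / \<epsilon>)" if "\<epsilon> < s" "s < 1"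
      unfolding F_def using that e p young_nonneg[OF yA, of s] young_mono[OF yA, of s 1]
      by (intro mult_mono frac_le powr_mono2) auto
    then show "ennreal (F s) * indicator {\<epsilon><..} s \<le> ennreal (F s) * indicator {1..} s +
        ennreal (A 1 powr (q / p) / \<epsilon> powr q * (1 / \<epsilon>)) * indicator {0..1} s"
      using e by (auto simp: indicator_def intro!: ennreal_leI)
  qed auto
  also have "\<dots> < \<infinity>"
    using A by (simp add: B_class_def F_def nn_integral_cmult_indicator ennreal_mult_less_top)
  finally have J: "J < \<infinity>" .
  define C where "C = 2 powr (q + 1) * enn2real J + 1"
  show ?thesis
  proof (rule that[of C])
    show "0 < C" unfolding C_def by (intro add_nonneg_pos mult_nonneg_nonneg) auto
    fix K :: "int set" and t :: real
    assume K: "finite K" and t: "0 \<le> t"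
    define a where "a k = (if \<epsilon> * 2 powr k < t then 2 powr (k * p) * A (t / 2 powr k) else 0)" for k :: int
    define K' where "K' = {k\<in>K. \<epsilon> * 2 powr k < t}"
    define u where "u k = t / 2 powr k" for k :: int
    have a0: "0 \<le> a k" for k using t by (auto simp: a_def young_nonneg[OF yA])
    have tpos: "0 < t" if "k \<in> K'" for k
    proof -
      have "0 < \<epsilon> * 2 powr k" using e by simp
      then show ?thesis using that by (auto simp: K'_def)
    qed
    have single: "ennreal (a k powr (q / p)) \<le> ennreal (2 powr (q + 1) * t powr q) *
        (\<integral>\<^sup>+s. ennreal (F s) * indicator {\<epsilon><..} s * indicator {u k<..<2 * u k} s \<partial>lborel)" if k: "k \<in> K'" for k
    proof -
      have uk: "\<epsilon> < u k" "0 < u k" using k tpos[OF k] by (auto simp: K'_def u_def field_simps)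
      have Au: "0 \<le> A (u k)" using uk by (simp add: young_nonneg[OF yA])
      \<comment> \<open>A lower bound for \<open>F\<close> on the interval: the numerator is taken
        at the left end and the denominators at the right end. Multiplied by the length
        \<open>u k\<close>, this accounts for \<open>2 powr (q + 1)\<close>.\<close>
      let ?c = "A (u k) powr (q / p) / (2 * u k) powr q * (1 / (2 * u k))"
      have "ennreal (?c * u k) = (\<integral>\<^sup>+s. ennreal ?c * indicator {u k<..<2 * u k} s \<partial>lborel)"
        using uk Au by (subst nn_integral_cmult_indicator) (auto simp flip: ennreal_mult)
      also have "\<dots> \<le> (\<integral>\<^sup>+s. ennreal (F s) * indicator {\<epsilon><..} s * indicator {u k<..<2 * u k} s \<partial>lborel)"
      proof (rule nn_integral_mono)
        fix s
        have "?c \<le> F s" if "u k < s" "s < 2 * u k"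
          unfolding F_def using that uk Au p young_mono[OF yA, of "u k" s]
          by (intro mult_mono frac_le powr_mono2) auto
        then show "ennreal ?c * indicator {u k<..<2 * u k} s \<le>
            ennreal (F s) * indicator {\<epsilon><..} s * indicator {u k<..<2 * u k} s"
          using uk by (auto simp: indicator_def intro!: ennreal_leI)
      qed
      finally have *: "ennreal (?c * u k) \<le> \<dots>" .
      have "a k powr (q / p) = 2 powr (k * q) * A (u k) powr (q / p)"
        using k p Au by (simp add: a_def K'_def powr_mult powr_powr u_def)
      also have "2 powr (k * q) = t powr q / u k powr q"
        using tpos[OF k] by (simp add: u_def powr_divide powr_powr)
      also have "t powr q / u k powr q * A (u k) powr (q / p) = 2 powr (q + 1) * t powr q * (?c * u k)"
        using uk by (simp add: powr_mult powr_add field_simps)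
      finally have "ennreal (a k powr (q / p)) = ennreal (2 powr (q + 1) * t powr q) * ennreal (?c * u k)"
        using uk by (simp flip: ennreal_mult)
      also have "\<dots> \<le> ennreal (2 powr (q + 1) * t powr q) *
        (\<integral>\<^sup>+s. ennreal (F s) * indicator {\<epsilon><..} s * indicator {u k<..<2 * u k} s \<partial>lborel)"
        by (intro mult_left_mono *) simp
      finally show ?thesis .
    qed
    have disj: "(\<Sum>k\<in>K'. indicator {u k<..<2 * u k} s) \<le> (1 :: ennreal)" for s
    proof -
      have eq: "k = l" if "u k < s" "s < 2 * u k" "u l < s" "s < 2 * u l" "k \<in> K'" for k l
      proof -
        have t0: "0 < t" using that tpos by blast
        have *: "i \<le> j" if "u j < 2 * u i" for i j
        proof -
          have "2 powr real_of_int i < 2 powr (real_of_int j + 1)"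
            using that t0 by (simp add: u_def field_simps powr_add)
          then have "real_of_int i < real_of_int j + 1" by (subst (asm) powr_less_cancel_iff) auto
          then show ?thesis by linarith
        qed
        show ?thesis using *[of k l] *[of l k] that by linarith
      qed
      have fin: "finite K'" using K by (simp add: K'_def)
      have "(\<Sum>k\<in>K'. indicator {u k<..<2 * u k} s) = (of_nat (card {k\<in>K'. s \<in> {u k<..<2 * u k}}) :: ennreal)"
        using fin by (simp add: indicator_def sum.If_cases Int_def)
      also have "\<dots> \<le> of_nat 1"
      proof -
        have "card {k\<in>K'. s \<in> {u k<..<2 * u k}} \<le> Suc 0"
          by (subst card_le_Suc0_iff_eq) (use fin eq in auto)
        then show ?thesis by (intro of_nat_mono) simp
      qed
      finally show ?thesis by simp
    qed
    have "ennreal (\<Sum>k\<in>K. a k powr (q / p)) = ennreal (\<Sum>k\<in>K'. a k powr (q / p))"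
      using K by (intro arg_cong[of _ _ ennreal] sum.mono_neutral_right) (auto simp: K'_def a_def)
    also have "\<dots> = (\<Sum>k\<in>K'. ennreal (a k powr (q / p)))" by (simp add: sum_ennreal)
    also have "\<dots> \<le> (\<Sum>k\<in>K'. ennreal (2 powr (q + 1) * t powr q) *
        (\<integral>\<^sup>+s. ennreal (F s) * indicator {\<epsilon><..} s * indicator {u k<..<2 * u k} s \<partial>lborel))"
      by (intro sum_mono single)
    also have "\<dots> = ennreal (2 powr (q + 1) * t powr q) *
        (\<integral>\<^sup>+s. ennreal (F s) * indicator {\<epsilon><..} s * (\<Sum>k\<in>K'. indicator {u k<..<2 * u k} s) \<partial>lborel)"
      unfolding sum_distrib_left by (subst nn_integral_sum) (auto simp: sum_distrib_left)
    also have "\<dots> \<le> ennreal (2 powr (q + 1) * t powr q) * (\<integral>\<^sup>+s. ennreal (F s) * indicator {\<epsilon><..} s * 1 \<partial>lborel)"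
      by (intro mult_left_mono nn_integral_mono disj) auto
    also have "\<dots> = ennreal (2 powr (q + 1) * t powr q * enn2real J)"
      using J by (simp add: J_def[symmetric] ennreal_mult)
    finally have "(\<Sum>k\<in>K. a k powr (q / p)) \<le> 2 powr (q + 1) * t powr q * enn2real J"
      by (subst (asm) ennreal_le_iff) auto
    also have "\<dots> \<le> C * t powr q" by (simp add: C_def algebra_simps)
    finally show "(\<Sum>k\<in>K. (if \<epsilon> * 2 powr k < t then 2 powr (k * p) * A (t / 2 powr k) else 0) powr (q / p))
        \<le> C * t powr q" by (simp add: a_def)
  qed
qed

text \<open>For the largest level \<open>\<kappa> Q\<close> admitted by the last hypothesis, the supremum is up to a constant
  factor the \<open>q\<close>-th power of the fractional Orlicz maximal function of \<open>h\<close>. The maximal sets of each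
  level are disjoint, and Minkowski's inequality in the level replaces the summability over the
  levels that would be available for \<open>p = q\<close>.\<close>

lemma Orlicz_maximal_bound:
  fixes p q :: real
  assumes A: "A \<in> B_class p q" and p: "0 < p" "p \<le> q"
  obtains C where "0 < C" "\<And>(M :: 'x measure) \<F> h \<kappa>. finite \<F> \<Longrightarrow> laminar \<F> \<Longrightarrow> \<F> \<subseteq> sets M \<Longrightarrow>
    (\<And>Q. Q \<in> \<F> \<Longrightarrow> 0 < measure M Q) \<Longrightarrow> h \<in> borel_measurable M \<Longrightarrow> (\<And>x. 0 \<le> h x) \<Longrightarrow>
    integrable M (\<lambda>x. h x powr p) \<Longrightarrow>
    (\<And>Q. Q \<in> \<F> \<Longrightarrow> emeasure M Q \<le> (\<integral>\<^sup>+y\<in>Q. ennreal (A (h y / 2 powr (real_of_int (\<kappa> Q)))) \<partial>M)) \<Longrightarrow>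
    (\<integral>\<^sup>+x. (SUP Q\<in>\<F>. ennreal (2 powr (\<kappa> Q * q) * measure M Q powr (q / p - 1)) * indicator Q x) \<partial>M)
      \<le> ennreal (C * (LINT x|M. h x powr p) powr (q / p))"
proof -
  define r where "r = q / p"
  have r: "1 \<le> r" using p by (simp add: r_def)
  have yA: "young A" using A by (simp add: B_class_def)
  obtain \<epsilon> where e: "0 < \<epsilon>" "\<epsilon> \<le> 1" "A \<epsilon> \<le> 1 / 2" by (rule young_small_value[OF yA])
  \<comment> \<open>The part of the Orlicz integrand that survives the cutoff where \<open>A\<close>
    is at most 1 / 2. The scaling \<open>2 powr (k * p)\<close> makes it at most a constant times
    \<open>t powr p\<close>, uniformly in \<open>k\<close>.\<close>
  define a where "a t k = (if \<epsilon> * 2 powr k < t then 2 powr (k * p) * A (t / 2 powr k) else 0)"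
    for t and k :: int
  obtain C where C: "0 < C" "\<And>(K :: int set) t. finite K \<Longrightarrow> 0 \<le> t \<Longrightarrow> (\<Sum>k\<in>K. a t k powr r) \<le> C * t powr q"
    unfolding a_def r_def by (fact B_class_lacunary_sum[OF A p e(1,2)])
  have a0: "0 \<le> a t k" if "0 \<le> t" for t k using that by (simp add: a_def young_nonneg[OF yA])
  have Cr: "C * t powr q = (C powr (1 / r) * t powr p) powr r" if "0 \<le> t" for t
    using C(1) r p that by (simp add: powr_mult powr_powr r_def)
  have a_le: "a t k \<le> C powr (1 / r) * t powr p" if "0 \<le> t" for t k
  proof -
    have "a t k powr r \<le> (C powr (1 / r) * t powr p) powr r"
      using C(2)[of "{k}" t] that by (simp add: Cr)
    then show ?thesis using r C(1) a0[OF that] powr_less_mono2[of r "C powr (1 / r) * t powr p" "a t k"] by (force simp: not_le[symmetric])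
  qed
  show ?thesis
  proof (rule that[of "2 powr r * C"])
    show "0 < 2 powr r * C" using C by simp
    fix M :: "'x measure" and \<F> h and \<kappa> :: "'x set \<Rightarrow> int"
    assume fin: "finite \<F>" and lam: "laminar \<F>" and sets: "\<F> \<subseteq> sets M"
      and meas: "\<And>Q. Q \<in> \<F> \<Longrightarrow> 0 < measure M Q" and h[measurable]: "h \<in> borel_measurable M"
      and h0: "\<And>x. 0 \<le> h x" and int: "integrable M (\<lambda>x. h x powr p)"
      and large: "\<And>Q. Q \<in> \<F> \<Longrightarrow> emeasure M Q \<le> (\<integral>\<^sup>+y\<in>Q. ennreal (A (h y / 2 powr (real_of_int (\<kappa> Q)))) \<partial>M)"
    have em: "emeasure M Q = ennreal (measure M Q)" if "Q \<in> \<F>" for Q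
      using meas[OF that] by (intro emeasure_eq_ennreal_measure) (auto simp: measure_def)
    have [measurable]: "(\<lambda>x. A (h x / 2 powr real_of_int k)) \<in> borel_measurable M" for k
      using h0 by (intro young_borel_measurable[OF yA]) auto
    have am[measurable]: "(\<lambda>x. a (h x) k) \<in> borel_measurable M" for k
      unfolding a_def by measurable
    have aint: "integrable M (\<lambda>x. a (h x) k)" for k
    proof (rule Bochner_Integration.integrable_bound[OF integrable_mult_right[OF int, of "C powr (1 / r)"]])
      show "AE x in M. norm (a (h x) k) \<le> norm (C powr (1 / r) * h x powr p)"
        using a_le[OF h0] a0[OF h0] by auto
    qed measurable
    \<comment> \<open>Small values of \<open>h\<close> contribute at most half of
      \<open>measure M Q\<close> to the Orlicz integral, so the large values collected in
      \<open>a\<close> must provide the other half. The factor 2 becomes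
      \<open>2 powr r\<close>.\<close>
    have aQ: "measure M Q powr r * 2 powr (\<kappa> Q * q) \<le> 2 powr r * (LINT x:Q|M. a (h x) (\<kappa> Q)) powr r" if Q: "Q \<in> \<F>" for Q
    proof -
      let ?k = "\<kappa> Q"
      have [measurable]: "Q \<in> sets M" using Q sets by blast
      have aiQ: "integrable M (\<lambda>x. indicator Q x * a (h x) ?k)"
        using integrable_mult_indicator[OF _ aint, of Q ?k] by simp
      have pt: "A (h x / 2 powr ?k) \<le> 1 / 2 + 2 powr (- (?k * p)) * a (h x) ?k" for x
      proof (cases "\<epsilon> * 2 powr ?k < h x")
        case False
        then have "A (h x / 2 powr ?k) \<le> A \<epsilon>" using h0 by (intro young_mono[OF yA]) (auto simp: field_simps)
        then show ?thesis using e a0[OF h0, of x ?k] by (simp add: add_increasing2)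
      qed (simp add: a_def powr_minus mult.assoc[symmetric])
      have "ennreal (measure M Q) \<le> (\<integral>\<^sup>+y\<in>Q. ennreal (A (h y / 2 powr ?k)) \<partial>M)"
        using large[OF Q] em[OF Q] by simp
      also have "\<dots> \<le> (\<integral>\<^sup>+y. ennreal (1 / 2) * indicator Q y + ennreal (2 powr (- (?k * p)) * (indicator Q y * a (h y) ?k)) \<partial>M)"
      proof (rule nn_integral_mono)
        fix y
        have "ennreal (A (h y / 2 powr ?k)) \<le> ennreal (1 / 2 + 2 powr (- (?k * p)) * a (h y) ?k)"
          by (rule ennreal_leI) (rule pt)
        also have "\<dots> = ennreal (1 / 2) + ennreal (2 powr (- (?k * p)) * a (h y) ?k)"
          using a0[OF h0] by (intro ennreal_plus) auto
        finally show "ennreal (A (h y / 2 powr ?k)) * indicator Q y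
            \<le> ennreal (1 / 2) * indicator Q y + ennreal (2 powr (- (?k * p)) * (indicator Q y * a (h y) ?k))"
          by (cases "y \<in> Q") auto
      qed
      also have "\<dots> = ennreal (1 / 2) * emeasure M Q + (\<integral>\<^sup>+y. ennreal (2 powr (- (?k * p)) * (indicator Q y * a (h y) ?k)) \<partial>M)"
        by (subst nn_integral_add) (auto simp: nn_integral_cmult_indicator)
      also have "(\<integral>\<^sup>+y. ennreal (2 powr (- (?k * p)) * (indicator Q y * a (h y) ?k)) \<partial>M)
          = ennreal (2 powr (- (?k * p)) * (LINT x:Q|M. a (h x) ?k))"
        using aiQ a0[OF h0] by (subst nn_integral_eq_integral) (auto simp: set_lebesgue_integral_def)
      also have "ennreal (1 / 2) * emeasure M Q = ennreal (measure M Q / 2)"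
        unfolding em[OF Q] by (subst ennreal_mult[symmetric]) simp_all
      also have "ennreal (measure M Q / 2) + ennreal (2 powr (- (?k * p)) * (LINT x:Q|M. a (h x) ?k)) = ennreal (measure M Q / 2 + 2 powr (- (?k * p)) * (LINT x:Q|M. a (h x) ?k))"
        using a0[OF h0] by (subst ennreal_plus)
          (auto simp: set_lebesgue_integral_def intro!: integral_nonneg_AE)
      finally have "measure M Q \<le> measure M Q / 2 + 2 powr (- (?k * p)) * (LINT x:Q|M. a (h x) ?k)"
        using a0[OF h0] by (subst (asm) ennreal_le_iff)
          (auto simp: set_lebesgue_integral_def intro!: integral_nonneg_AE add_nonneg_nonneg mult_nonneg_nonneg)
      then have "measure M Q * 2 powr (?k * p) \<le> 2 * (LINT x:Q|M. a (h x) ?k)"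
        by (simp add: powr_minus field_simps)
      then have "(measure M Q * 2 powr (?k * p)) powr r \<le> (2 * (LINT x:Q|M. a (h x) ?k)) powr r"
        using r by (intro powr_mono2) auto
      moreover have "?k * p * r = ?k * q" using p by (simp add: r_def)
      ultimately show ?thesis
        using a0[OF h0] by (simp add: powr_mult powr_powr set_lebesgue_integral_def integral_nonneg_AE)
    qed
    define K where "K = \<kappa> ` \<F>"
    have finK: "finite K" using fin by (simp add: K_def)
    have "\<exists>\<M>\<subseteq>{Q\<in>\<F>. \<kappa> Q = k}. disjoint \<M> \<and> (\<forall>Q\<in>\<F>. \<kappa> Q = k \<longrightarrow> (\<exists>Q'\<in>\<M>. Q \<subseteq> Q'))" for k
    proof -
      have "finite {Q\<in>\<F>. \<kappa> Q = k}" "laminar {Q\<in>\<F>. \<kappa> Q = k}"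
        using fin laminar_subset[OF lam, of "{Q\<in>\<F>. \<kappa> Q = k}"] by auto
      then show ?thesis by (rule laminar_disjoint_subfamily) blast
    qed
    then obtain \<M> where M: "\<And>k. \<M> k \<subseteq> {Q\<in>\<F>. \<kappa> Q = k}" "\<And>k. disjoint (\<M> k)"
      "\<And>k Q. Q \<in> \<F> \<Longrightarrow> \<kappa> Q = k \<Longrightarrow> \<exists>Q'\<in>\<M> k. Q \<subseteq> Q'" by metis
    have finM: "finite (\<M> k)" for k using M(1)[of k] fin by (auto intro: finite_subset)
    have MF: "Q \<in> \<F>" "\<kappa> Q = k" if "Q \<in> \<M> k" for Q k using that M(1)[of k] by auto
    define w where "w Q = 2 powr (\<kappa> Q * q) * measure M Q powr (r - 1)" for Q
    have w0: "0 \<le> w Q" for Q by (simp add: w_def)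
    \<comment> \<open>Since \<open>r - 1\<close> is nonnegative, \<open>w\<close> does not decrease
      from \<open>Q\<close> to the maximal set of the same level that contains it. So only disjoint
      sets remain within a level, and the supremum can be replaced by a sum.\<close>
    have "(SUP Q\<in>\<F>. ennreal (w Q) * indicator Q x) \<le> (\<Sum>k\<in>K. \<Sum>Q\<in>\<M> k. ennreal (w Q) * indicator Q x)" for x
    proof (rule SUP_least)
      fix Q assume Q: "Q \<in> \<F>"
      obtain Q' where Q': "Q' \<in> \<M> (\<kappa> Q)" "Q \<subseteq> Q'" using M(3)[OF Q refl] by blast
      note Q'F = MF[OF Q'(1)]
      have "measure M Q \<le> measure M Q'"
        using Q' Q Q'F sets em[of Q'] by (intro measure_mono_fmeasurable fmeasurableI) auto
      then have "w Q \<le> w Q'" using r Q'F by (auto simp: w_def intro!: mult_left_mono powr_mono2)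
      then have "ennreal (w Q) * indicator Q x \<le> ennreal (w Q') * indicator Q' x"
        using Q' by (auto simp: indicator_def intro: ennreal_leI)
      also have "\<dots> \<le> (\<Sum>Q\<in>\<M> (\<kappa> Q). ennreal (w Q) * indicator Q x)"
        using finM Q' by (intro member_le_sum) auto
      also have "\<dots> \<le> (\<Sum>k\<in>K. \<Sum>Q\<in>\<M> k. ennreal (w Q) * indicator Q x)"
        using finK Q by (intro member_le_sum[of "\<kappa> Q" K "\<lambda>k. \<Sum>Q\<in>\<M> k. ennreal (w Q) * indicator Q x"]) (auto simp: K_def)
      finally show "ennreal (w Q) * indicator Q x \<le> (\<Sum>k\<in>K. \<Sum>Q\<in>\<M> k. ennreal (w Q) * indicator Q x)" .
    qed
    then have "(\<integral>\<^sup>+x. (SUP Q\<in>\<F>. ennreal (w Q) * indicator Q x) \<partial>M)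
        \<le> (\<integral>\<^sup>+x. (\<Sum>k\<in>K. \<Sum>Q\<in>\<M> k. ennreal (w Q) * indicator Q x) \<partial>M)"
      by (intro nn_integral_mono)
    also have "\<dots> = (\<Sum>k\<in>K. \<Sum>Q\<in>\<M> k. ennreal (w Q) * emeasure M Q)"
    proof -
      have *: "Q \<in> sets M" if "Q \<in> \<M> k" for Q k using MF(1)[OF that] sets by blast
      have "(\<integral>\<^sup>+x. (\<Sum>k\<in>K. \<Sum>Q\<in>\<M> k. ennreal (w Q) * indicator Q x) \<partial>M)
          = (\<Sum>k\<in>K. \<integral>\<^sup>+x. (\<Sum>Q\<in>\<M> k. ennreal (w Q) * indicator Q x) \<partial>M)"
        using * by (intro nn_integral_sum borel_measurable_sum borel_measurable_times borel_measurable_indicator) auto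
      also have "\<dots> = (\<Sum>k\<in>K. \<Sum>Q\<in>\<M> k. \<integral>\<^sup>+x. ennreal (w Q) * indicator Q x \<partial>M)"
        using * by (intro sum.cong refl nn_integral_sum borel_measurable_times borel_measurable_indicator) auto
      also have "\<dots> = (\<Sum>k\<in>K. \<Sum>Q\<in>\<M> k. ennreal (w Q) * emeasure M Q)"
        using * by (intro sum.cong refl nn_integral_cmult_indicator) auto
      finally show ?thesis .
    qed
    also have "\<dots> = ennreal (\<Sum>k\<in>K. \<Sum>Q\<in>\<M> k. w Q * measure M Q)"
    proof -
      have "ennreal (w Q) * emeasure M Q = ennreal (w Q * measure M Q)" if "Q \<in> \<M> k" for Q k
        using em[OF MF(1)[OF that]] w0 by (simp add: ennreal_mult)
      then show ?thesis using w0 by (simp add: sum_ennreal sum_nonneg)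
    qed
    also have "\<dots> \<le> ennreal (2 powr r * C * (LINT x|M. h x powr p) powr r)"
    proof (rule ennreal_leI)
      have "(\<Sum>k\<in>K. \<Sum>Q\<in>\<M> k. w Q * measure M Q) \<le> (\<Sum>k\<in>K. 2 powr r * (LINT x|M. a (h x) k) powr r)"
      proof (rule sum_mono)
        fix k assume "k \<in> K"
        have i0: "0 \<le> (LINT x:Q|M. a (h x) k)" for Q
          using a0[OF h0] unfolding set_lebesgue_integral_def by (intro integral_nonneg_AE) auto
        have iQ: "integrable M (\<lambda>x. indicator Q x *\<^sub>R a (h x) k)" if "Q \<in> \<M> k" for Q
          using MF(1)[OF that] sets by (intro integrable_mult_indicator aint) auto
        have "(\<Sum>Q\<in>\<M> k. w Q * measure M Q) \<le> (\<Sum>Q\<in>\<M> k. 2 powr r * (LINT x:Q|M. a (h x) k) powr r)"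
        proof (rule sum_mono)
          fix Q assume Q: "Q \<in> \<M> k"
          have "w Q * measure M Q = 2 powr (\<kappa> Q * q) * (measure M Q * measure M Q powr (r - 1))"
            by (simp add: w_def)
          also have "\<dots> = measure M Q powr r * 2 powr (\<kappa> Q * q)" by (simp add: powr_mult_base)
          finally show "w Q * measure M Q \<le> 2 powr r * (LINT x:Q|M. a (h x) k) powr r"
            using aQ[OF MF(1)[OF Q]] MF(2)[OF Q] by simp
        qed
        \<comment> \<open>Here \<open>p \<le> q\<close> enters: \<open>r \<ge> 1\<close> allows the
          power to be moved outside the sum. By disjointness the integrals then add up to at most
          one over the whole space.\<close>
        also have "\<dots> \<le> 2 powr r * (\<Sum>Q\<in>\<M> k. LINT x:Q|M. a (h x) k) powr r"
          unfolding sum_distrib_left[symmetric] using i0 r by (intro mult_left_mono sum_powr_le_powr_sum) auto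
        also have "\<dots> \<le> 2 powr r * (LINT x|M. a (h x) k) powr r"
        proof -
          have "(\<Sum>Q\<in>\<M> k. LINT x:Q|M. a (h x) k) = (LINT x|M. (\<Sum>Q\<in>\<M> k. indicator Q x *\<^sub>R a (h x) k))"
            unfolding set_lebesgue_integral_def using iQ by (subst Bochner_Integration.integral_sum) auto
          also have "\<dots> \<le> (LINT x|M. a (h x) k)"
          proof (rule integral_mono)
            show "integrable M (\<lambda>x. \<Sum>Q\<in>\<M> k. indicator Q x *\<^sub>R a (h x) k)"
              using iQ by (intro Bochner_Integration.integrable_sum)
            fix x
            have "(\<Sum>Q\<in>\<M> k. indicator Q x) = (indicator (\<Union>(\<M> k)) x :: real)"
              using finM M(2)[of k] by (intro indicator_UN_disjoint[of "\<M> k" "\<lambda>Q. Q", simplified, symmetric])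
                (auto simp: disjoint_family_on_def disjoint_def)
            then have "(\<Sum>Q\<in>\<M> k. indicator Q x *\<^sub>R a (h x) k) = indicator (\<Union>(\<M> k)) x * a (h x) k"
              by (simp add: sum_distrib_right[symmetric])
            also have "\<dots> \<le> a (h x) k" using a0[OF h0] by (simp add: indicator_def)
            finally show "(\<Sum>Q\<in>\<M> k. indicator Q x *\<^sub>R a (h x) k) \<le> a (h x) k" .
          qed (rule aint)
          finally show ?thesis using r i0 by (intro mult_left_mono powr_mono2 sum_nonneg) auto
        qed
        finally show "(\<Sum>Q\<in>\<M> k. w Q * measure M Q) \<le> 2 powr r * (LINT x|M. a (h x) k) powr r" .
      qed
      also have "\<dots> = 2 powr r * (\<Sum>k\<in>K. (LINT x|M. a (h x) k) powr r)" by (simp add: sum_distrib_left)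
      \<comment> \<open>\<open>Cr\<close> puts the lacunary sum into the pointwise form that
        Minkowski's inequality asks for, with
        \<open>s x = C powr (1 / r) * h x powr p\<close>.\<close>
      also have "\<dots> \<le> 2 powr r * (LINT x|M. C powr (1 / r) * h x powr p) powr r"
        using C(2)[OF finK h0] a0[OF h0] aint int
        by (intro mult_left_mono Minkowski_sum_integral[OF finK r]) (auto simp: Cr[OF h0, symmetric])
      also have "(LINT x|M. C powr (1 / r) * h x powr p) powr r = C * (LINT x|M. h x powr p) powr r"
        using C(1) r by (simp add: powr_mult powr_powr integral_nonneg_AE)
      finally show "(\<Sum>k\<in>K. \<Sum>Q\<in>\<M> k. w Q * measure M Q) \<le> 2 powr r * C * (LINT x|M. h x powr p) powr r"
        by simp
    qed
    finally show "(\<integral>\<^sup>+x. (SUP Q\<in>\<F>. ennreal (2 powr (\<kappa> Q * q) * measure M Q powr (q / p - 1)) * indicator Q x) \<partial>M)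
      \<le> ennreal (2 powr r * C * (LINT x|M. h x powr p) powr (q / p))"
      by (simp add: w_def r_def)
  qed
qed

text \<open>An integer substitute for the Luxemburg norm of \<open>h\<close> on \<open>Q\<close>,
  with respect to \<open>M\<close>, bracketed by \<open>2 powr k\<close> and
  \<open>2 powr (k + 1)\<close>. Take the largest \<open>k\<close> with the first property: such
  \<open>k\<close> exist because \<open>A\<close> grows superlinearly and \<open>h\<close> exceeds a
  positive constant on a set of positive measure, and they are bounded above.\<close>

lemma Orlicz_level_exists:
  fixes p q :: real
  assumes A: "A \<in> B_class p q" and p: "0 < p" "p \<le> q"
    and Q[measurable]: "Q \<in> sets M" and mQ: "0 < measure M Q"
    and h[measurable]: "h \<in> borel_measurable M" and h0: "\<And>x. 0 \<le> h x"
    and int: "integrable M (\<lambda>x. h x powr p)" and nz: "\<not> (AE x in M. x \<in> Q \<longrightarrow> h x = 0)"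
  obtains k :: int where
    "emeasure M Q \<le> (\<integral>\<^sup>+y\<in>Q. ennreal (A (h y / 2 powr k)) \<partial>M)"
    "(\<integral>\<^sup>+y\<in>Q. ennreal (A (h y / 2 powr (k + 1))) \<partial>M) \<le> emeasure M Q"
proof -
  have yA: "young A" using A by (simp add: B_class_def)
  have em: "emeasure M Q = ennreal (measure M Q)"
    using mQ by (intro emeasure_eq_ennreal_measure) (auto simp: measure_def)
  have [measurable]: "(\<lambda>x. A (h x / 2 powr real_of_int k)) \<in> borel_measurable M" for k
    using h0 by (intro young_borel_measurable[OF yA]) auto
  define I where "I k = (\<integral>\<^sup>+y\<in>Q. ennreal (A (h y / 2 powr real_of_int k)) \<partial>M)" for k :: int
  define S where "S = {k. emeasure M Q \<le> I k}"
  obtain C where C: "0 < C" "\<And>(M :: 'a measure) \<F> h \<kappa>. finite \<F> \<Longrightarrow> laminar \<F> \<Longrightarrow> \<F> \<subseteq> sets M \<Longrightarrow>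
    (\<And>Q. Q \<in> \<F> \<Longrightarrow> 0 < measure M Q) \<Longrightarrow> h \<in> borel_measurable M \<Longrightarrow> (\<And>x. 0 \<le> h x) \<Longrightarrow>
    integrable M (\<lambda>x. h x powr p) \<Longrightarrow>
    (\<And>Q. Q \<in> \<F> \<Longrightarrow> emeasure M Q \<le> (\<integral>\<^sup>+y\<in>Q. ennreal (A (h y / 2 powr (real_of_int (\<kappa> Q)))) \<partial>M)) \<Longrightarrow>
    (\<integral>\<^sup>+x. (SUP Q\<in>\<F>. ennreal (2 powr (\<kappa> Q * q) * measure M Q powr (q / p - 1)) * indicator Q x) \<partial>M)
      \<le> ennreal (C * (LINT x|M. h x powr p) powr (q / p))"
    by (fact Orlicz_maximal_bound[OF A p, where 'x='a])
  define D where "D = C * (LINT x|M. h x powr p) powr (q / p)"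
  \<comment> \<open>The bound for the Orlicz maximal function, applied to the one-element family
    \<open>{Q}\<close>, limits the admissible levels.\<close>
  have bound: "2 powr (k * q) \<le> D / measure M Q powr (q / p)" if "k \<in> S" for k
  proof -
    have "(\<integral>\<^sup>+x. (SUP Q\<in>{Q}. ennreal (2 powr (k * q) * measure M Q powr (q / p - 1)) * indicator Q x) \<partial>M) \<le> ennreal D"
      unfolding D_def
      by (rule C(2)[of "{Q}" M h "\<lambda>_. k"])
        (use that mQ h0 int in \<open>auto simp: S_def I_def laminar_def\<close>)
    then have "ennreal (2 powr (k * q) * measure M Q powr (q / p - 1) * measure M Q) \<le> ennreal D"
      by (simp add: nn_integral_cmult_indicator em ennreal_mult)
    then have "2 powr (k * q) * (measure M Q * measure M Q powr (q / p - 1)) \<le> D"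
      using C(1) by (subst (asm) ennreal_le_iff) (auto simp: D_def mult_ac)
    then show ?thesis using mQ by (simp add: powr_mult_base field_simps)
  qed
  have bdd: "\<exists>N::int. \<forall>k\<in>S. k \<le> N"
  proof -
    define D' where "D' = D / measure M Q powr (q / p)"
    have "k \<le> \<lceil>log 2 D' / q\<rceil>" if "k \<in> S" for k
    proof -
      have *: "2 powr (k * q) \<le> D'" using bound[OF that] by (simp add: D'_def)
      then have "0 < D'" by (smt (verit) powr_gt_zero)
      with * have "k * q \<le> log 2 D'" by (simp add: le_log_iff)
      then have "real_of_int k \<le> log 2 D' / q" using p by (simp add: field_simps)
      then show ?thesis by linarith
    qed
    then show ?thesis by blast
  qed
  have ne: "\<exists>k. k \<in> S"
  proof -
    have "\<exists>n::nat. 0 < measure M {x\<in>Q. 1 / Suc n < h x}"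
    proof (rule ccontr)
      assume "\<not> ?thesis"
      then have z: "measure M {x\<in>Q. 1 / Suc n < h x} = 0" for n by (simp add: zero_less_measure_iff)
      have QM: "{x\<in>Q. 1 / Suc n < h x} \<in> sets M" for n
      proof -
        have "{x\<in>Q. 1 / Suc n < h x} = {x\<in>space M. x \<in> Q \<and> 1 / Suc n < h x}"
          using sets.sets_into_space[OF Q] by auto
        also have "\<dots> \<in> sets M" by measurable
        finally show ?thesis .
      qed
      have "emeasure M {x\<in>Q. 1 / Suc n < h x} \<noteq> top" for n
        using emeasure_mono[of "{x\<in>Q. 1 / Suc n < h x}" Q M] em Q by (auto simp: top_unique)
      then have NS: "{x\<in>Q. 1 / Suc n < h x} \<in> null_sets M" for n
        using z[of n] QM[of n] by (intro null_setsI) (auto simp: emeasure_eq_ennreal_measure)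
      have "AE x in M. \<forall>n. x \<notin> {x\<in>Q. 1 / Suc n < h x}"
        by (subst AE_all_countable) (intro allI AE_not_in NS)
      then have "AE x in M. x \<in> Q \<longrightarrow> h x = 0"
      proof eventually_elim
        case (elim x)
        show ?case
        proof (rule impI, rule ccontr)
          assume "x \<in> Q" "h x \<noteq> 0"
          then have "0 < h x" using h0[of x] by simp
          then obtain n where "1 / Suc n < h x" using nat_approx_posE by blast
          with elim \<open>x \<in> Q\<close> show False by auto
        qed
      qed
      with nz show False by simp
    qed
    then obtain n :: nat where n: "0 < measure M {x\<in>Q. 1 / Suc n < h x}" by blast
    define E where "E = {x\<in>Q. 1 / Suc n < h x}"
    have EM[measurable]: "E \<in> sets M" using n unfolding E_def by (metis less_irrefl measure_notin_sets)
    have Ee: "emeasure M E = ennreal (measure M E)"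
      using n by (intro emeasure_eq_ennreal_measure) (auto simp: measure_def E_def)
    \<comment> \<open>\<open>c\<close> is large enough for the integral of the constant
      \<open>c\<close> over \<open>E\<close> to reach the measure of \<open>Q\<close>.
      Superlinearity gives \<open>t\<close> with \<open>A t \<ge> c\<close>, and \<open>k\<close> is
      then taken so negative that \<open>h / 2 powr k\<close> is at least \<open>t\<close> on
      \<open>E\<close>.\<close>
    define c where "c = max 1 (measure M Q / measure M E)"
    have "filterlim (\<lambda>t. A t / t) at_top at_top" using yA by (simp add: young_def)
    then have "eventually (\<lambda>t. c \<le> A t / t) at_top" by (simp add: filterlim_at_top)
    then have "eventually (\<lambda>t. 1 \<le> t \<and> c \<le> A t / t) at_top"
      by (intro eventually_conj eventually_ge_at_top)
    then obtain t where t: "1 \<le> t" "c \<le> A t / t" using eventually_happens'[OF trivial_limit_at_top_linorder] by blast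
    have "c * 1 \<le> c * t" using t by (intro mult_left_mono) (auto simp: c_def)
    also have "\<dots> \<le> A t" using t by (simp add: field_simps)
    finally have At: "c \<le> A t" by simp
    define k where "k = - \<lceil>log 2 (t * Suc n)\<rceil>"
    have tk: "t * Suc n \<le> 2 powr (- real_of_int k)"
    proof -
      have "log 2 (t * Suc n) \<le> - real_of_int k" by (simp add: k_def)
      then show ?thesis using t by (subst (asm) log_le_iff) auto
    qed
    have "emeasure M Q \<le> (\<integral>\<^sup>+y. ennreal c * indicator E y \<partial>M)"
    proof -
      have "measure M Q \<le> c * measure M E"
        using n by (simp add: c_def E_def max_def field_simps split: if_splits)
      then show ?thesis by (simp add: nn_integral_cmult_indicator em Ee ennreal_leI c_def flip: ennreal_mult)
    qed
    also have "\<dots> \<le> I k"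
      unfolding I_def
    proof (rule nn_integral_mono)
      fix y
      show "ennreal c * indicator E y \<le> ennreal (A (h y / 2 powr k)) * indicator Q y"
      proof (cases "y \<in> E")
        case True
        then have y: "y \<in> Q" "1 / Suc n < h y" by (auto simp: E_def)
        have "t = t * Suc n * (1 / Suc n)" by simp
        also have "\<dots> \<le> 2 powr (- real_of_int k) * h y"
          using tk y t by (intro mult_mono) auto
        finally have "t \<le> h y / 2 powr k" by (simp add: powr_minus field_simps)
        then have "A t \<le> A (h y / 2 powr k)" using t by (intro young_mono[OF yA]) auto
        then show ?thesis using True y At by (auto intro!: ennreal_leI)
      qed simp
    qed
    finally show ?thesis by (auto simp: S_def)
  qed
  obtain k where k: "k \<in> S" "k + 1 \<notin> S"
  proof -
    from bdd obtain N where N: "\<forall>k\<in>S. k \<le> N" by blast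
    from ne obtain k0 where k0: "k0 \<in> S" by blast
    let ?T = "S \<inter> {k0..N}"
    have T: "finite ?T" "k0 \<in> ?T" using N k0 by auto
    then have "Max ?T \<in> ?T" by (intro Max_in) auto
    moreover have "Max ?T + 1 \<notin> S"
    proof
      assume *: "Max ?T + 1 \<in> S"
      then have "Max ?T + 1 \<in> ?T" using N \<open>Max ?T \<in> ?T\<close> by auto
      then have "Max ?T + 1 \<le> Max ?T" using T by (intro Max_ge)
      then show False by simp
    qed
    ultimately show ?thesis using that by blast
  qed
  show ?thesis
  proof (rule that[of k])
    show "emeasure M Q \<le> (\<integral>\<^sup>+y\<in>Q. ennreal (A (h y / 2 powr k)) \<partial>M)" using k by (simp add: S_def I_def)
    show "(\<integral>\<^sup>+y\<in>Q. ennreal (A (h y / 2 powr (k + 1))) \<partial>M) \<le> emeasure M Q"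
      using k(2) by (simp add: S_def I_def not_le less_imp_le)
  qed
qed

subsection \<open>The spectral theorem for complex self-adjoint matrices\<close>

text \<open>Linear in the first argument and conjugate-linear in the second. The real product
  \<open>\<bullet>\<close> sees only its real part, whereas unitarity requires orthogonality over
  the complex numbers.\<close>

definition hermitian_inner :: "complex^'n::finite \<Rightarrow> complex^'n \<Rightarrow> complex" where
  "hermitian_inner z w = (\<Sum>i\<in>UNIV. z $ i * cnj (w $ i))"

lemma inner_eq_Re_hermitian: "z \<bullet> w = Re (hermitian_inner z w)"
  by (simp add: hermitian_inner_def inner_vec_def inner_complex_def)

lemma inner_eq_Im_hermitian: "z \<bullet> (\<i> *s w) = Im (hermitian_inner z w)"
  unfolding hermitian_inner_def inner_vec_def inner_complex_def Im_sum
  by (intro sum.cong) (simp_all add: vector_scalar_mult_def)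

text \<open>Complex orthogonality to \<open>w\<close> is real orthogonality to \<open>w\<close> and
  to its multiple by the imaginary unit, which makes it accessible to real dimension counts.\<close>

lemma hermitian_inner_eq_0_iff:
  "hermitian_inner z w = 0 \<longleftrightarrow> z \<bullet> w = 0 \<and> z \<bullet> (\<i> *s w) = 0"
  unfolding inner_eq_Im_hermitian by (simp add: inner_eq_Re_hermitian complex_eq_iff)

lemma hermitian_inner_scaleR_right: "hermitian_inner z (c *\<^sub>R w) = of_real c * hermitian_inner z w"
  by (simp add: hermitian_inner_def sum_distrib_left scaleR_conv_of_real[where 'a=complex] mult_ac)

lemma hermitian_inner_commute: "hermitian_inner w z = cnj (hermitian_inner z w)"
  by (simp add: hermitian_inner_def mult.commute)

lemma hermitian_inner_same: "hermitian_inner z z = of_real (norm z ^ 2)"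
proof -
  have "hermitian_inner z z = (\<Sum>i\<in>UNIV. of_real ((norm (z $ i))\<^sup>2))"
    by (simp only: hermitian_inner_def complex_norm_square)
  also have "\<dots> = of_real (norm z ^ 2)"
    by (simp add: norm_vec_def L2_set_def sum_nonneg)
  finally show ?thesis .
qed

lemma hermitian_inner_matrix:
  "hermitian_inner (A *v z) w = hermitian_inner z (cadjoint A *v w)"
proof -
  have "hermitian_inner (A *v z) w = (\<Sum>i\<in>UNIV. \<Sum>j\<in>UNIV. A $ i $ j * z $ j * cnj (w $ i))"
    by (simp add: hermitian_inner_def matrix_vector_mult_def sum_distrib_right)
  also have "\<dots> = (\<Sum>j\<in>UNIV. \<Sum>i\<in>UNIV. A $ i $ j * z $ j * cnj (w $ i))"
    by (rule sum.swap)
  also have "\<dots> = hermitian_inner z (cadjoint A *v w)"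
    by (simp add: hermitian_inner_def matrix_vector_mult_def cadjoint_def sum_distrib_left mult_ac)
  finally show ?thesis .
qed

text \<open>The maximum of the Rayleigh quotient over an invariant subspace is attained at an eigenvector.\<close>

lemma self_adjoint_eigenvector:
  fixes A :: "complex^'n::finite^'n"
  assumes A: "self_adjoint_mat A" and T: "subspace T" "\<And>z. z \<in> T \<Longrightarrow> A *v z \<in> T" and ne: "z \<in> T" "z \<noteq> 0"
  obtains z0 \<mu> where "z0 \<in> T" "norm z0 = 1" "A *v z0 = \<mu> *\<^sub>R z0"
proof -
  have sym: "(A *v v) \<bullet> w = (A *v w) \<bullet> v" for v w
    using A hermitian_inner_matrix[of A v w]
    by (simp add: inner_eq_Re_hermitian self_adjoint_mat_def hermitian_inner_commute[of "A *v w"])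
  have lin: "A *v (v + t *\<^sub>R w) = A *v v + t *\<^sub>R (A *v w)" for v w and t :: real
    by (simp add: linear_add[of "(*v) A"] linear_scale[of "(*v) A"] bounded_linear.linear)
  have "compact (sphere 0 1 \<inter> T)"
    by (intro compact_Int_closed closed_subspace T) auto
  moreover have "(1 / norm z) *\<^sub>R z \<in> sphere 0 1 \<inter> T"
    using ne T by (auto intro: subspace_scale)
  then have "sphere 0 1 \<inter> T \<noteq> {}" by blast
  moreover have "continuous_on (sphere 0 1 \<inter> T) (\<lambda>z. (A *v z) \<bullet> z)"
    by (intro continuous_intros bounded_linear.continuous_on[OF matrix_vector_mul_bounded_linear])
  ultimately have "\<exists>x\<in>sphere 0 1 \<inter> T. \<forall>y\<in>sphere 0 1 \<inter> T. (A *v y) \<bullet> y \<le> (A *v x) \<bullet> x"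
    by (rule continuous_attains_sup)
  then obtain z0 where z0: "z0 \<in> T" "norm z0 = 1"
    and max: "\<And>y. y \<in> T \<Longrightarrow> norm y = 1 \<Longrightarrow> (A *v y) \<bullet> y \<le> (A *v z0) \<bullet> z0" by auto
  define \<mu> where "\<mu> = (A *v z0) \<bullet> z0"
  then have Az0: "(A *v z0) \<bullet> z0 = \<mu>" by simp
  have max': "(A *v y) \<bullet> y \<le> \<mu> * (y \<bullet> y)" if y: "y \<in> T" for y
  proof (cases "y = 0")
    case False
    have "(A *v ((1 / norm y) *\<^sub>R y)) \<bullet> ((1 / norm y) *\<^sub>R y) \<le> \<mu>"
      unfolding \<mu>_def using y False T by (intro max) (auto intro: subspace_scale)
    moreover have "A *v ((1 / norm y) *\<^sub>R y) = (1 / norm y) *\<^sub>R (A *v y)"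
      by (intro linear_scale bounded_linear.linear) simp
    ultimately show ?thesis using False
      by (simp add: field_simps power2_eq_square flip: power2_norm_eq_inner)
  qed simp
  \<comment> \<open>The residual of the eigenvalue equation. Perturbing the maximiser
    \<open>z0\<close> in this very direction shows that it vanishes.\<close>
  define h where "h = A *v z0 - \<mu> *\<^sub>R z0"
  have h: "h \<in> T" unfolding h_def using T z0 by (intro subspace_diff subspace_scale)
  define d where "d = (A *v h) \<bullet> h - \<mu> * (h \<bullet> h)"
  have z00: "z0 \<bullet> z0 = 1" using z0 by (simp add: norm_eq_1)
  have ineq: "2 * t * (h \<bullet> h) + t ^ 2 * d \<le> 0" for t
  proof -
    have "(A *v (z0 + t *\<^sub>R h)) \<bullet> (z0 + t *\<^sub>R h) \<le> \<mu> * ((z0 + t *\<^sub>R h) \<bullet> (z0 + t *\<^sub>R h))"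
      using T z0 h by (intro max' subspace_add subspace_scale)
    then have "2 * t * ((A *v z0) \<bullet> h) + t ^ 2 * ((A *v h) \<bullet> h)
        \<le> \<mu> * (2 * t * (z0 \<bullet> h) + t ^ 2 * (h \<bullet> h))"
      using sym[of h z0] z00 unfolding lin
      by (simp add: inner_add_left inner_add_right Az0 power2_eq_square algebra_simps inner_commute[of h z0])
    moreover have e: "(A *v z0) \<bullet> h = h \<bullet> h + \<mu> * (z0 \<bullet> h)"
    proof -
      have "h \<bullet> h = (A *v z0 - \<mu> *\<^sub>R z0) \<bullet> h" by (simp only: h_def)
      then show ?thesis by (simp add: inner_diff_left)
    qed
    ultimately show ?thesis unfolding e d_def by (simp add: algebra_simps)
  qed
  have "h \<bullet> h \<le> 0"
  proof -
    \<comment> \<open>With this \<open>t\<close> the quadratic term has at most half the size of the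
      linear one, so the left side of \<open>ineq\<close> could not be nonpositive if
      \<open>h\<close> were nonzero.\<close>
    define t where "t = (if d = 0 then 1 else (h \<bullet> h) / \<bar>d\<bar>)"
    have "0 \<le> h \<bullet> h" by simp
    show ?thesis
    proof (cases "d = 0")
      case True
      then show ?thesis using ineq[of 1] by simp
    next
      case False
      have "2 * t * (h \<bullet> h) + t ^ 2 * d = (h \<bullet> h)\<^sup>2 / \<bar>d\<bar> * (2 + sgn d)"
        using False by (simp add: t_def field_simps power2_eq_square sgn_if)
      then have "(h \<bullet> h)\<^sup>2 / \<bar>d\<bar> * (2 + sgn d) \<le> 0" using ineq[of t] by simp
      moreover have "0 < (2 + sgn d) / \<bar>d\<bar>" using False by (simp add: sgn_if)
      ultimately have "(h \<bullet> h)\<^sup>2 \<le> 0" by (simp add: mult_le_0_iff divide_le_0_iff zero_less_divide_iff sgn_if split: if_splits)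
      then show ?thesis by simp
    qed
  qed
  then have "h = 0" by (metis antisym inner_eq_zero_iff inner_ge_zero)
  then show ?thesis using that[of z0 \<mu>] z0 by (simp add: h_def)
qed

text \<open>Each step finds an eigenvector in the complex orthogonal complement of the previous
  ones, which is invariant because \<open>A\<close> is self-adjoint with real eigenvalues on them.
  The complement is nonzero since \<open>k\<close> vectors and their imaginary multiples span at
  most \<open>2 * k\<close> real dimensions, fewer than those of the space.\<close>

lemma orthonormal_eigenvectors:
  fixes A :: "complex^'n::finite^'n"
  assumes A: "self_adjoint_mat A" and "k \<le> CARD('n)"
  shows "\<exists>v :: nat \<Rightarrow> complex^'n. \<exists>\<mu> :: nat \<Rightarrow> real. \<forall>i<k. A *v v i = \<mu> i *\<^sub>R v i \<and>
    (\<forall>j<k. hermitian_inner (v i) (v j) = (if i = j then 1 else 0))"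
  using assms(2)
proof (induction k)
  case (Suc k)
  then obtain v :: "nat \<Rightarrow> complex^'n" and \<mu> :: "nat \<Rightarrow> real"
    where v: "\<And>i. i < k \<Longrightarrow> A *v v i = \<mu> i *\<^sub>R v i"
      "\<And>i j. i < k \<Longrightarrow> j < k \<Longrightarrow> hermitian_inner (v i) (v j) = (if i = j then 1 else 0)"
    by auto
  define F where "F = v ` {..<k} \<union> (\<lambda>i. \<i> *s v i) ` {..<k}"
  define T where "T = {z. \<forall>i<k. hermitian_inner z (v i) = 0}"
  have "card F \<le> k + k"
    unfolding F_def by (intro order_trans[OF card_Un_le] add_mono order_trans[OF card_image_le]) auto
  moreover have "dim F \<le> card F" by (rule dim_le_card) (auto simp: F_def intro: span_base)
  ultimately have "dim F < DIM(complex^'n)" using Suc.prems by simp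
  then obtain z where z: "z \<noteq> 0" "\<And>y. y \<in> span F \<Longrightarrow> orthogonal z y"
    using orthogonal_to_subspace_exists[of F] by metis
  have zT: "z \<in> T"
    using z(2) by (auto simp: T_def hermitian_inner_eq_0_iff orthogonal_def F_def span_base)
  have "subspace T"
    by (rule subspaceI) (auto simp: T_def hermitian_inner_def algebra_simps sum.distrib scaleR_sum_right[symmetric])
  moreover have "A *v z \<in> T" if "z \<in> T" for z
  proof -
    have "hermitian_inner (A *v z) (v i) = of_real (\<mu> i) * hermitian_inner z (v i)" if "i < k" for i
      using A v(1)[OF that]
      by (simp add: hermitian_inner_matrix self_adjoint_mat_def hermitian_inner_scaleR_right)
    then show ?thesis using that by (simp add: T_def)
  qed
  ultimately obtain z0 \<nu> where z0: "z0 \<in> T" "norm z0 = 1" "A *v z0 = \<nu> *\<^sub>R z0"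
    by (rule self_adjoint_eigenvector[OF A _ _ zT z(1)])
  have orth: "hermitian_inner z0 (v i) = 0" "hermitian_inner (v i) z0 = 0" if "i < k" for i
    using z0(1) that hermitian_inner_commute[of "v i" z0] by (auto simp: T_def)
  have "\<forall>i<Suc k. A *v (v(k := z0)) i = (\<mu>(k := \<nu>)) i *\<^sub>R (v(k := z0)) i \<and>
    (\<forall>j<Suc k. hermitian_inner ((v(k := z0)) i) ((v(k := z0)) j) = (if i = j then 1 else 0))"
    using v z0 orth by (auto simp: less_Suc_eq hermitian_inner_same)
  then show ?case by blast
qed simp

text \<open>The third conclusion exhibits every eigenvalue as a value of the quadratic form on the
  unit sphere; positivity of the eigenvalues of a positive definite matrix is read off from
  it.\<close>

theorem self_adjoint_diagonalization:
  fixes A :: "complex^'n::finite^'n"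
  assumes "self_adjoint_mat A"
  obtains P D where "unitary_mat P" "A = P ** real_diag_mat D ** cadjoint P"
    "\<And>i. \<exists>z. norm z = 1 \<and> D i = (A *v z) \<bullet> z"
proof -
  obtain v :: "nat \<Rightarrow> complex^'n" and \<mu> :: "nat \<Rightarrow> real"
    where v: "\<And>i. i < CARD('n) \<Longrightarrow> A *v v i = \<mu> i *\<^sub>R v i"
      "\<And>i j. i < CARD('n) \<Longrightarrow> j < CARD('n) \<Longrightarrow> hermitian_inner (v i) (v j) = (if i = j then 1 else 0)"
    using orthonormal_eigenvectors[OF assms order_refl] by metis
  obtain e :: "'n \<Rightarrow> nat" where e: "bij_betw e UNIV {0..<CARD('n)}"
    using ex_bij_betw_finite_nat[of "UNIV :: 'n set"] by auto
  have el: "e i < CARD('n)" for i using e by (auto simp: bij_betw_def)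
  have einj: "e i = e j \<longleftrightarrow> i = j" for i j using e by (auto simp: bij_betw_def inj_on_def)
  define P where "P = (\<chi> i j. v (e j) $ i)"
  define D where "D i = \<mu> (e i)" for i
  have "cadjoint P ** P = mat 1"
  proof -
    have "(cadjoint P ** P) $ i $ j = (mat 1 :: complex^'n^'n) $ i $ j" for i j
      using v(2)[OF el el, of j i]
      by (simp add: matrix_matrix_mult_def cadjoint_def P_def mat_def hermitian_inner_def einj mult.commute eq_commute[of j i])
    then show ?thesis by (simp add: vec_eq_iff)
  qed
  moreover from this have PP: "P ** cadjoint P = mat 1" by (simp add: matrix_left_right_inverse)
  ultimately have "unitary_mat P" by (simp add: unitary_mat_def)
  moreover have "A ** P = P ** real_diag_mat D"
  proof -
    have "(A ** P) $ i $ j = (P ** real_diag_mat D) $ i $ j" for i j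
      unfolding real_diag_mat_right
      using arg_cong[OF v(1)[OF el[of j]], of "\<lambda>w. w $ i"]
      by (simp add: matrix_matrix_mult_def matrix_vector_mult_def P_def D_def
          scaleR_conv_of_real[where 'a=complex] mult.commute)
    then show ?thesis by (simp add: vec_eq_iff)
  qed
  then have "A = P ** real_diag_mat D ** cadjoint P" by (metis PP matrix_mul_assoc matrix_mul_rid)
  moreover have "\<exists>z. norm z = 1 \<and> D i = (A *v z) \<bullet> z" for i
  proof (intro exI conjI)
    have "complex_of_real ((norm (v (e i)))\<^sup>2) = of_real 1"
      using v(2)[OF el el, of i i] by (simp only: hermitian_inner_same) simp
    then have "(norm (v (e i)))\<^sup>2 = 1" by (simp only: of_real_eq_iff)
    then show n: "norm (v (e i)) = 1" 
      using norm_ge_zero[of "v (e i)"] unfolding power2_eq_1_iff by linarith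
    then show "D i = (A *v v (e i)) \<bullet> v (e i)" using v(1)[OF el[of i]] by (simp add: D_def norm_eq_1)
  qed
  ultimately show ?thesis by (rule that)
qed

subsection \<open>Powers of positive definite matrices\<close>

lemma conj_diag_nth:
  "(P ** real_diag_mat E ** cadjoint P) $ i $ j = (\<Sum>k\<in>UNIV. P $ i $ k * of_real (E k) * cnj (P $ j $ k))"
proof -
  have "(P ** real_diag_mat E ** cadjoint P) $ i $ j
      = (\<Sum>k\<in>UNIV. (P ** real_diag_mat E) $ i $ k * cadjoint P $ k $ j)"
    by (simp add: matrix_matrix_mult_def)
  then show ?thesis by (simp only: real_diag_mat_right) (simp add: cadjoint_def)
qed

lemma conj_diag_mult:
  assumes "unitary_mat P"
  shows "(P ** real_diag_mat E ** cadjoint P) ** (P ** real_diag_mat F ** cadjoint P)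
    = P ** real_diag_mat (\<lambda>i. E i * F i) ** cadjoint P"
proof -
  have EF: "real_diag_mat E ** real_diag_mat F = real_diag_mat (\<lambda>i. E i * F i)"
    by (simp add: vec_eq_iff real_diag_mat_left) (simp add: real_diag_mat_def)
  have "(P ** real_diag_mat E ** cadjoint P) ** (P ** real_diag_mat F ** cadjoint P)
      = P ** real_diag_mat E ** (cadjoint P ** P) ** real_diag_mat F ** cadjoint P"
    by (simp only: matrix_mul_assoc)
  also have "\<dots> = P ** (real_diag_mat E ** real_diag_mat F) ** cadjoint P"
    using assms by (simp add: unitary_mat_def matrix_mul_assoc)
  finally show ?thesis by (simp only: EF)
qed

lemma real_diag_mat_1: "real_diag_mat (\<lambda>_. 1) = mat 1"
  by (simp add: real_diag_mat_def mat_def vec_eq_iff)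

lemma pos_def_mat_diagonalization:
  fixes A :: "complex^'n::finite^'n"
  assumes "pos_def_mat A"
  obtains P D where "unitary_mat P" "A = P ** real_diag_mat D ** cadjoint P" "\<And>i. 0 < D i"
    "\<And>s. mat_powr A s = P ** real_diag_mat (\<lambda>i. D i powr s) ** cadjoint P"
proof -
  have "self_adjoint_mat A" using assms by (simp add: pos_def_mat_def)
  then obtain P D where PD: "unitary_mat P" "A = P ** real_diag_mat D ** cadjoint P"
    and D: "\<And>i. \<exists>z. norm z = 1 \<and> D i = (A *v z) \<bullet> z"
    by (rule self_adjoint_diagonalization) blast
  have "0 < D i" for i
    using D[of i] assms unfolding pos_def_mat_def by (metis norm_zero zero_neq_one)
  with PD show ?thesis by (intro that[of P D]) (simp_all add: mat_powr_def spectral_fun_eq)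
qed

lemma mat_powr_inverse:
  assumes "pos_def_mat A" shows "mat_powr A (- s) ** mat_powr A s = mat 1"
proof -
  obtain P D where PD: "unitary_mat P" "\<And>i. 0 < D i"
    "\<And>s. mat_powr A s = P ** real_diag_mat (\<lambda>i. D i powr s) ** cadjoint P"
    using pos_def_mat_diagonalization[OF assms] by metis
  have "D i powr (- s) * D i powr s = 1" for i using PD(2)[of i] by (simp flip: powr_add)
  then show ?thesis using PD(1) by (simp add: PD(3) conj_diag_mult real_diag_mat_1 unitary_mat_def)
qed

primrec mat_power :: "complex^'n::finite^'n \<Rightarrow> nat \<Rightarrow> complex^'n^'n" where
  "mat_power A 0 = mat 1"
| "mat_power A (Suc k) = A ** mat_power A k"

lemma mat_power_conj_diag:
  assumes "unitary_mat P"
  shows "mat_power (P ** real_diag_mat D ** cadjoint P) k = P ** real_diag_mat (\<lambda>i. D i ^ k) ** cadjoint P"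
  using assms by (induction k) (simp_all add: conj_diag_mult real_diag_mat_1 unitary_mat_def)

text \<open>Stone-Weierstrass on \<open>{1 / Suc n..Suc n}\<close> with error
  \<open>1 / Suc n\<close>. These intervals exhaust the positive half-line, so a single sequence of
  polynomials serves all positive eigenvalues at once.\<close>

lemma powr_polynomial_limit:
  fixes s :: real
  obtains a :: "nat \<Rightarrow> nat \<Rightarrow> real" and N :: "nat \<Rightarrow> nat" where
    "\<And>t. 0 < t \<Longrightarrow> (\<lambda>n. \<Sum>k\<le>N n. a n k * t ^ k) \<longlonglongrightarrow> t powr s"
proof -
  have "\<exists>b m. \<forall>t\<in>{1 / Suc n..Suc n}. \<bar>t powr s - (\<Sum>k\<le>m. b k * t ^ k)\<bar> < 1 / Suc n" for n :: nat
  proof -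
    obtain g where g: "real_polynomial_function g" "\<And>x. x \<in> {1 / Suc n..Suc n} \<Longrightarrow> \<bar>x powr s - g x\<bar> < 1 / Suc n"
    proof (rule Stone_Weierstrass_real_polynomial_function[where f = "\<lambda>t. t powr s" and e = "1 / Suc n"
          and S = "{1 / Suc n..Suc n}"])
      show "continuous_on {1 / Suc n..Suc n} (\<lambda>t::real. t powr s)"
      proof (intro continuous_intros ballI)
        fix t :: real assume "t \<in> {1 / Suc n..Suc n}"
        moreover have "0 < 1 / real (Suc n)" by simp
        ultimately show "t \<noteq> 0" by (metis atLeastAtMost_iff less_irrefl order_less_le_trans)
      qed
    qed (auto intro: that)
    from g(1) obtain b m where "g = (\<lambda>x. \<Sum>i\<le>m. b i * x ^ i)"
      unfolding real_polynomial_function_iff_sum by blast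
    with g show ?thesis by blast
  qed
  then obtain a N where aN: "\<And>n t. t \<in> {1 / Suc n..Suc n} \<Longrightarrow>
      \<bar>t powr s - (\<Sum>k\<le>N n. a n k * t ^ k)\<bar> < 1 / Suc n" by metis
  show ?thesis
  proof (rule that)
    fix t :: real assume t: "0 < t"
    have "eventually (\<lambda>n. 1 / Suc n < t) sequentially"
      using order_tendstoD(2)[OF LIMSEQ_inverse_real_of_nat t] by (simp add: inverse_eq_divide)
    moreover have "eventually (\<lambda>n. t \<le> Suc n) sequentially"
      using eventually_ge_at_top[of "nat \<lceil>t\<rceil>"] by eventually_elim linarith
    ultimately have "eventually (\<lambda>n. norm ((\<Sum>k\<le>N n. a n k * t ^ k) - t powr s) \<le> 1 / Suc n) sequentially"
    proof eventually_elim
      case (elim n)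
      then show ?case using aN[of t n] by (auto simp: abs_minus_commute intro: less_imp_le)
    qed
    then have "(\<lambda>n. (\<Sum>k\<le>N n. a n k * t ^ k) - t powr s) \<longlonglongrightarrow> 0"
      by (rule Lim_null_comparison) (use LIMSEQ_inverse_real_of_nat in \<open>simp add: inverse_eq_divide\<close>)
    then show "(\<lambda>n. \<Sum>k\<le>N n. a n k * t ^ k) \<longlonglongrightarrow> t powr s" by (rule LIM_zero_cancel)
  qed
qed

text \<open>Local integrability yields measurability after restriction to a ball; the entry is the
  pointwise limit of its restrictions to growing balls.\<close>

lemma matrix_weight_entry_measurable:
  fixes U :: "real^'d::finite \<Rightarrow> complex^'n::finite^'n"
  assumes "matrix_weight U" shows "(\<lambda>x. U x $ i $ j) \<in> borel_measurable lebesgue"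
proof (rule borel_measurable_LIMSEQ_metric)
  show "(\<lambda>x. indicator (cball 0 (real n)) x *\<^sub>R U x $ i $ j) \<in> borel_measurable lebesgue" for n
    using assms unfolding matrix_weight_def set_integrable_def
    by (intro borel_measurable_integrable) (auto simp: compact_cball)
  fix x :: "real^'d"
  have "eventually (\<lambda>n. norm x \<le> real n) sequentially"
    using eventually_ge_at_top[of "nat \<lceil>norm x\<rceil>"] by eventually_elim linarith
  then have "eventually (\<lambda>n. indicator (cball 0 (real n)) x *\<^sub>R U x $ i $ j = U x $ i $ j) sequentially"
    by eventually_elim (simp add: indicator_def)
  then show "(\<lambda>n. indicator (cball 0 (real n)) x *\<^sub>R U x $ i $ j) \<longlonglongrightarrow> U x $ i $ j"
    by (rule tendsto_eventually)
qed

text \<open>The pointwise diagonalisations involve a choice of eigenvectors that need not be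
  measurable in \<open>x\<close>. Instead \<open>mat_powr (U x) s\<close> is written as a limit of
  polynomials in \<open>U x\<close>, whose coefficients do not depend on \<open>x\<close>.\<close>

lemma mat_powr_entry_measurable:
  fixes U :: "real^'d::finite \<Rightarrow> complex^'n::finite^'n"
  assumes U: "matrix_weight U"
  shows "(\<lambda>x. mat_powr (U x) s $ i $ j) \<in> borel_measurable lebesgue"
proof -
  obtain a :: "nat \<Rightarrow> nat \<Rightarrow> real" and N where
    lim: "\<And>t. 0 < t \<Longrightarrow> (\<lambda>n. \<Sum>k\<le>N n. a n k * t ^ k) \<longlonglongrightarrow> t powr s"
    by (fact powr_polynomial_limit)
  have pm: "(\<lambda>x. mat_power (U x) k $ i $ j) \<in> borel_measurable lebesgue" for k i j
  proof (induction k arbitrary: i j)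
    case (Suc k)
    then show ?case using matrix_weight_entry_measurable[OF U] by (simp add: matrix_matrix_mult_def)
  qed simp
  have pd: "AE x in lebesgue. pos_def_mat (U x)" using U by (simp add: matrix_weight_def)
  \<comment> \<open>The complement is a null set, and the completion makes it measurable.\<close>
  have pds: "{x. pos_def_mat (U x)} \<in> sets lebesgue"
  proof -
    have "AE x in lborel. \<not> \<not> pos_def_mat (U x)" using pd by (simp add: AE_completion_iff)
    from sets_completion_AE[OF this] have "Measurable.pred lebesgue (\<lambda>x. \<not> pos_def_mat (U x))" .
    then have "Measurable.pred lebesgue (\<lambda>x. \<not> \<not> pos_def_mat (U x))" by (rule pred_intros_logic)
    then show ?thesis by (simp add: pred_def)
  qed
  \<comment> \<open>Cut off where \<open>U x\<close> is not positive definite: the polynomials are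
    only known to converge at positive eigenvalues. The change affects a null set.\<close>
  define G where "G x = (if pos_def_mat (U x) then mat_powr (U x) s $ i $ j else 0)" for x
  have "G \<in> borel_measurable lebesgue"
  proof (rule borel_measurable_LIMSEQ_metric)
    show "(\<lambda>x. if pos_def_mat (U x) then (\<Sum>k\<le>N n. of_real (a n k) * mat_power (U x) k $ i $ j) else 0)
        \<in> borel_measurable lebesgue" for n
      using pm pds by (intro measurable_If borel_measurable_sum borel_measurable_times borel_measurable_const) auto
    fix x
    show "(\<lambda>n. if pos_def_mat (U x) then (\<Sum>k\<le>N n. of_real (a n k) * mat_power (U x) k $ i $ j) else 0) \<longlonglongrightarrow> G x"
    proof (cases "pos_def_mat (U x)")
      case True
      obtain P D where PD: "unitary_mat P" "U x = P ** real_diag_mat D ** cadjoint P" "\<And>i. 0 < D i"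
        "\<And>s. mat_powr (U x) s = P ** real_diag_mat (\<lambda>i. D i powr s) ** cadjoint P"
        using pos_def_mat_diagonalization[OF True] by metis
      have "(\<Sum>k\<le>N n. of_real (a n k) * mat_power (U x) k $ i $ j)
          = (\<Sum>l\<in>UNIV. P $ i $ l * of_real (\<Sum>k\<le>N n. a n k * D l ^ k) * cnj (P $ j $ l))" for n
      proof -
        have "(\<Sum>k\<le>N n. of_real (a n k) * mat_power (U x) k $ i $ j)
            = (\<Sum>k\<le>N n. \<Sum>l\<in>UNIV. of_real (a n k) * (P $ i $ l * of_real (D l ^ k) * cnj (P $ j $ l)))"
          by (simp only: PD(2) mat_power_conj_diag[OF PD(1)] conj_diag_nth sum_distrib_left)
        also have "\<dots> = (\<Sum>l\<in>UNIV. \<Sum>k\<le>N n. of_real (a n k) * (P $ i $ l * of_real (D l ^ k) * cnj (P $ j $ l)))"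
          by (rule sum.swap)
        finally show ?thesis by (simp add: sum_distrib_left sum_distrib_right mult_ac)
      qed
      moreover have "(\<lambda>n. \<Sum>l\<in>UNIV. P $ i $ l * of_real (\<Sum>k\<le>N n. a n k * D l ^ k) * cnj (P $ j $ l))
          \<longlonglongrightarrow> (\<Sum>l\<in>UNIV. P $ i $ l * of_real (D l powr s) * cnj (P $ j $ l))"
        by (intro tendsto_intros lim PD(3))
      ultimately show ?thesis using True by (simp only: G_def PD(4) conj_diag_nth if_True)
    qed (simp add: G_def)
  qed
  moreover have "AE x in lebesgue. G x = mat_powr (U x) s $ i $ j"
    using pd by eventually_elim (simp add: G_def)
  ultimately show ?thesis by (rule borel_measurable_AE)
qed

lemma borel_measurable_vec_components:
  fixes f :: "'x \<Rightarrow> complex^'n::finite"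
  assumes "\<And>i. (\<lambda>x. f x $ i) \<in> borel_measurable M" shows "f \<in> borel_measurable M"
proof (subst borel_measurable_euclidean_space, intro ballI)
  fix b :: "complex^'n" assume "b \<in> Basis"
  then obtain i c where "b = axis i c" by (auto simp: Basis_vec_def)
  then show "(\<lambda>x. f x \<bullet> b) \<in> borel_measurable M"
    using assms[of i] by (simp add: inner_axis)
qed

lemma borel_measurable_matrix_vector:
  fixes B :: "'x \<Rightarrow> complex^'n::finite^'n"
  assumes B: "\<And>i j. (\<lambda>x. B x $ i $ j) \<in> borel_measurable M" and f[measurable]: "f \<in> borel_measurable M"
  shows "(\<lambda>x. B x *v f x) \<in> borel_measurable M"
proof (rule borel_measurable_vec_components)
  have "(\<lambda>x. f x $ j) \<in> borel_measurable M" for j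
    by (rule borel_measurable_continuous_on[OF _ f]) (intro continuous_intros)
  then show "(\<lambda>x. (B x *v f x) $ i) \<in> borel_measurable M" for i
    using B by (simp add: matrix_vector_mult_def)
qed

lemma norm_matrix_vector_le_op_norm: "norm (A *v z) \<le> op_norm A * norm z"
  unfolding op_norm_def by (rule onorm) simp

lemma op_norm_nonneg: "0 \<le> op_norm A"
  unfolding op_norm_def by (rule onorm_pos_le) simp

subsection \<open>Shifted dyadic grids\<close>

lemma cube_eq_cbox: "cube c l = cbox (\<chi> i. c $ i - l / 2) (\<chi> i. c $ i + l / 2)"
  unfolding cube_def abs_diff_le_iff by (auto simp: set_eq_iff mem_box_cart)

lemma cube_sets [measurable]: "cube c l \<in> sets lebesgue"
  by (simp add: cube_eq_cbox)

lemma measure_cube: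
  fixes c :: "real^'d::finite"
  assumes "0 < l" shows "measure lebesgue (cube c l) = l powr CARD('d)"
proof -
  have "cbox (\<chi> i. c $ i - l / 2) (\<chi> i. c $ i + l / 2) \<noteq> {}"
    using assms by (simp add: interval_ne_empty_cart)
  then show ?thesis
    using assms by (simp add: cube_eq_cbox content_cbox_cart powr_realpow)
qed

lemma emeasure_cube:
  fixes c :: "real^'d::finite"
  assumes "0 < l" shows "emeasure lebesgue (cube c l) = ennreal (l powr CARD('d))"
proof -
  have "emeasure lebesgue (cube c l) < \<infinity>" 
    using emeasure_bounded_finite[OF bounded_cbox] by (simp add: cube_eq_cbox)
  then show ?thesis using measure_cube[OF assms, of c] by (simp add: emeasure_eq_ennreal_measure)
qed

text \<open>The grid translated by a third of its mesh, with alternating sign, is again nested because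
  the shift of the coarser mesh differs from half the shift of the finer one by \<open>\<plusminus> 1 / 2\<close>.\<close>

definition grid_shift :: "bool \<Rightarrow> int \<Rightarrow> real" where
  "grid_shift s k = (if s then (if even k then 1 / 3 else - 1 / 3) else 0)"

text \<open>The floor makes the intervals half-open, so the cubes of each generation partition the
  space and nesting holds exactly, not just up to null sets.\<close>

definition grid_index :: "bool \<Rightarrow> int \<Rightarrow> real \<Rightarrow> int" where
  "grid_index s k x = \<lfloor>x / 2 powr k + grid_shift s k\<rfloor>"

definition grid_cube :: "('d \<Rightarrow> bool) \<Rightarrow> int \<Rightarrow> ('d \<Rightarrow> int) \<Rightarrow> (real^'d::finite) set" where
  "grid_cube t k m = {x. \<forall>i. grid_index (t i) k (x $ i) = m i}"

definition grid :: "('d \<Rightarrow> bool) \<Rightarrow> (real^'d::finite) set set" where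
  "grid t = range (\<lambda>(k, m). grid_cube t k m)"

lemma grid_index_parent:
  "\<exists>e. \<forall>x. grid_index s (k + 1) x = (grid_index s k x - e) div 2"
proof -
  \<comment> \<open>For a shift \<open>a\<close> equal to 1 / 3 or - 1 / 3 the next shift is
    \<open>- a\<close>, and \<open>(a - e) / 2 = - a\<close> forces \<open>e = 3 * a\<close>. Being
    an integer, it can be pulled out of the floor.\<close>
  define e :: int where "e = (if s then (if even k then 1 else -1) else 0)"
  have "grid_index s (k + 1) x = (grid_index s k x - e) div 2" for x
  proof -
    have "x / 2 powr real_of_int (k + 1) + grid_shift s (k + 1) = (x / 2 powr k + grid_shift s k - real_of_int e) / real_of_int 2"
      by (simp add: grid_shift_def e_def powr_add)
    then have "grid_index s (k + 1) x = \<lfloor>(x / 2 powr k + grid_shift s k - real_of_int e) / real_of_int 2\<rfloor>"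
      by (simp only: grid_index_def)
    also have "\<dots> = (grid_index s k x - e) div 2"
      by (subst floor_divide_real_eq_div) (simp_all add: grid_index_def)
    finally show ?thesis .
  qed
  then show ?thesis by blast
qed

lemma grid_index_coarser:
  assumes "k \<le> k'" "grid_index s k x = grid_index s k y"
  shows "grid_index s k' x = grid_index s k' y"
  using assms
proof (induction k' rule: int_ge_induct)
  case (step k')
  then show ?case using grid_index_parent[of s k'] by metis
qed

lemma laminar_grid: "laminar (grid t)"
proof -
  have sub: "grid_cube t k m \<subseteq> grid_cube t k' m'"
    if "k \<le> k'" "z \<in> grid_cube t k m" "z \<in> grid_cube t k' m'" for k k' m m' z
  proof
    fix x assume "x \<in> grid_cube t k m"
    then have "grid_index (t i) k (x $ i) = grid_index (t i) k (z $ i)" for i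
      using that by (simp add: grid_cube_def)
    from grid_index_coarser[OF that(1) this]
    have "grid_index (t i) k' (x $ i) = m' i" for i using that(3) by (simp add: grid_cube_def)
    then show "x \<in> grid_cube t k' m'" by (simp add: grid_cube_def)
  qed
  have "A \<subseteq> B \<or> B \<subseteq> A" if AB: "A \<in> grid t" "B \<in> grid t" and z: "z \<in> A" "z \<in> B" for A B z
  proof -
    obtain k m where "A = grid_cube t k m" using AB(1) by (auto simp: grid_def)
    moreover obtain k' m' where "B = grid_cube t k' m'" using AB(2) by (auto simp: grid_def)
    ultimately show ?thesis using sub[of k k' z m m'] sub[of k' k z m' m] z by (cases "k \<le> k'") auto
  qed
  then show ?thesis unfolding laminar_def by (meson disjoint_iff)
qed

lemma countable_grid: "countable (grid t)"
  unfolding grid_def by simp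

lemma grid_sets: "Q \<in> grid t \<Longrightarrow> Q \<in> sets lebesgue"
proof -
  assume "Q \<in> grid t"
  then obtain k m where "Q = grid_cube t k m" by (auto simp: grid_def)
  then have "Q = {x\<in>space borel. \<forall>i\<in>UNIV. grid_index (t i) k (x $ i) = m i}" by (simp add: grid_cube_def)
  also have "\<dots> \<in> sets borel"
    unfolding grid_index_def by measurable
  finally show ?thesis by simp
qed

text \<open>In units of the mesh, the end points of the shifted intervals keep distance at least 1 /
  3 from those of the unshifted ones. An interval shorter than 1 / 3 therefore cannot be cut in both
  grids.\<close>

lemma one_third_trick:
  assumes "3 * l < 2 powr real_of_int k" "0 < l"
  shows "\<exists>s. \<forall>x. \<bar>x - c\<bar> \<le> l / 2 \<longrightarrow> grid_index s k x = grid_index s k c"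
proof -
  define y0 y1 where "y0 = (c - l / 2) / 2 powr k" and "y1 = (c + l / 2) / 2 powr k"
  define \<sigma> :: real where "\<sigma> = grid_shift True k"
  have "y1 - y0 = l / 2 powr k" by (simp add: y0_def y1_def field_simps)
  also have "\<dots> < 1 / 3" using assms by (simp add: field_simps)
  finally have y: "y1 - y0 < 1 / 3" .
  have "\<exists>s. \<lfloor>y0 + grid_shift s k\<rfloor> = \<lfloor>y1 + grid_shift s k\<rfloor>"
  proof (rule ccontr)
    assume *: "\<not> ?thesis"
    have le: "y0 \<le> y1" using assms by (auto simp: y0_def y1_def intro!: divide_right_mono)
    have "\<lfloor>y0\<rfloor> \<noteq> \<lfloor>y1\<rfloor>" using *[unfolded not_ex, rule_format, of False] by (simp add: grid_shift_def)
    moreover have "\<lfloor>y0 + \<sigma>\<rfloor> \<noteq> \<lfloor>y1 + \<sigma>\<rfloor>" using * by (auto simp: \<sigma>_def)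
    moreover have "\<lfloor>y0\<rfloor> \<le> \<lfloor>y1\<rfloor>" "\<lfloor>y0 + \<sigma>\<rfloor> \<le> \<lfloor>y1 + \<sigma>\<rfloor>" using le by (auto intro: floor_mono)
    ultimately have "\<lfloor>y0\<rfloor> < \<lfloor>y1\<rfloor>" "\<lfloor>y0 + \<sigma>\<rfloor> < \<lfloor>y1 + \<sigma>\<rfloor>" by linarith+
    then have a: "y0 < \<lfloor>y1\<rfloor>" "y0 + \<sigma> < \<lfloor>y1 + \<sigma>\<rfloor>" by (simp_all add: floor_less_iff)
    have b: "\<lfloor>y1\<rfloor> \<le> y1" "\<lfloor>y1 + \<sigma>\<rfloor> \<le> y1 + \<sigma>" by linarith+
    define n where "n = \<lfloor>y1 + \<sigma>\<rfloor> - \<lfloor>y1\<rfloor>"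
    have "\<bar>real_of_int n - \<sigma>\<bar> < 1 / 3" using a b y unfolding n_def of_int_diff by linarith
    moreover have "\<sigma> = 1 / 3 \<or> \<sigma> = - 1 / 3" by (simp add: \<sigma>_def grid_shift_def)
    moreover have "n = 0 \<or> real_of_int 1 \<le> real_of_int n \<or> real_of_int n \<le> real_of_int (- 1)"
      unfolding of_int_le_iff by linarith
    ultimately show False by (elim disjE) auto
  qed
  then obtain s where s: "\<lfloor>y0 + grid_shift s k\<rfloor> = \<lfloor>y1 + grid_shift s k\<rfloor>" by blast
  have "grid_index s k x = \<lfloor>y1 + grid_shift s k\<rfloor>" if "\<bar>x - c\<bar> \<le> l / 2" for x
  proof (rule antisym)
    have "x \<le> c + l / 2" "c - l / 2 \<le> x" using that unfolding abs_le_iff by linarith+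
    then have le: "x / 2 powr k \<le> y1" "y0 \<le> x / 2 powr k"
      unfolding y0_def y1_def by (simp_all add: divide_right_mono)
    show "grid_index s k x \<le> \<lfloor>y1 + grid_shift s k\<rfloor>"
      unfolding grid_index_def using le by (intro floor_mono) simp
    show "\<lfloor>y1 + grid_shift s k\<rfloor> \<le> grid_index s k x"
      unfolding s[symmetric] grid_index_def using le by (intro floor_mono) simp
  qed
  then show ?thesis using assms by (intro exI[of _ s]) auto
qed

lemma cube_in_grid_cube:
  fixes c :: "real^'d::finite"
  assumes l: "0 < l"
  obtains t Q where "Q \<in> grid t" "cube c l \<subseteq> Q" "Q \<subseteq> cube c (12 * l)"
proof -
  \<comment> \<open>The unique generation with mesh in the range from \<open>3 * l\<close>
    (excluded) to \<open>6 * l\<close>: coarse enough for the one-third trick, while a cell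
    containing \<open>c\<close> reaches at most \<open>6 * l\<close> away from it in each
    coordinate. Hence the side \<open>12 * l\<close>. The shift is chosen per coordinate, which is
    why there are \<open>2^d\<close> grids.\<close>
  define k where "k = \<lfloor>log 2 (6 * l)\<rfloor>"
  have "real_of_int k \<le> log 2 (6 * l)" "log 2 (6 * l) < real_of_int k + 1" by (simp_all add: k_def)
  then have k: "2 powr k \<le> 6 * l" "3 * l < 2 powr k"
    using l by (simp_all add: le_log_iff log_less_iff powr_add)
  have "\<forall>i. \<exists>s. \<forall>x. \<bar>x - c $ i\<bar> \<le> l / 2 \<longrightarrow> grid_index s k x = grid_index s k (c $ i)"
    using one_third_trick[OF k(2) l] by blast
  then obtain t where t: "\<And>i x. \<bar>x - c $ i\<bar> \<le> l / 2 \<Longrightarrow> grid_index (t i) k x = grid_index (t i) k (c $ i)"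
    by metis
  define Q where "Q = grid_cube t k (\<lambda>i. grid_index (t i) k (c $ i))"
  show ?thesis
  proof (rule that[of Q t])
    show "Q \<in> grid t" by (auto simp: Q_def grid_def)
    show "cube c l \<subseteq> Q" using t by (auto simp: Q_def grid_cube_def cube_def)
    show "Q \<subseteq> cube c (12 * l)"
    proof
      fix x assume "x \<in> Q"
      then have eq: "\<lfloor>x $ i / 2 powr k + grid_shift (t i) k\<rfloor> = \<lfloor>c $ i / 2 powr k + grid_shift (t i) k\<rfloor>" for i
        by (simp add: Q_def grid_cube_def grid_index_def)
      have "\<bar>x $ i - c $ i\<bar> \<le> 6 * l" for i
      proof -
        have "\<bar>x $ i / 2 powr k - c $ i / 2 powr k\<bar> < 1" using eq[of i] by linarith
        then have "\<bar>x $ i - c $ i\<bar> / 2 powr k < 1" by (simp add: diff_divide_distrib[symmetric])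
        then show ?thesis using k(1) by (simp add: divide_less_eq)
      qed
      then show "x \<in> cube c (12 * l)" by (simp add: cube_def)
    qed
  qed
qed

subsection \<open>The local estimate\<close>

text \<open>The real-valued \<open>SUP\<close> gives an upper bound only for a bounded set, and the
  superlinear growth of \<open>\<Phi>\<close> supplies boundedness. The case \<open>s = 0\<close> is
  separate because the supremum ranges over positive \<open>s\<close>.\<close>

lemma complementary_Young:
  assumes \<Phi>: "young \<Phi>" and A: "young (complementary \<Phi>)" and s: "0 \<le> s" and t: "0 \<le> t"
  shows "s * t \<le> \<Phi> s + complementary \<Phi> t"
proof (cases "s = 0")
  case True
  then show ?thesis using young_nonneg[OF A t] \<Phi> by (simp add: young_def)
next
  case False
  have "eventually (\<lambda>u. t \<le> \<Phi> u / u) at_top"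
    using \<Phi> by (simp add: young_def filterlim_at_top)
  then obtain S where S: "\<And>u. S \<le> u \<Longrightarrow> t \<le> \<Phi> u / u" by (auto simp: eventually_at_top_linorder)
  have "bdd_above ((\<lambda>s. s * t - \<Phi> s) ` {0<..})"
  proof (rule bdd_aboveI2)
    fix u :: real assume u: "u \<in> {0<..}"
    show "u * t - \<Phi> u \<le> max 0 S * t"
    proof (cases "S \<le> u")
      case True
      then have "u * t \<le> \<Phi> u" using S[OF True] u by (simp add: field_simps)
      moreover have "0 \<le> max 0 S * t" using t by simp
      ultimately show ?thesis by linarith
    next
      case False
      then have "u * t \<le> max 0 S * t" using t by (intro mult_right_mono) auto
      then show ?thesis using young_nonneg[OF \<Phi>, of u] u by simp
    qed
  qed
  then have "s * t - \<Phi> s \<le> complementary \<Phi> t"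
    unfolding complementary_def using False s by (intro cSUP_upper) auto
  then show ?thesis by simp
qed

text \<open>Young's inequality for \<open>F / r\<close> and \<open>h / \<mu>\<close>, integrated for
  every admissible \<open>r\<close>. The two norms live on different sets, \<open>F\<close> on the
  larger \<open>Q'\<close> and \<open>h\<close> on \<open>Q\<close>: their integrals are at most
  \<open>c\<close> and 1 times the measure of \<open>Q\<close>, hence \<open>c + 1\<close>. The
  integral of the possibly non-measurable \<open>\<Phi> (F y / r)\<close> is a lower one.\<close>

lemma Orlicz_Hoelder:
  fixes \<psi> h F :: "real^'d::finite \<Rightarrow> real"
  assumes \<Phi>: "young \<Phi>" and A: "young (complementary \<Phi>)"
    and \<psi>[measurable]: "\<psi> \<in> borel_measurable lebesgue" and h[measurable]: "h \<in> borel_measurable lebesgue"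
    and pos: "\<And>y. 0 \<le> h y" "\<And>y. 0 \<le> F y" and le: "\<And>y. \<psi> y \<le> F y * h y"
    and Q[measurable]: "Q \<in> sets lebesgue" and Q': "Q \<subseteq> Q'" "Q' \<in> lmeasurable"
    and m: "0 < measure lebesgue Q" and c: "measure lebesgue Q' \<le> c * measure lebesgue Q"
    and \<mu>: "0 < \<mu>" "(\<integral>\<^sup>+y\<in>Q. ennreal (complementary \<Phi> (h y / \<mu>)) \<partial>lebesgue) \<le> emeasure lebesgue Q"
  shows "(\<integral>\<^sup>+y\<in>Q. ennreal (\<psi> y) \<partial>lebesgue)
    \<le> ennreal ((c + 1) * \<mu> * measure lebesgue Q) * orlicz_norm \<Phi> Q' F"
proof -
  let ?X = "\<integral>\<^sup>+y\<in>Q. ennreal (\<psi> y) \<partial>lebesgue"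
  have em: "emeasure lebesgue Q = ennreal (measure lebesgue Q)"
    using m by (intro emeasure_eq_ennreal_measure) (auto simp: measure_def)
  have em': "emeasure lebesgue Q' = ennreal (measure lebesgue Q')"
    using Q'(2) by (simp add: emeasure_eq_measure2)
  have mm: "measure lebesgue Q \<le> measure lebesgue Q'"
    using Q Q' by (intro measure_mono_fmeasurable) auto
  have c0: "0 \<le> c"
  proof (rule ccontr)
    assume "\<not> 0 \<le> c"
    then have "c * measure lebesgue Q < 0" using m by (simp add: mult_less_0_iff)
    with c mm m show False by linarith
  qed
  define D where "D = (c + 1) * \<mu> * measure lebesgue Q"
  have D: "0 < D" using c0 \<mu> m by (simp add: D_def)
  have bound: "?X \<le> ennreal (D * r)"
    if r: "0 < r" "mean_on Q' (\<lambda>y. ennreal (\<Phi> (\<bar>F y\<bar> / r))) \<le> 1" for r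
  proof -
    define u v w where "u y = ennreal (\<psi> y / (r * \<mu>)) * indicator Q y"
      and "v y = ennreal (\<Phi> (\<bar>F y\<bar> / r)) * indicator Q' y"
      and "w y = ennreal (complementary \<Phi> (h y / \<mu>)) * indicator Q y" for y
    have [measurable]: "(\<lambda>y. complementary \<Phi> (h y / \<mu>)) \<in> borel_measurable lebesgue"
      using pos \<mu> by (intro young_borel_measurable[OF A]) auto
    have [measurable]: "u \<in> borel_measurable lebesgue" "w \<in> borel_measurable lebesgue"
      unfolding u_def w_def by measurable
    have "integral\<^sup>N lebesgue u \<le> integral\<^sup>N lebesgue v + integral\<^sup>N lebesgue w"
    proof (rule nn_integral_le_add)
      fix y
      have "\<psi> y / (r * \<mu>) \<le> (F y / r) * (h y / \<mu>)" using le[of y] r \<mu> by (simp add: divide_right_mono)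
      also have "\<dots> \<le> \<Phi> (F y / r) + complementary \<Phi> (h y / \<mu>)"
        using pos r \<mu> by (intro complementary_Young \<Phi> A) auto
      finally have "ennreal (\<psi> y / (r * \<mu>)) \<le> ennreal (\<Phi> (F y / r) + complementary \<Phi> (h y / \<mu>))"
        by (rule ennreal_leI)
      also have "\<dots> = ennreal (\<Phi> (F y / r)) + ennreal (complementary \<Phi> (h y / \<mu>))"
        using pos r \<mu> by (intro ennreal_plus young_nonneg[OF \<Phi>] young_nonneg[OF A]) auto
      finally show "u y \<le> v y + w y"
        using Q'(1) pos by (cases "y \<in> Q") (auto simp: u_def v_def w_def)
    qed measurable
    also have "\<dots> \<le> ennreal (measure lebesgue Q') + ennreal (measure lebesgue Q)"
    proof (rule add_mono)
      have "emeasure lebesgue Q' \<noteq> 0" using m mm by (simp add: em' ennreal_eq_0_iff)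
      then have "integral\<^sup>N lebesgue v = mean_on Q' (\<lambda>y. ennreal (\<Phi> (\<bar>F y\<bar> / r))) * emeasure lebesgue Q'"
        unfolding v_def[abs_def] by (intro set_nn_integral_eq_mean_on) (simp_all add: em')
      also have "\<dots> \<le> 1 * emeasure lebesgue Q'" using r by (intro mult_right_mono) auto
      finally show "integral\<^sup>N lebesgue v \<le> ennreal (measure lebesgue Q')" by (simp add: em')
      show "integral\<^sup>N lebesgue w \<le> ennreal (measure lebesgue Q)" using \<mu> by (simp add: w_def[abs_def] em)
    qed
    also have "\<dots> = ennreal (measure lebesgue Q' + measure lebesgue Q)" by simp
    also have "\<dots> \<le> ennreal ((c + 1) * measure lebesgue Q)"
      using c by (intro ennreal_leI) (simp add: algebra_simps)
    finally have ub: "integral\<^sup>N lebesgue u \<le> ennreal ((c + 1) * measure lebesgue Q)" .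
    have "ennreal (\<psi> y) * indicator Q y = ennreal (r * \<mu>) * u y" for y
    proof -
      have "ennreal (\<psi> y) = ennreal (r * \<mu>) * ennreal (\<psi> y / (r * \<mu>))"
        using r \<mu> ennreal_mult'[of "r * \<mu>" "\<psi> y / (r * \<mu>)"] by simp
      then show ?thesis by (simp add: u_def mult.assoc)
    qed
    then have "?X = ennreal (r * \<mu>) * integral\<^sup>N lebesgue u"
      by (simp add: nn_integral_cmult)
    also have "\<dots> \<le> ennreal (r * \<mu>) * ennreal ((c + 1) * measure lebesgue Q)"
      by (intro mult_left_mono ub) simp
    also have "\<dots> = ennreal (D * r)"
      using r \<mu> c0 by (simp add: D_def mult_ac flip: ennreal_mult)
    finally show ?thesis .
  qed
  have inv: "ennreal D * (ennreal (1 / D) * z) = z" for z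
    using D by (simp flip: mult.assoc ennreal_mult)
  have "ennreal (1 / D) * ?X \<le> orlicz_norm \<Phi> Q' F"
    unfolding orlicz_norm_def
  proof (rule Inf_greatest)
    fix z assume "z \<in> {ennreal r | r. 0 < r \<and> mean_on Q' (\<lambda>y. ennreal (\<Phi> (\<bar>F y\<bar> / r))) \<le> 1}"
    then obtain r where r: "z = ennreal r" "0 < r" "mean_on Q' (\<lambda>y. ennreal (\<Phi> (\<bar>F y\<bar> / r))) \<le> 1" by blast
    have "ennreal (1 / D) * ?X \<le> ennreal (1 / D) * ennreal (D * r)"
      using bound[OF r(2,3)] by (intro mult_left_mono) auto
    also have "\<dots> = z" using D r by (simp flip: ennreal_mult)
    finally show "ennreal (1 / D) * ?X \<le> z" .
  qed
  then have "ennreal D * (ennreal (1 / D) * ?X) \<le> ennreal D * orlicz_norm \<Phi> Q' F"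
    by (intro mult_left_mono) auto
  then show ?thesis unfolding inv by (simp only: D_def)
qed

text \<open>Wanted for the measurability in \<open>x\<close> of the inner integral
  \<open>G Q x\<close>.\<close>

lemma sigma_finite_lebesgue: "sigma_finite_measure (lebesgue :: 'a::euclidean_space measure)"
proof
  have "emeasure lebesgue (cball (0 :: 'a) (real n)) \<noteq> \<infinity>" for n
    using emeasure_bounded_finite[OF bounded_cball, of "0 :: 'a" "real n"] by simp
  moreover have "(\<Union>n. cball (0 :: 'a) (real n)) = UNIV"
    using real_arch_simple by (auto simp: set_eq_iff)
  ultimately show "\<exists>A::'a set set. countable A \<and> A \<subseteq> sets lebesgue \<and> \<Union>A = space lebesgue \<and>
      (\<forall>a\<in>A. emeasure lebesgue a \<noteq> \<infinity>)"
    by (intro exI[of _ "range (\<lambda>n. cball (0 :: 'a) (real n))"]) auto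
qed

text \<open>Here the weights and \<open>f\<close> are fixed, so every estimate below displays its
  dependence on \<open>K\<close> and on the level; otherwise uniformity in \<open>U\<close>,
  \<open>V\<close> and \<open>f\<close> would be lost on leaving the locale.\<close>

locale bump_weights =
  fixes \<rho> :: "real^'d::finite \<Rightarrow> real" and \<theta>' \<alpha> p q K :: real and \<Phi> :: "real \<Rightarrow> real"
    and U V :: "real^'d \<Rightarrow> complex^'n::finite^'n" and f :: "real^'d \<Rightarrow> complex^'n"
  assumes \<rho>: "\<And>x. 0 < \<rho> x" and \<theta>': "0 \<le> \<theta>'" and \<alpha>: "0 \<le> \<alpha>" "\<alpha> < CARD('d)"
    and p: "1 < p" "p \<le> q" and pq\<alpha>: "1 / p - 1 / q \<le> \<alpha> / CARD('d)"
    and \<Phi>: "young \<Phi>" and A: "complementary \<Phi> \<in> B_class p q"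
    and UV: "matrix_weight U" "matrix_weight V" and f: "f \<in> borel_measurable lebesgue"
    and bump: "bump_const \<rho> p q \<alpha> \<theta>' \<Phi> U V = ennreal K" and K: "0 \<le> K"
begin

definition W where "W x = mat_powr (U x) (1 / q)"

definition g where "g y = mat_powr (V y) (- 1 / q) *v f y"

text \<open>Extended-valued on purpose: that \<open>g\<close> is integrable on cubes is itself a
  consequence of an estimate for \<open>G\<close>. The real-valued averages \<open>H\<close> take
  over afterwards.\<close>

definition G where "G Q x = (\<integral>\<^sup>+y\<in>Q. ennreal (norm (W x *v g y)) \<partial>lebesgue)"

lemma yA: "young (complementary \<Phi>)" using A by (simp add: B_class_def)

lemma q0: "0 < q" "0 < p" using p by auto

lemma f_measurable [measurable]: "(\<lambda>y. norm (f y)) \<in> borel_measurable lebesgue"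
  using f by measurable

lemma g_measurable [measurable]: "g \<in> borel_measurable lebesgue"
  unfolding g_def by (intro borel_measurable_matrix_vector mat_powr_entry_measurable UV f)

lemma W_measurable [measurable]: "(\<lambda>x. W x $ i $ j) \<in> borel_measurable lebesgue"
  unfolding W_def by (intro mat_powr_entry_measurable UV)

lemma Wg_measurable [measurable]: "(\<lambda>y. norm (W x *v g y)) \<in> borel_measurable lebesgue"
proof -
  have [measurable]: "(\<lambda>y. W x *v g y) \<in> borel_measurable lebesgue"
    by (rule borel_measurable_matrix_vector) auto
  show ?thesis by measurable
qed

lemma G_measurable [measurable]: "Q \<in> sets lebesgue \<Longrightarrow> G Q \<in> borel_measurable lebesgue"
proof -
  assume [measurable]: "Q \<in> sets lebesgue"
  interpret sigma_finite_measure "lebesgue :: (real^'d) measure" by (rule sigma_finite_lebesgue)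
  have [measurable]: "(\<lambda>z. W (fst z) *v g (snd z)) \<in> borel_measurable (lebesgue \<Otimes>\<^sub>M lebesgue)"
    by (intro borel_measurable_matrix_vector) measurable
  show ?thesis
    unfolding G_def[abs_def] by (rule borel_measurable_nn_integral) measurable
qed

lemma kernel: "(mat_powr (U x) (1 / q) ** mat_powr (V y) (- 1 / q)) *v f y = W x *v g y"
  by (simp add: W_def g_def matrix_vector_mul_assoc)

text \<open>Orlicz-Hoelder bounds \<open>G Q x\<close>, for each \<open>x\<close>, by
  \<open>\<mu>\<close> times the measure of \<open>Q\<close> times the Orlicz norm of the kernel
  over the dilate \<open>cube c (12 * l)\<close>. The bump condition on this dilate controls the
  \<open>q\<close>-th power mean of that norm, and the centre being \<open>c\<close> again,
  \<open>\<psi>\<close> only contributes a power of \<open>12 * R\<close>.\<close>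

lemma local_estimate:
  assumes Q[measurable]: "Q \<in> sets lebesgue" and l: "0 < l" and sub: "cube c l \<subseteq> Q" "Q \<subseteq> cube c (12 * l)"
    and \<mu>: "0 < \<mu>" "(\<integral>\<^sup>+y\<in>Q. ennreal (complementary \<Phi> (norm (f y) / \<mu>)) \<partial>lebesgue) \<le> emeasure lebesgue Q"
    and R: "1 + l / \<rho> c \<le> R"
  shows "(\<integral>\<^sup>+x\<in>Q. epowr (ennreal (measure lebesgue Q powr (\<alpha> / real CARD('d) - 1)) * G Q x) q \<partial>lebesgue)
    \<le> ennreal (12 powr real CARD('d) * ((12 powr real CARD('d) + 1) * K * (12 * R) powr (\<theta>' / 3 * (1 - \<alpha> / real CARD('d)))) powr q)
      * emeasure lebesgue Q * ennreal (\<mu> powr q * measure lebesgue Q powr (q / p - 1))"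
proof -
  define Q' where "Q' = cube c (12 * l)"
  define m m' where "m = measure lebesgue Q" and "m' = measure lebesgue Q'"
  define N where "N x = orlicz_norm \<Phi> Q' (\<lambda>y. op_norm (mat_powr (U x) (1 / q) ** mat_powr (V y) (- 1 / q)))" for x
  define \<gamma> where "\<gamma> = 1 - \<alpha> / real CARD('d)"
  define e where "e = \<alpha> / real CARD('d) + 1 / q - 1 / p"
  have d0: "0 < real CARD('d)" by simp
  have \<gamma>: "0 \<le> \<gamma>" using \<alpha> d0 by (simp add: \<gamma>_def)
  have e: "0 \<le> e" using pq\<alpha> by (simp add: e_def)
  have l12: "0 < 12 * l" using l by simp
  have em': "emeasure lebesgue Q' = ennreal m'" "m' = (12 * l) powr real CARD('d)"
    by (simp_all only: Q'_def m'_def measure_cube[OF l12] emeasure_cube[OF l12])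
  have lm': "Q' \<in> lmeasurable"
    by (rule fmeasurableI) (simp_all only: Q'_def cube_sets emeasure_cube[OF l12] ennreal_less_top infinity_ennreal_def)
  have "Q \<in> lmeasurable" using fmeasurableI2[OF lm', of Q] sub by (simp add: Q'_def)
  then have em: "emeasure lebesgue Q = ennreal m" by (simp add: emeasure_eq_measure2 m_def)
  have "l powr real CARD('d) \<le> m"
    unfolding m_def measure_cube[OF l, of c, symmetric] using sub \<open>Q \<in> lmeasurable\<close>
    by (intro measure_mono_fmeasurable) auto
  with l have m: "0 < m" and lm: "l powr real CARD('d) \<le> m"
    by (auto intro: less_le_trans[of 0 "l powr real CARD('d)"])
  then have m'm: "m' \<le> 12 powr real CARD('d) * m"
    using l by (simp add: em'(2) powr_mult)
  have mm': "m \<le> m'" using sub lm' unfolding m_def m'_def Q'_def by (intro measure_mono_fmeasurable) auto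
  have GN: "G Q x \<le> ennreal ((12 powr real CARD('d) + 1) * \<mu> * m) * N x" for x
    unfolding G_def N_def m_def
  proof (rule Orlicz_Hoelder[OF \<Phi> yA Wg_measurable f_measurable])
    show "norm (W x *v g y) \<le> op_norm (mat_powr (U x) (1 / q) ** mat_powr (V y) (- 1 / q)) * norm (f y)" for y
      unfolding kernel[symmetric] by (rule norm_matrix_vector_le_op_norm)
    show "Q \<subseteq> Q'" using sub by (simp add: Q'_def)
  qed (use m m'm lm' \<mu> in \<open>simp_all add: op_norm_nonneg m_def m'_def\<close>)
  define coef where "coef = m' powr e / psi \<rho> (\<theta>' / 3) c (12 * l) powr \<gamma>"
  have psi0: "0 < 1 + 12 * l / \<rho> c" using l \<rho>[of c] by (simp add: add_pos_pos)
  have psi: "psi \<rho> (\<theta>' / 3) c (12 * l) powr \<gamma> = (1 + 12 * l / \<rho> c) powr (\<theta>' / 3 * \<gamma>)"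
    by (simp add: psi_def powr_powr)
  have coef: "0 < coef" using m mm' psi0 by (simp add: coef_def psi)
  have "ennreal coef * epowr (mean_on Q' (\<lambda>x. epowr (N x) q)) (1 / q) \<le> bump_const \<rho> p q \<alpha> \<theta>' \<Phi> U V"
    unfolding bump_const_def
    by (rule SUP_upper2[of "(c, 12 * l)"])
      (use l in \<open>simp_all add: coef_def m'_def Q'_def N_def e_def \<gamma>_def\<close>)
  then have *: "ennreal coef * epowr (mean_on Q' (\<lambda>x. epowr (N x) q)) (1 / q) \<le> ennreal K" by (simp add: bump)
  have "epowr (mean_on Q' (\<lambda>x. epowr (N x) q)) (1 / q)
      = ennreal (1 / coef) * (ennreal coef * epowr (mean_on Q' (\<lambda>x. epowr (N x) q)) (1 / q))"
    using coef by (simp flip: mult.assoc ennreal_mult)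
  also have "\<dots> \<le> ennreal (1 / coef) * ennreal K" by (intro mult_left_mono *) simp
  also have "\<dots> = ennreal (K / coef)" using coef K by (simp flip: ennreal_mult)
  finally have "mean_on Q' (\<lambda>x. epowr (N x) q) \<le> epowr (ennreal (K / coef)) q"
    using epowr_le_iff[of "1 / q" "mean_on Q' (\<lambda>x. epowr (N x) q)"] q0 by simp
  then have mean: "mean_on Q' (\<lambda>x. epowr (N x) q) \<le> ennreal ((K / coef) powr q)"
    using coef K by simp
  have "(\<integral>\<^sup>+x\<in>Q'. epowr (N x) q \<partial>lebesgue) = mean_on Q' (\<lambda>x. epowr (N x) q) * emeasure lebesgue Q'"
    using m mm' by (intro set_nn_integral_eq_mean_on) (auto simp: em' simp flip: zero_less_iff_neq_zero)
  also have "\<dots> \<le> ennreal ((K / coef) powr q) * ennreal m'"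
    unfolding em' by (intro mult_right_mono mean) simp
  also have "\<dots> = ennreal ((K / coef) powr q * m')" using m mm' by (simp flip: ennreal_mult)
  finally have IN: "(\<integral>\<^sup>+x\<in>Q'. epowr (N x) q \<partial>lebesgue) \<le> ennreal ((K / coef) powr q * m')" .
  define D where "D = m powr (\<alpha> / real CARD('d)) * (12 powr real CARD('d) + 1) * \<mu>"
  have D: "0 < D" using m \<mu> by (simp add: D_def add_pos_pos)
  have D_eq: "m powr (\<alpha> / real CARD('d) - 1) * ((12 powr real CARD('d) + 1) * \<mu> * m) = D"
  proof -
    have ma: "m powr (\<alpha> / real CARD('d) - 1) * m = m powr (\<alpha> / real CARD('d))"
      using m by (subst powr_diff) simp
    show ?thesis unfolding D_def ma[symmetric] by (simp only: mult_ac)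
  qed
  have "(\<integral>\<^sup>+x\<in>Q. epowr (ennreal (measure lebesgue Q powr (\<alpha> / real CARD('d) - 1)) * G Q x) q \<partial>lebesgue)
      \<le> ennreal (D powr q) * (\<integral>\<^sup>+x\<in>Q'. epowr (N x) q \<partial>lebesgue)"
  \<comment> \<open>The left integrand is measurable through \<open>G_measurable\<close>; the one
    with \<open>N\<close> on the right is integrated in the lower sense.\<close>
  proof (rule nn_integral_le_cmult)
    show "(\<lambda>x. epowr (ennreal (measure lebesgue Q powr (\<alpha> / real CARD('d) - 1)) * G Q x) q * indicator Q x) \<in> borel_measurable lebesgue"
      by measurable
    fix x
    have "ennreal (m powr (\<alpha> / real CARD('d) - 1)) * G Q x
        \<le> ennreal (m powr (\<alpha> / real CARD('d) - 1)) * (ennreal ((12 powr real CARD('d) + 1) * \<mu> * m) * N x)"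
      by (intro mult_left_mono GN) simp
    also have "\<dots> = ennreal D * N x"
      using m \<mu> by (simp add: D_eq[symmetric] mult.assoc ennreal_mult)
    finally have "epowr (ennreal (m powr (\<alpha> / real CARD('d) - 1)) * G Q x) q \<le> epowr (ennreal D * N x) q"
      using q0 by (intro epowr_mono) auto
    also have "\<dots> = ennreal (D powr q) * epowr (N x) q" using D q0 by (simp add: epowr_mult)
    finally show "epowr (ennreal (measure lebesgue Q powr (\<alpha> / real CARD('d) - 1)) * G Q x) q * indicator Q x
        \<le> ennreal (D powr q) * (epowr (N x) q * indicator Q' x)"
      using sub by (auto simp: indicator_def m_def Q'_def)
  qed (use D in simp)
  also have "\<dots> \<le> ennreal (D powr q) * ennreal ((K / coef) powr q * m')" by (intro mult_left_mono IN) simp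
  also have "\<dots> = ennreal ((D * (K / coef)) powr q * m')"
  proof -
    have pm: "(D * (K / coef)) powr q = D powr q * (K / coef) powr q"
      by (subst powr_mult) (use D K coef in simp_all)
    show ?thesis unfolding pm using m mm' by (simp add: mult.assoc flip: ennreal_mult)
  qed
  also have "\<dots> \<le> ennreal (12 powr real CARD('d) * ((12 powr real CARD('d) + 1) * K * (12 * R) powr (\<theta>' / 3 * \<gamma>)) powr q
      * m * (\<mu> powr q * m powr (q / p - 1)))"
  proof (rule ennreal_leI)
    let ?P = "(1 + 12 * l / \<rho> c) powr (\<theta>' / 3 * \<gamma>)"
    have "1 + 12 * l / \<rho> c \<le> 12 * R" using R by simp
    then have P: "?P \<le> (12 * R) powr (\<theta>' / 3 * \<gamma>)" using psi0 \<theta>' \<gamma> by (intro powr_mono2) auto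
    \<comment> \<open>This is where \<open>1 / p - 1 / q \<le> \<alpha> / CARD('d)\<close> acts:
      \<open>e\<close> is nonnegative, so the larger measure \<open>m'\<close> in the denominator
      may be replaced by \<open>m\<close>. The resulting exponent \<open>1 / p - 1 / q\<close>,
      times \<open>q\<close>, is the \<open>q / p - 1\<close> of the Orlicz maximal
      function.\<close>
    have "m powr (\<alpha> / real CARD('d)) / m' powr e \<le> m powr (\<alpha> / real CARD('d)) / m powr e"
      using m mm' e by (intro divide_left_mono powr_mono2) auto
    also have "\<dots> = m powr (1 / p - 1 / q)" by (simp add: powr_diff[symmetric] e_def)
    finally have me: "m powr (\<alpha> / real CARD('d)) / m' powr e \<le> m powr (1 / p - 1 / q)" .
    have "D * (K / coef) = (m powr (\<alpha> / real CARD('d)) / m' powr e) * ((12 powr real CARD('d) + 1) * \<mu> * K * ?P)"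
      by (simp add: D_def coef_def psi)
    also have "\<dots> \<le> m powr (1 / p - 1 / q) * ((12 powr real CARD('d) + 1) * \<mu> * K * (12 * R) powr (\<theta>' / 3 * \<gamma>))"
      using me P K \<mu> by (intro mult_mono mult_nonneg_nonneg) auto
    finally have "(D * (K / coef)) powr q
        \<le> (m powr (1 / p - 1 / q) * ((12 powr real CARD('d) + 1) * \<mu> * K * (12 * R) powr (\<theta>' / 3 * \<gamma>))) powr q"
      using D K coef q0 by (intro powr_mono2) auto
    also have "\<dots> = ((12 powr real CARD('d) + 1) * K * (12 * R) powr (\<theta>' / 3 * \<gamma>)) powr q * (\<mu> powr q * m powr (q / p - 1))"
    proof -
      have "(1 / p - 1 / q) * q = q / p - 1" using q0 by (simp add: field_simps)
      then show ?thesis using K \<mu> by (simp add: powr_mult powr_powr mult_ac)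
    qed
    finally have "(D * (K / coef)) powr q * m' \<le>
        ((12 powr real CARD('d) + 1) * K * (12 * R) powr (\<theta>' / 3 * \<gamma>)) powr q * (\<mu> powr q * m powr (q / p - 1)) * (12 powr real CARD('d) * m)"
      using m'm m mm' by (intro mult_mono) auto
    then show "(D * (K / coef)) powr q * m' \<le> 12 powr real CARD('d) * ((12 powr real CARD('d) + 1) * K * (12 * R) powr (\<theta>' / 3 * \<gamma>)) powr q
      * m * (\<mu> powr q * m powr (q / p - 1))" by (simp add: mult_ac)
  qed
  finally show ?thesis
    using m by (simp add: em m_def[symmetric] \<gamma>_def[symmetric] ennreal_mult)
qed

section \<open>Families of grid cubes comparable to true cubes\<close>

definition comparable :: "real \<Rightarrow> (real^'d) set \<Rightarrow> bool" where
  "comparable R Q \<longleftrightarrow> Q \<in> sets lebesgue \<and>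
    (\<exists>c l. 0 < l \<and> cube c l \<subseteq> Q \<and> Q \<subseteq> cube c (12 * l) \<and> 1 + l / \<rho> c \<le> R)"

definition H where
  "H Q x = measure lebesgue Q powr (\<alpha> / real CARD('d)) * avg lebesgue Q (\<lambda>y. norm (W x *v g y))"

lemma comparable_measure:
  assumes "comparable R Q"
  shows "0 < measure lebesgue Q" "Q \<in> lmeasurable" "Q \<in> sets lebesgue"
proof -
  obtain c l where Q: "Q \<in> sets lebesgue" "0 < l" "cube c l \<subseteq> Q" "Q \<subseteq> cube c (12 * l)"
    using assms by (auto simp: comparable_def)
  then show "Q \<in> sets lebesgue" by simp
  have l12: "0 < 12 * l" using Q by simp
  have "cube c (12 * l) \<in> lmeasurable"
    by (rule fmeasurableI) (simp_all only: cube_sets emeasure_cube[OF l12] ennreal_less_top infinity_ennreal_def)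
  then show lm: "Q \<in> lmeasurable" by (rule fmeasurableI2[OF _ Q(4) Q(1)])
  have "measure lebesgue (cube c l) \<le> measure lebesgue Q"
    using Q lm by (intro measure_mono_fmeasurable) auto
  then show "0 < measure lebesgue Q"
    using Q(2) by (auto simp: measure_cube intro: less_le_trans[of 0 "l powr real CARD('d)"])
qed

lemma local_estimate':
  assumes "comparable R Q" and "0 < \<mu>"
    and "(\<integral>\<^sup>+y\<in>Q. ennreal (complementary \<Phi> (norm (f y) / \<mu>)) \<partial>lebesgue) \<le> emeasure lebesgue Q"
  shows "(\<integral>\<^sup>+x\<in>Q. epowr (ennreal (measure lebesgue Q powr (\<alpha> / real CARD('d) - 1)) * G Q x) q \<partial>lebesgue)
    \<le> ennreal (12 powr real CARD('d) * ((12 powr real CARD('d) + 1) * K *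
        (12 * R) powr (\<theta>' / 3 * (1 - \<alpha> / real CARD('d)))) powr q)
      * emeasure lebesgue Q * ennreal (\<mu> powr q * measure lebesgue Q powr (q / p - 1))"
  using assms local_estimate unfolding comparable_def by blast

text \<open>The bump condition hides this integrability. The local estimate makes
  \<open>G Q x\<close> finite for almost every \<open>x\<close> in \<open>Q\<close>; at one such
  \<open>x\<close> with \<open>U x\<close> positive definite, \<open>W x\<close> can be inverted,
  and \<open>norm (g y)\<close> is at most a constant times
  \<open>norm (W x *v g y)\<close>.\<close>

lemma g_integrable:
  assumes Q: "comparable R Q" and int: "integrable lebesgue (\<lambda>x. norm (f x) powr p)"
  shows "set_integrable lebesgue Q g"
proof -
  note Qm = comparable_measure[OF Q]
  have [measurable]: "Q \<in> sets lebesgue" by (rule Qm)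
  have A0: "complementary \<Phi> 0 = 0" using yA by (simp add: young_def)
  have "\<exists>\<mu>>0. (\<integral>\<^sup>+y\<in>Q. ennreal (complementary \<Phi> (norm (f y) / \<mu>)) \<partial>lebesgue) \<le> emeasure lebesgue Q"
  proof (cases "AE x in lebesgue. x \<in> Q \<longrightarrow> norm (f x) = 0")
    case True
    then have "AE y in lebesgue. ennreal (complementary \<Phi> (norm (f y) / 1)) * indicator Q y = 0"
      by eventually_elim (auto simp: indicator_def A0)
    then have "(\<integral>\<^sup>+y\<in>Q. ennreal (complementary \<Phi> (norm (f y) / 1)) \<partial>lebesgue) = (\<integral>\<^sup>+(y :: real^'d). 0 \<partial>lebesgue)"
      by (rule nn_integral_cong_AE)
    then show ?thesis by (intro exI[of _ 1]) simp
  next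
    case False
    obtain k :: int where "(\<integral>\<^sup>+y\<in>Q. ennreal (complementary \<Phi> (norm (f y) / 2 powr (k + 1))) \<partial>lebesgue) \<le> emeasure lebesgue Q"
      by (rule Orlicz_level_exists[OF A q0(2) p(2) Qm(3) Qm(1) f_measurable norm_ge_zero int False]) blast
    then show ?thesis by (intro exI[of _ "2 powr (k + 1)"]) simp
  qed
  then obtain \<mu> where "0 < \<mu>" "(\<integral>\<^sup>+y\<in>Q. ennreal (complementary \<Phi> (norm (f y) / \<mu>)) \<partial>lebesgue) \<le> emeasure lebesgue Q"
    by blast
  from local_estimate'[OF Q this]
  have "(\<integral>\<^sup>+x\<in>Q. epowr (ennreal (measure lebesgue Q powr (\<alpha> / real CARD('d) - 1)) * G Q x) q \<partial>lebesgue) < \<infinity>"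
    by (rule le_less_trans) (use Qm(2) in \<open>simp add: ennreal_mult_less_top emeasure_eq_measure2\<close>)
  then have "AE x in lebesgue. epowr (ennreal (measure lebesgue Q powr (\<alpha> / real CARD('d) - 1)) * G Q x) q * indicator Q x \<noteq> \<infinity>"
    by (intro nn_integral_PInf_AE) auto
  moreover have "AE x in lebesgue. pos_def_mat (U x)" using UV(1) by (simp add: matrix_weight_def)
  ultimately have "AE x in lebesgue. x \<in> Q \<longrightarrow> G Q x < top \<and> pos_def_mat (U x)"
  proof eventually_elim
    case (elim x)
    have "ennreal (measure lebesgue Q powr (\<alpha> / real CARD('d) - 1)) \<noteq> 0" using Qm(1) by simp
    with elim show ?case
      by (auto simp: less_top[symmetric] ennreal_mult_top)
  qed
  note good = this
  have "\<exists>x. x \<in> Q \<and> G Q x < top \<and> pos_def_mat (U x)"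
  proof (rule ccontr)
    assume no: "\<not> ?thesis"
    from good have "AE x in lebesgue. x \<notin> Q" by eventually_elim (use no in metis)
    then have "Q \<in> null_sets lebesgue" using Qm(3) by (simp add: AE_iff_null_sets)
    then show False using Qm(1) by (simp add: null_sets_def measure_def)
  qed
  then obtain x where x: "x \<in> Q" "G Q x < top" "pos_def_mat (U x)" by (elim exE conjE)
  define B where "B = op_norm (mat_powr (U x) (- (1 / q)))"
  have "mat_powr (U x) (- (1 / q)) *v (W x *v g y) = g y" for y
    by (simp add: W_def matrix_vector_mul_assoc mat_powr_inverse[OF x(3)])
  then have gB: "norm (g y) \<le> B * norm (W x *v g y)" for y
    unfolding B_def by (metis norm_matrix_vector_le_op_norm)
  show ?thesis
    unfolding set_integrable_def
  proof (rule integrableI_bounded)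
    have "(\<integral>\<^sup>+y. ennreal (norm (indicator Q y *\<^sub>R g y)) \<partial>lebesgue)
        \<le> (\<integral>\<^sup>+y. ennreal B * (ennreal (norm (W x *v g y)) * indicator Q y) \<partial>lebesgue)"
      using gB op_norm_nonneg[of "mat_powr (U x) (- (1 / q))"] unfolding B_def[symmetric]
      by (intro nn_integral_mono) (auto simp: indicator_def intro!: ennreal_leI simp flip: ennreal_mult)
    also have "\<dots> = ennreal B * G Q x" unfolding G_def by (rule nn_integral_cmult) measurable
    also have "\<dots> < \<infinity>" using x(2) by (simp add: ennreal_mult_less_top)
    finally show "(\<integral>\<^sup>+y. ennreal (norm (indicator Q y *\<^sub>R g y)) \<partial>lebesgue) < \<infinity>" .
  qed measurable
qed

lemma H_nonneg: "0 \<le> H Q x"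
  unfolding H_def by (intro mult_nonneg_nonneg avg_nonneg) auto

text \<open>The Bochner integral inside \<open>avg\<close> is 0 for non-integrable functions, so
  integrability of \<open>g\<close> is what ties \<open>H\<close> to \<open>G\<close>.\<close>

lemma H_eq:
  assumes g: "set_integrable lebesgue Q g" and m: "0 < measure lebesgue Q"
  shows "ennreal (H Q x) = ennreal (measure lebesgue Q powr (\<alpha> / real CARD('d) - 1)) * G Q x"
proof -
  have lin: "linear ((*v) (W x))" by (simp add: bounded_linear.linear)
  have int: "integrable lebesgue (\<lambda>y. indicator Q y *\<^sub>R norm (W x *v g y))"
    using set_integrable_norm_linear[OF g lin] by (simp add: set_integrable_def)
  have "G Q x = (\<integral>\<^sup>+y. ennreal (indicator Q y *\<^sub>R norm (W x *v g y)) \<partial>lebesgue)"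
    unfolding G_def by (intro nn_integral_cong) (auto simp: indicator_def)
  also have "\<dots> = ennreal (LINT y:Q|lebesgue. norm (W x *v g y))"
    unfolding set_lebesgue_integral_def by (rule nn_integral_eq_integral[OF int]) auto
  finally have GL: "G Q x = ennreal (LINT y:Q|lebesgue. norm (W x *v g y))" .
  have "measure lebesgue Q powr (\<alpha> / real CARD('d) - 1) = measure lebesgue Q powr (\<alpha> / real CARD('d)) / measure lebesgue Q"
    using m by (subst powr_diff) simp
  then show ?thesis
    unfolding GL H_def avg_def by (subst ennreal_mult'[symmetric]) simp_all
qed

lemma H_measurable:
  assumes Q: "comparable R Q" and int: "integrable lebesgue (\<lambda>x. norm (f x) powr p)"
  shows "H Q \<in> borel_measurable lebesgue"
proof -
  have [measurable]: "Q \<in> sets lebesgue" by (rule comparable_measure[OF Q])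
  have "H Q = (\<lambda>x. enn2real (ennreal (measure lebesgue Q powr (\<alpha> / real CARD('d) - 1)) * G Q x))"
    using H_eq[OF g_integrable[OF Q int] comparable_measure(1)[OF Q]] by (metis H_nonneg enn2real_ennreal)
  also have "\<dots> \<in> borel_measurable lebesgue" by measurable
  finally show ?thesis .
qed

text \<open>Combines the laminar induction with the bound for the Orlicz maximal function. The
  constant \<open>C\<close> comes in as a parameter so that it can be chosen before the weights and
  \<open>f\<close>.\<close>

lemma family_bound:
  assumes D: "\<D> \<subseteq> grid t" "\<And>Q. Q \<in> \<D> \<Longrightarrow> comparable R Q"
    and int: "integrable lebesgue (\<lambda>x. norm (f x) powr p)" and C0: "0 < C"
    and C: "\<And>\<F> h \<kappa>. finite \<F> \<Longrightarrow> laminar \<F> \<Longrightarrow> \<F> \<subseteq> sets (lebesgue :: (real^'d) measure) \<Longrightarrow>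
      (\<And>Q. Q \<in> \<F> \<Longrightarrow> 0 < measure lebesgue Q) \<Longrightarrow> h \<in> borel_measurable lebesgue \<Longrightarrow> (\<And>x. 0 \<le> h x) \<Longrightarrow>
      integrable lebesgue (\<lambda>x. h x powr p) \<Longrightarrow>
      (\<And>Q. Q \<in> \<F> \<Longrightarrow> emeasure lebesgue Q
        \<le> (\<integral>\<^sup>+y\<in>Q. ennreal (complementary \<Phi> (h y / 2 powr (real_of_int (\<kappa> Q)))) \<partial>lebesgue)) \<Longrightarrow>
      (\<integral>\<^sup>+x. (SUP Q\<in>\<F>. ennreal (2 powr (\<kappa> Q * q) * measure lebesgue Q powr (q / p - 1)) * indicator Q x) \<partial>lebesgue)
        \<le> ennreal (C * (LINT x|lebesgue. h x powr p) powr (q / p))"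
    and L: "L = real DIM(complex^'n) * real (DIM(complex^'n) * (2 * DIM(complex^'n) * 2 ^ DIM(complex^'n)))"
  shows "(\<integral>\<^sup>+x. (SUP Q\<in>\<D>. ennreal (H Q x powr q) * indicator Q x) \<partial>lebesgue)
    \<le> ennreal (2 * L powr q * (2 powr q * (12 powr real CARD('d) * ((12 powr real CARD('d) + 1) * K *
        (12 * R) powr (\<theta>' / 3 * (1 - \<alpha> / real CARD('d)))) powr q)) *
        (C * (LINT x|lebesgue. norm (f x) powr p) powr (q / p)))"
proof -
  note Qm = comparable_measure[OF D(2)]
  have gQ: "set_integrable lebesgue Q g" if "Q \<in> \<D>" for Q by (rule g_integrable[OF D(2)[OF that] int])
  have Hm: "H Q \<in> borel_measurable lebesgue" if Q: "Q \<in> \<D>" for Q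
    by (rule H_measurable[OF D(2)[OF Q] int])
  define Bc where "Bc = 12 powr real CARD('d) * ((12 powr real CARD('d) + 1) * K *
        (12 * R) powr (\<theta>' / 3 * (1 - \<alpha> / real CARD('d)))) powr q"
  have Bc: "0 \<le> Bc" by (simp add: Bc_def)
  show ?thesis
    unfolding Bc_def[symmetric]
  proof (rule nn_integral_countable_SUP_le)
    show "countable \<D>" using countable_subset[OF D(1) countable_grid] .
    show "(\<lambda>x. ennreal (H Q x powr q) * indicator Q x) \<in> borel_measurable lebesgue" if "Q \<in> \<D>" for Q
    proof -
      have [measurable]: "Q \<in> sets lebesgue" "H Q \<in> borel_measurable lebesgue" using that Qm Hm by auto
      show ?thesis by measurable
    qed
    fix J assume J: "finite J" "J \<subseteq> \<D>"
    define J' where "J' = {Q\<in>J. \<not> (AE x in lebesgue. x \<in> Q \<longrightarrow> norm (f x) = 0)}"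
    have J': "finite J'" "J' \<subseteq> \<D>" using J by (auto simp: J'_def)
    have "(SUP Q\<in>J. ennreal (H Q x powr q) * indicator Q x) \<le> (SUP Q\<in>J'. ennreal (H Q x powr q) * indicator Q x)" for x
    proof (rule SUP_least)
      fix Q assume Q: "Q \<in> J"
      show "ennreal (H Q x powr q) * indicator Q x \<le> (SUP Q\<in>J'. ennreal (H Q x powr q) * indicator Q x)"
      proof (cases "Q \<in> J'")
        case True
        then show ?thesis by (rule SUP_upper)
      next
        case False
        then have "AE y in lebesgue. y \<in> Q \<longrightarrow> norm (f y) = 0" using Q by (simp add: J'_def)
        then have "AE y in lebesgue. indicator Q y *\<^sub>R norm (W x *v g y) = 0"
          by eventually_elim (auto simp: indicator_def g_def)
        then have "(LINT y:Q|lebesgue. norm (W x *v g y)) = 0"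
          unfolding set_lebesgue_integral_def by (rule integral_eq_zero_AE)
        then show ?thesis by (simp add: H_def avg_def)
      qed
    qed
    then have "(\<integral>\<^sup>+x. (SUP Q\<in>J. ennreal (H Q x powr q) * indicator Q x) \<partial>lebesgue)
        \<le> (\<integral>\<^sup>+x. (SUP Q\<in>J'. ennreal (H Q x powr q) * indicator Q x) \<partial>lebesgue)"
      by (intro nn_integral_mono)
    also have "\<dots> \<le> ennreal (2 * L powr q) * ennreal (2 powr q * Bc) *
        ennreal (C * (LINT x|lebesgue. norm (f x) powr p) powr (q / p))"
    proof -
      have lam: "laminar J'" using J'(2) D(1) by (intro laminar_subset[OF laminar_grid]) auto
      have sets: "J' \<subseteq> sets lebesgue" using J'(2) Qm(3) by blast
      have "\<forall>Q\<in>J'. \<exists>k :: int. emeasure lebesgue Q \<le> (\<integral>\<^sup>+y\<in>Q. ennreal (complementary \<Phi> (norm (f y) / 2 powr real_of_int k)) \<partial>lebesgue) \<and>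
          (\<integral>\<^sup>+y\<in>Q. ennreal (complementary \<Phi> (norm (f y) / 2 powr (real_of_int k + 1))) \<partial>lebesgue) \<le> emeasure lebesgue Q"
      proof
        fix Q assume Q: "Q \<in> J'"
        have QD: "Q \<in> \<D>" using Q J' by blast
        have nz: "\<not> (AE x in lebesgue. x \<in> Q \<longrightarrow> norm (f x) = 0)" using Q by (simp add: J'_def)
        show "\<exists>k :: int. emeasure lebesgue Q \<le> (\<integral>\<^sup>+y\<in>Q. ennreal (complementary \<Phi> (norm (f y) / 2 powr real_of_int k)) \<partial>lebesgue) \<and>
          (\<integral>\<^sup>+y\<in>Q. ennreal (complementary \<Phi> (norm (f y) / 2 powr (real_of_int k + 1))) \<partial>lebesgue) \<le> emeasure lebesgue Q"
        proof (rule Orlicz_level_exists[OF A q0(2) p(2) Qm(3)[OF QD] Qm(1)[OF QD] f_measurable norm_ge_zero int nz])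
          fix k :: int
          assume "emeasure lebesgue Q \<le> (\<integral>\<^sup>+y\<in>Q. ennreal (complementary \<Phi> (norm (f y) / 2 powr k)) \<partial>lebesgue)"
            "(\<integral>\<^sup>+y\<in>Q. ennreal (complementary \<Phi> (norm (f y) / 2 powr (k + 1))) \<partial>lebesgue) \<le> emeasure lebesgue Q"
          then show "\<exists>k :: int. emeasure lebesgue Q \<le> (\<integral>\<^sup>+y\<in>Q. ennreal (complementary \<Phi> (norm (f y) / 2 powr real_of_int k)) \<partial>lebesgue) \<and>
          (\<integral>\<^sup>+y\<in>Q. ennreal (complementary \<Phi> (norm (f y) / 2 powr (real_of_int k + 1))) \<partial>lebesgue) \<le> emeasure lebesgue Q" by (intro exI[of _ k] conjI) simp_all
        qed
      qed
      from bchoice[OF this] obtain \<kappa> where \<kappa>: "\<forall>Q\<in>J'. emeasure lebesgue Q \<le> (\<integral>\<^sup>+y\<in>Q. ennreal (complementary \<Phi> (norm (f y) / 2 powr real_of_int (\<kappa> Q))) \<partial>lebesgue) \<and>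
          (\<integral>\<^sup>+y\<in>Q. ennreal (complementary \<Phi> (norm (f y) / 2 powr (real_of_int (\<kappa> Q) + 1))) \<partial>lebesgue) \<le> emeasure lebesgue Q" ..
      have k1: "emeasure lebesgue Q \<le> (\<integral>\<^sup>+y\<in>Q. ennreal (complementary \<Phi> (norm (f y) / 2 powr real_of_int (\<kappa> Q))) \<partial>lebesgue)" if "Q \<in> J'" for Q
        using bspec[OF \<kappa> that] by (rule conjunct1)
      have k2: "(\<integral>\<^sup>+y\<in>Q. ennreal (complementary \<Phi> (norm (f y) / 2 powr (real_of_int (\<kappa> Q) + 1))) \<partial>lebesgue) \<le> emeasure lebesgue Q" if "Q \<in> J'" for Q
        using bspec[OF \<kappa> that] by (rule conjunct2)
      define \<tau> where "\<tau> x = (SUP Q\<in>J'. ennreal (2 powr (\<kappa> Q * q) * measure lebesgue Q powr (q / p - 1)) * indicator Q x)" for x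
      have \<tau>m[measurable]: "\<tau> \<in> borel_measurable lebesgue"
        unfolding \<tau>_def[abs_def]
      proof (rule borel_measurable_SUP[OF countable_finite[OF J'(1)]])
        fix Q assume "Q \<in> J'"
        then have [measurable]: "Q \<in> sets lebesgue" using sets by blast
        show "(\<lambda>x. ennreal (2 powr (\<kappa> Q * q) * measure lebesgue Q powr (q / p - 1)) * indicator Q x)
            \<in> borel_measurable lebesgue" by measurable
      qed
      have "(\<integral>\<^sup>+x. (SUP Q\<in>J'. ennreal (H Q x powr q) * indicator Q x) \<partial>lebesgue)
          \<le> ennreal (2 * L powr q) * ennreal (2 powr q * Bc) * (\<integral>\<^sup>+x\<in>\<Union>J'. \<tau> x \<partial>lebesgue)"
        unfolding H_def L
      proof (rule laminar_maximal_bound[where W = "\<lambda>x v. W x *v v" and g = g and \<tau> = \<tau>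
            and a = "\<lambda>Q. measure lebesgue Q powr (\<alpha> / real CARD('d))" and M = lebesgue])
        show "finite J'" by (rule J')
        show "laminar J'" by (rule lam)
        show "J' \<subseteq> sets lebesgue" by (rule sets)
        show "\<tau> \<in> borel_measurable lebesgue" by (rule \<tau>m)
        show "0 < q" by (rule q0)
        show "linear ((*v) (W x))" for x by (simp add: bounded_linear.linear)
        show "0 \<le> measure lebesgue Q powr (\<alpha> / real CARD('d))" for Q :: "(real^'d) set" by simp
        fix Q assume Q: "Q \<in> J'"
        have QD: "Q \<in> \<D>" by (rule subsetD[OF J'(2) Q])
        show "0 < measure lebesgue Q" by (rule Qm(1)[OF QD])
        show "set_integrable lebesgue Q g" by (rule gQ[OF QD])
        show "(\<lambda>x. measure lebesgue Q powr (\<alpha> / real CARD('d)) * avg lebesgue Q (\<lambda>y. norm (W x *v g y))) \<in> borel_measurable lebesgue"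
          using Hm[OF QD] unfolding H_def[abs_def] .
        show "measure lebesgue Q powr (\<alpha> / real CARD('d)) \<le> measure lebesgue Q' powr (\<alpha> / real CARD('d))"
          if "Q' \<in> J'" "Q \<subseteq> Q'" for Q'
        proof -
          have "measure lebesgue Q \<le> measure lebesgue Q'"
            by (rule measure_mono_fmeasurable[OF that(2) Qm(3)[OF QD] Qm(2)[OF subsetD[OF J'(2) that(1)]]])
          then show ?thesis using \<alpha> by (intro powr_mono2) auto
        qed
        fix y assume y: "y \<in> Q"
        have "(\<integral>\<^sup>+x\<in>Q. ennreal ((measure lebesgue Q powr (\<alpha> / real CARD('d)) * avg lebesgue Q (\<lambda>y. norm (W x *v g y))) powr q) \<partial>lebesgue)
            = (\<integral>\<^sup>+x\<in>Q. epowr (ennreal (measure lebesgue Q powr (\<alpha> / real CARD('d) - 1)) * G Q x) q \<partial>lebesgue)"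
          unfolding H_eq[OF gQ[OF QD] Qm(1)[OF QD], symmetric] epowr_ennreal[OF H_nonneg] by (simp add: H_def)
        \<comment> \<open>The local estimate needs the level \<open>\<kappa> Q + 1\<close>, where
          \<open>k2\<close> holds, while \<open>\<tau>\<close> is built from
          \<open>\<kappa> Q\<close>, where \<open>k1\<close> feeds the Orlicz bound. The gap is the
          factor \<open>2 powr q\<close>.\<close>
        also have "\<dots> \<le> ennreal Bc * emeasure lebesgue Q * ennreal ((2 powr (real_of_int (\<kappa> Q) + 1)) powr q * measure lebesgue Q powr (q / p - 1))"
          unfolding Bc_def by (rule local_estimate'[OF D(2)[OF QD] _ k2[OF Q]]) simp
        also have "\<dots> = ennreal (2 powr q * Bc) * emeasure lebesgue Q * ennreal (2 powr (\<kappa> Q * q) * measure lebesgue Q powr (q / p - 1))"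
        proof -
          have "(2 powr (real_of_int (\<kappa> Q) + 1)) powr q = 2 powr q * 2 powr (\<kappa> Q * q)"
            unfolding powr_powr unfolding distrib_right powr_add by simp
          then show ?thesis using Bc by (simp add: ennreal_mult mult_ac)
        qed
        also have "\<dots> \<le> ennreal (2 powr q * Bc) * emeasure lebesgue Q * \<tau> y"
        proof (intro mult_left_mono)
          have "ennreal (2 powr (\<kappa> Q * q) * measure lebesgue Q powr (q / p - 1)) * indicator Q y \<le> \<tau> y"
            unfolding \<tau>_def using Q by (rule SUP_upper)
          then show "ennreal (2 powr (\<kappa> Q * q) * measure lebesgue Q powr (q / p - 1)) \<le> \<tau> y" using y by simp
        qed simp
        finally show "(\<integral>\<^sup>+x\<in>Q. ennreal ((measure lebesgue Q powr (\<alpha> / real CARD('d)) * avg lebesgue Q (\<lambda>y. norm (W x *v g y))) powr q) \<partial>lebesgue)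
          \<le> ennreal (2 powr q * Bc) * emeasure lebesgue Q * \<tau> y" .
      qed
      also have "\<dots> \<le> ennreal (2 * L powr q) * ennreal (2 powr q * Bc) * (\<integral>\<^sup>+x. \<tau> x \<partial>lebesgue)"
        by (intro mult_left_mono nn_integral_mono) (auto simp: indicator_def)
      also have "\<dots> \<le> ennreal (2 * L powr q) * ennreal (2 powr q * Bc) *
          ennreal (C * (LINT x|lebesgue. norm (f x) powr p) powr (q / p))"
        unfolding \<tau>_def
      proof (rule mult_left_mono)
        show "(\<integral>\<^sup>+x. (SUP Q\<in>J'. ennreal (2 powr (\<kappa> Q * q) * measure lebesgue Q powr (q / p - 1)) * indicator Q x) \<partial>lebesgue)
            \<le> ennreal (C * (LINT x|lebesgue. norm (f x) powr p) powr (q / p))"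
        proof (rule C[OF J'(1) lam sets _ f_measurable norm_ge_zero int])
          show "0 < measure lebesgue Q" if "Q \<in> J'" for Q using subsetD[OF J'(2) that] by (rule Qm(1))
        qed (rule k1)
      qed simp
      finally show ?thesis .
    qed
    also have "\<dots> = ennreal (2 * L powr q * (2 powr q * Bc) * (C * (LINT x|lebesgue. norm (f x) powr p) powr (q / p)))"
      using Bc C0 by (simp flip: ennreal_mult)
    finally show "(\<integral>\<^sup>+x. (SUP Q\<in>J. ennreal (H Q x powr q) * indicator Q x) \<partial>lebesgue)
      \<le> ennreal (2 * L powr q * (2 powr q * Bc) * (C * (LINT x|lebesgue. norm (f x) powr p) powr (q / p)))" .
  qed
qed

section \<open>Sorting the cubes by level\<close>

definition level_cubes :: "('d \<Rightarrow> bool) \<Rightarrow> nat \<Rightarrow> (real^'d) set set" where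
  "level_cubes t j = {Q\<in>grid t. \<exists>c l. 0 < l \<and> cube c l \<subseteq> Q \<and> Q \<subseteq> cube c (12 * l) \<and>
     2 powr real j \<le> 1 + l / \<rho> c \<and> 1 + l / \<rho> c \<le> 2 powr (real j + 1)}"

lemma level_cubes_comparable:
  "Q \<in> level_cubes t j \<Longrightarrow> comparable (2 powr (real j + 1)) Q"
  unfolding level_cubes_def comparable_def using grid_sets by blast

text \<open>For each cube a single term on the right is enough: the grid and level of a comparable
  grid cube. On level \<open>j\<close> the weight \<open>\<psi>\<close> is at least
  \<open>2 powr (j * \<theta>)\<close>, which gives the decay, and the exchange of measures costs
  \<open>12 powr CARD('d)\<close>. A grid cube may occur in several levels, which does no harm in a
  sum.\<close>

lemma maximal_op_pointwise:
  assumes int: "integrable lebesgue (\<lambda>x. norm (f x) powr p)" and \<theta>: "0 \<le> \<theta>"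
  shows "epowr (maximal_op \<rho> q \<alpha> \<theta> U V f x) q \<le>
    (\<Sum>t\<in>UNIV. \<Sum>j. ennreal ((12 powr (CARD('d) * (1 - \<alpha> / CARD('d))) * 2 powr - (real j * \<theta> * (1 - \<alpha> / CARD('d)))) powr q) *
      (SUP Q\<in>level_cubes t j. ennreal (H Q x powr q) * indicator Q x))"
    (is "_ \<le> ?Y")
proof -
  define \<gamma> where "\<gamma> = 1 - \<alpha> / real CARD('d)"
  have \<gamma>: "0 < \<gamma>" using \<alpha> by (simp add: \<gamma>_def)
  have "maximal_op \<rho> q \<alpha> \<theta> U V f x \<le> epowr ?Y (1 / q)"
    unfolding maximal_op_def
  proof (rule SUP_least, clarify)
    fix c :: "real^'d" and l :: real
    assume l: "0 < l" and x: "x \<in> cube c l"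
    define z where "z = 1 + l / \<rho> c"
    have z: "1 \<le> z" using l \<rho>[of c] by (simp add: z_def)
    define j where "j = nat \<lfloor>log 2 z\<rfloor>"
    have "0 \<le> log 2 z" using z by simp
    then have "real j = \<lfloor>log 2 z\<rfloor>" by (simp add: j_def)
    then have "real j \<le> log 2 z" "log 2 z \<le> real j + 1" by linarith+
    then have j: "2 powr real j \<le> z" "z \<le> 2 powr (real j + 1)"
      using z by (simp_all add: le_log_iff log_le_iff)
    obtain t Q where Q: "Q \<in> grid t" "cube c l \<subseteq> Q" "Q \<subseteq> cube c (12 * l)"
      by (rule cube_in_grid_cube[OF l])
    have QL: "Q \<in> level_cubes t j" using Q l j by (auto simp: level_cubes_def z_def)
    note QC = level_cubes_comparable[OF QL]
    define m where "m = measure lebesgue Q"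
    have m: "0 < m" unfolding m_def by (rule comparable_measure(1)[OF QC])
    \<comment> \<open>Chosen so that \<open>m powr \<gamma> / b\<close> is the lower bound for the
      denominator of the maximal operator.\<close>
    define b where "b = 12 powr (CARD('d) * \<gamma>) * 2 powr - (real j * \<theta> * \<gamma>)"
    have b: "0 < b" by (simp add: b_def)
    have l12: "0 < 12 * l" using l by simp
    have "m \<le> measure lebesgue (cube c (12 * l))"
      unfolding m_def using Q(3) comparable_measure(3)[OF QC]
      by (rule measure_mono_fmeasurable)
        (rule fmeasurableI, simp_all only: cube_sets emeasure_cube[OF l12] ennreal_less_top infinity_ennreal_def)
    also have "\<dots> = 12 powr real CARD('d) * l powr real CARD('d)" using l by (simp add: measure_cube powr_mult)
    finally have lm: "m / 12 powr real CARD('d) \<le> l powr real CARD('d)" by (simp add: field_simps)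
    have psi0: "0 \<le> psi \<rho> \<theta> c l" by (simp add: psi_def)
    have "2 powr (real j * \<theta>) \<le> psi \<rho> \<theta> c l"
    proof -
      have "(2 powr real j) powr \<theta> \<le> z powr \<theta>" using j \<theta> by (intro powr_mono2) auto
      then show ?thesis by (simp add: psi_def z_def powr_powr)
    qed
    then have "(2 powr (real j * \<theta>) * (m / 12 powr real CARD('d))) powr \<gamma>
        \<le> (psi \<rho> \<theta> c l * measure lebesgue (cube c l)) powr \<gamma>"
      using lm \<gamma> m l psi0 by (intro powr_mono2 mult_mono) (auto simp: measure_cube)
    moreover have "(2 powr (real j * \<theta>) * (m / 12 powr real CARD('d))) powr \<gamma> = m powr \<gamma> / b"
    proof -
      have "(2 powr (real j * \<theta>) * (m / 12 powr real CARD('d))) powr \<gamma>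
          = 2 powr (real j * \<theta> * \<gamma>) * (m powr \<gamma> / 12 powr (CARD('d) * \<gamma>))"
        using m by (simp add: powr_mult powr_divide powr_powr)
      then show ?thesis by (simp add: b_def powr_minus field_simps)
    qed
    ultimately have den: "m powr \<gamma> / b \<le> (psi \<rho> \<theta> c l * measure lebesgue (cube c l)) powr \<gamma>" by simp
    have mb: "0 < m powr \<gamma> / b" using m b by simp
    have "(\<integral>\<^sup>+y\<in>cube c l. ennreal (norm ((mat_powr (U x) (1 / q) ** mat_powr (V y) (- 1 / q)) *v f y)) \<partial>lebesgue)
        / ennreal ((psi \<rho> \<theta> c l * measure lebesgue (cube c l)) powr \<gamma>)
        \<le> G Q x * ennreal (inverse (m powr \<gamma> / b))"
      unfolding divide_ennreal_def inverse_ennreal[OF less_le_trans[OF mb den]]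
    proof (rule mult_mono)
      show "(\<integral>\<^sup>+y\<in>cube c l. ennreal (norm ((mat_powr (U x) (1 / q) ** mat_powr (V y) (- 1 / q)) *v f y)) \<partial>lebesgue) \<le> G Q x"
        unfolding G_def kernel using Q(2) by (intro nn_integral_mono) (auto simp: indicator_def)
      show "ennreal (inverse ((psi \<rho> \<theta> c l * measure lebesgue (cube c l)) powr \<gamma>)) \<le> ennreal (inverse (m powr \<gamma> / b))"
        by (intro ennreal_leI le_imp_inverse_le den mb)
    qed simp_all
    also have "inverse (m powr \<gamma> / b) = b * m powr (\<alpha> / real CARD('d) - 1)"
    proof -
      have "m powr (\<alpha> / real CARD('d) - 1) = m powr (- \<gamma>)" by (simp add: \<gamma>_def)
      then show ?thesis by (simp add: powr_minus field_simps)
    qed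
    also have "G Q x * ennreal (b * m powr (\<alpha> / real CARD('d) - 1)) = ennreal b * ennreal (H Q x)"
      unfolding H_eq[OF g_integrable[OF QC int] comparable_measure(1)[OF QC]] m_def[symmetric]
      using b by (simp add: ennreal_mult mult_ac)
    also have "\<dots> \<le> epowr ?Y (1 / q)"
    proof (subst epowr_le_iff[OF q0(1), symmetric])
      have "epowr (ennreal b * ennreal (H Q x)) q = ennreal (b powr q) * ennreal (H Q x powr q)"
        using b H_nonneg q0 by (simp add: epowr_mult)
      also have "\<dots> \<le> ennreal (b powr q) * (SUP Q\<in>level_cubes t j. ennreal (H Q x powr q) * indicator Q x)"
        using Q(2) x by (intro mult_left_mono SUP_upper2[OF QL]) auto
      also have "\<dots> = (\<Sum>j\<in>{j}. ennreal ((12 powr (CARD('d) * \<gamma>) * 2 powr - (real j * \<theta> * \<gamma>)) powr q) *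
          (SUP Q\<in>level_cubes t j. ennreal (H Q x powr q) * indicator Q x))"
        by (simp add: b_def)
      also have "\<dots> \<le> (\<Sum>j. ennreal ((12 powr (CARD('d) * \<gamma>) * 2 powr - (real j * \<theta> * \<gamma>)) powr q) *
          (SUP Q\<in>level_cubes t j. ennreal (H Q x powr q) * indicator Q x))"
        by (intro sum_le_suminf) auto
      also have "\<dots> \<le> ?Y"
        unfolding \<gamma>_def[symmetric]
        by (intro member_le_sum[of t UNIV "\<lambda>t. \<Sum>j. ennreal ((12 powr (CARD('d) * \<gamma>) * 2 powr - (real j * \<theta> * \<gamma>)) powr q) *
          (SUP Q\<in>level_cubes t j. ennreal (H Q x powr q) * indicator Q x)"]) auto
      finally show "epowr (ennreal b * ennreal (H Q x)) q \<le> ?Y" .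
    qed
    finally show "(\<integral>\<^sup>+y\<in>cube c l. ennreal (norm ((mat_powr (U x) (1 / q) ** mat_powr (V y) (- 1 / q)) *v f y)) \<partial>lebesgue)
        / ennreal ((psi \<rho> \<theta> c l * measure lebesgue (cube c l)) powr (1 - \<alpha> / real CARD('d))) \<le> epowr ?Y (1 / q)"
      unfolding \<gamma>_def .
  qed
  then show ?thesis by (simp add: epowr_le_iff[OF q0(1)])
qed

end

section \<open>Summation over levels and shifted grids\<close>

theorem theorem1p10:
  fixes \<rho> :: "real^'d::finite \<Rightarrow> real"
    and \<theta> \<theta>' \<alpha> p q :: real
    and \<Phi> :: "real \<Rightarrow> real"
  assumes "critical_radius \<rho>"
    and "0 < \<theta>" and "0 < \<theta>'" and "\<theta>' < \<theta>"
    and "0 \<le> \<alpha>" and "\<alpha> < CARD('d)"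
    and "1 < p" and "p \<le> q" and "1 / p - 1 / q \<le> \<alpha> / CARD('d)"
    and "young \<Phi>" and "complementary \<Phi> \<in> B_class p q"
  shows "\<exists>C>0. \<forall>(U :: real^'d \<Rightarrow> complex^'n::finite^'n) V.
           matrix_weight U \<longrightarrow> matrix_weight V \<longrightarrow> bump_const \<rho> p q \<alpha> \<theta>' \<Phi> U V < \<infinity> \<longrightarrow>
           (\<forall>f. in_Lp p f \<longrightarrow>
              Lp_norm q (maximal_op \<rho> q \<alpha> \<theta> U V f)
                \<le> ennreal C * bump_const \<rho> p q \<alpha> \<theta>' \<Phi> U V * Lp_norm p (\<lambda>x. ennreal (norm (f x))))"
proof -
  have p0: "0 < p" "0 < q" using assms(7,8) by auto
  \<comment> \<open>Fixed before \<open>U\<close>, \<open>V\<close> and \<open>f\<close> are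
    introduced, so that the final constant is uniform in them.\<close>
  obtain C where C0: "0 < C" and C: "\<And>(M :: (real^'d) measure) \<F> h \<kappa>. finite \<F> \<Longrightarrow> laminar \<F> \<Longrightarrow> \<F> \<subseteq> sets M \<Longrightarrow>
    (\<And>Q. Q \<in> \<F> \<Longrightarrow> 0 < measure M Q) \<Longrightarrow> h \<in> borel_measurable M \<Longrightarrow> (\<And>x. 0 \<le> h x) \<Longrightarrow>
    integrable M (\<lambda>x. h x powr p) \<Longrightarrow>
    (\<And>Q. Q \<in> \<F> \<Longrightarrow> emeasure M Q \<le> (\<integral>\<^sup>+y\<in>Q. ennreal (complementary \<Phi> (h y / 2 powr (real_of_int (\<kappa> Q)))) \<partial>M)) \<Longrightarrow>
    (\<integral>\<^sup>+x. (SUP Q\<in>\<F>. ennreal (2 powr (\<kappa> Q * q) * measure M Q powr (q / p - 1)) * indicator Q x) \<partial>M)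
      \<le> ennreal (C * (LINT x|M. h x powr p) powr (q / p))"
    by (fact Orlicz_maximal_bound[OF assms(11) p0(1) assms(8), where 'x = "real^'d"])
  define \<gamma> where "\<gamma> = 1 - \<alpha> / real CARD('d)"
  have \<gamma>: "0 < \<gamma>" using assms(6) by (simp add: \<gamma>_def)
  define L where "L = real DIM(complex^'n) * real (DIM(complex^'n) * (2 * DIM(complex^'n) * 2 ^ DIM(complex^'n)))"
  have L: "0 < L" by (simp add: L_def)
  define \<beta> where "\<beta> = \<theta>' / 3 * \<gamma>"
  \<comment> \<open>The ratio between consecutive levels: the maximal operator decays like
    \<open>2 powr - (\<theta> * \<gamma>)\<close>, the bump condition grows like
    \<open>2 powr \<beta>\<close>, and everything is raised to the power \<open>q\<close>.\<close>
  define r where "r = 2 powr - ((\<theta> * \<gamma> - \<beta>) * q)"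
  have "\<theta>' / 3 * \<gamma> < \<theta> * \<gamma>" using \<gamma> assms(3,4) by (intro mult_strict_right_mono) auto
  then have "0 < (\<theta> * \<gamma> - \<beta>) * q" using p0 by (simp add: \<beta>_def)
  then have "r < 2 powr 0" unfolding r_def by (intro powr_less_mono) auto
  then have r: "0 < r" "r < 1" by (simp_all add: r_def)
  \<comment> \<open>All factors independent of the level. The 24 is the dilation 12 times the 2 from
    the upper end \<open>2 powr (j + 1)\<close> of level \<open>j\<close>.\<close>
  define E where "E = (12 powr (real CARD('d) * \<gamma>)) powr q * (2 * L powr q * (2 powr q *
    (12 powr real CARD('d) * ((12 powr real CARD('d) + 1) * 24 powr \<beta>) powr q)) * C)"
  have "0 < (12 powr real CARD('d) + 1 :: real)" by (simp add: add_pos_pos)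
  then have E: "0 < E" unfolding E_def using L C0 by (intro mult_pos_pos) auto
  define T where "T = real (card (UNIV :: ('d \<Rightarrow> bool) set))"
  have T: "0 < T" unfolding T_def by (simp add: card_gt_0_iff)
  define C' where "C' = (T * (E / (1 - r))) powr (1 / q)"
  have "Lp_norm q (maximal_op \<rho> q \<alpha> \<theta> U V f)
      \<le> ennreal C' * bump_const \<rho> p q \<alpha> \<theta>' \<Phi> U V * Lp_norm p (\<lambda>x. ennreal (norm (f x)))"
    if UV: "matrix_weight U" "matrix_weight V" and fin: "bump_const \<rho> p q \<alpha> \<theta>' \<Phi> U V < \<infinity>" and fLp: "in_Lp p f"
    for U V :: "real^'d \<Rightarrow> complex^'n^'n" and f :: "real^'d \<Rightarrow> complex^'n"
  proof -
    define K where "K = enn2real (bump_const \<rho> p q \<alpha> \<theta>' \<Phi> U V)"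
    have bK: "bump_const \<rho> p q \<alpha> \<theta>' \<Phi> U V = ennreal K" "0 \<le> K" using fin by (simp_all add: K_def)
    have fm: "f \<in> borel_measurable lebesgue" using fLp by (simp add: in_Lp_def)
    interpret bump_weights \<rho> \<theta>' \<alpha> p q K \<Phi> U V f
      using assms UV fm bK by unfold_locales (auto simp: critical_radius_def)
    have "(\<integral>\<^sup>+x. ennreal (norm (f x) powr p) \<partial>lebesgue) < \<infinity>"
    proof -
      have "Lp_norm p (\<lambda>x. ennreal (norm (f x))) < top" using fLp by (simp add: in_Lp_def)
      then show ?thesis unfolding Lp_norm_def epowr_less_top by simp
    qed
    then have int: "integrable lebesgue (\<lambda>x. norm (f x) powr p)"
      by (intro integrableI_bounded) (auto simp: abs_of_nonneg)
    define I where "I = (LINT x|lebesgue. norm (f x) powr p)"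
    have I: "0 \<le> I" unfolding I_def by (intro integral_nonneg_AE) auto
    have "(\<integral>\<^sup>+x. ennreal (norm (f x) powr p) \<partial>lebesgue) = ennreal I"
      unfolding I_def by (rule nn_integral_eq_integral[OF int]) auto
    then have Lp: "Lp_norm p (\<lambda>x. ennreal (norm (f x))) = ennreal (I powr (1 / p))"
      using I by (simp add: Lp_norm_def)
    define S where "S t j x = (SUP Q\<in>level_cubes t j. ennreal (H Q x powr q) * indicator Q x)" for t j x
    have Sm[measurable]: "S t j \<in> borel_measurable lebesgue" for t j
      unfolding S_def[abs_def]
    proof (rule borel_measurable_SUP)
      show "countable (level_cubes t j)"
        by (rule countable_subset[OF _ countable_grid[of t]]) (auto simp: level_cubes_def)
      fix Q assume "Q \<in> level_cubes t j"
      note QC = level_cubes_comparable[OF this]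
      have [measurable]: "H Q \<in> borel_measurable lebesgue" "Q \<in> sets lebesgue"
        using H_measurable[OF QC int] comparable_measure(3)[OF QC] by auto
      show "(\<lambda>x. ennreal (H Q x powr q) * indicator Q x) \<in> borel_measurable lebesgue" by measurable
    qed
    define a where "a j = (12 powr (real CARD('d) * \<gamma>) * 2 powr - (real j * \<theta> * \<gamma>)) powr q" for j
    have Sint: "ennreal (a j) * (\<integral>\<^sup>+x. S t j x \<partial>lebesgue) \<le> ennreal (E * K powr q * I powr (q / p) * r ^ j)" for t j
    proof -
      let ?B = "2 * L powr q * (2 powr q * (12 powr real CARD('d) * ((12 powr real CARD('d) + 1) * K *
        (12 * 2 powr (real j + 1)) powr \<beta>) powr q)) * (C * I powr (q / p))"
      have "(\<integral>\<^sup>+x. S t j x \<partial>lebesgue) \<le> ennreal ?B"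
        unfolding S_def I_def \<beta>_def \<gamma>_def
      proof (rule family_bound[OF _ _ int C0 _ L_def])
        show "level_cubes t j \<subseteq> grid t" by (auto simp: level_cubes_def)
        show "comparable (2 powr (real j + 1)) Q" if "Q \<in> level_cubes t j" for Q
          by (rule level_cubes_comparable[OF that])
      qed (rule C)
      then have "ennreal (a j) * (\<integral>\<^sup>+x. S t j x \<partial>lebesgue) \<le> ennreal (a j) * ennreal ?B"
        by (intro mult_left_mono) auto
      also have "\<dots> = ennreal (a j * ?B)" by (rule ennreal_mult'[symmetric]) (simp add: a_def)
      also have "a j * ?B = E * K powr q * I powr (q / p) * r ^ j"
      proof -
        have 1: "(12 * 2 powr (real j + 1)) powr \<beta> = 24 powr \<beta> * 2 powr (real j * \<beta>)"
        proof -
          have "12 * 2 powr (real j + 1) = 24 * 2 powr real j" by (simp add: powr_add)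
          then show ?thesis by (simp only: powr_mult powr_powr)
        qed
        have 2: "((12 powr real CARD('d) + 1) * K * (24 powr \<beta> * 2 powr (real j * \<beta>))) powr q
            = ((12 powr real CARD('d) + 1) * 24 powr \<beta>) powr q * K powr q * 2 powr (real j * \<beta> * q)"
          using bK(2) by (simp add: powr_mult powr_powr mult_ac)
        have 3: "a j = (12 powr (real CARD('d) * \<gamma>)) powr q * 2 powr - (real j * \<theta> * \<gamma> * q)"
          unfolding a_def by (subst powr_mult) (simp_all add: powr_powr)
        have 4: "2 powr - (real j * \<theta> * \<gamma> * q) * 2 powr (real j * \<beta> * q) = r ^ j"
        proof -
          have "r ^ j = r powr real j" using r by (simp add: powr_realpow)
          also have "\<dots> = 2 powr (- (real j * \<theta> * \<gamma> * q) + real j * \<beta> * q)"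
            unfolding r_def powr_powr by (simp add: algebra_simps)
          finally show ?thesis by (simp only: powr_add)
        qed
        show ?thesis unfolding 1 2 3 4[symmetric] E_def by (simp only: mult_ac)
      qed
      finally show ?thesis .
    qed
    have "(\<integral>\<^sup>+x. epowr (maximal_op \<rho> q \<alpha> \<theta> U V f x) q \<partial>lebesgue)
        \<le> (\<integral>\<^sup>+x. (\<Sum>t\<in>UNIV. \<Sum>j. ennreal (a j) * S t j x) \<partial>lebesgue)"
      unfolding a_def S_def \<gamma>_def using assms(2) by (intro nn_integral_mono maximal_op_pointwise int) simp
    also have "\<dots> = (\<Sum>t\<in>UNIV. \<integral>\<^sup>+x. (\<Sum>j. ennreal (a j) * S t j x) \<partial>lebesgue)"
      by (rule nn_integral_sum) measurable
    also have "\<dots> = (\<Sum>t\<in>UNIV. \<Sum>j. \<integral>\<^sup>+x. ennreal (a j) * S t j x \<partial>lebesgue)"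
      by (intro sum.cong refl nn_integral_suminf) measurable
    also have "\<dots> = (\<Sum>t\<in>UNIV. \<Sum>j. ennreal (a j) * (\<integral>\<^sup>+x. S t j x \<partial>lebesgue))"
      by (simp add: nn_integral_cmult)
    also have "\<dots> \<le> (\<Sum>t\<in>(UNIV :: ('d \<Rightarrow> bool) set). \<Sum>j. ennreal (E * K powr q * I powr (q / p) * r ^ j))"
      by (intro sum_mono suminf_le Sint) auto
    also have "(\<Sum>j. ennreal (E * K powr q * I powr (q / p) * r ^ j)) = ennreal (E * K powr q * I powr (q / p) * (1 / (1 - r)))"
    proof -
      have "(\<lambda>j. E * K powr q * I powr (q / p) * r ^ j) sums (E * K powr q * I powr (q / p) * (1 / (1 - r)))"
        using r by (intro sums_mult geometric_sums) auto
      then show ?thesis using E r by (intro suminf_ennreal_eq) auto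
    qed
    also have "(\<Sum>t\<in>(UNIV :: ('d \<Rightarrow> bool) set). ennreal (E * K powr q * I powr (q / p) * (1 / (1 - r))))
        = ennreal (T * (E / (1 - r)) * K powr q * I powr (q / p))"
    proof -
      have "(\<Sum>t\<in>(UNIV :: ('d \<Rightarrow> bool) set). ennreal (E * K powr q * I powr (q / p) * (1 / (1 - r))))
          = ennreal (\<Sum>t\<in>(UNIV :: ('d \<Rightarrow> bool) set). E * K powr q * I powr (q / p) * (1 / (1 - r)))"
        using E r by (intro sum_ennreal) auto
      then show ?thesis by (simp add: T_def mult_ac)
    qed
    finally have "Lp_norm q (maximal_op \<rho> q \<alpha> \<theta> U V f) \<le> epowr (ennreal (T * (E / (1 - r)) * K powr q * I powr (q / p))) (1 / q)"
      unfolding Lp_norm_def using p0 by (intro epowr_mono) auto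
    also have "\<dots> = ennreal (C' * K * I powr (1 / p))"
    proof -
      have "(T * (E / (1 - r)) * K powr q * I powr (q / p)) powr (1 / q) = C' * K * I powr (1 / p)"
      proof -
        have "(X * K powr q * I powr (q / p)) powr (1 / q) = X powr (1 / q) * K * I powr (1 / p)" for X
          using bK(2) p0 by (simp add: powr_mult powr_powr)
        then show ?thesis unfolding C'_def .
      qed
      then show ?thesis using T E r by simp
    qed
    also have "\<dots> = ennreal C' * bump_const \<rho> p q \<alpha> \<theta>' \<Phi> U V * Lp_norm p (\<lambda>x. ennreal (norm (f x)))"
      unfolding Lp bK(1) using bK(2) by (simp add: ennreal_mult C'_def)
    finally show ?thesis .
  qed
  moreover have "0 < C'" using T E r by (simp add: C'_def)
  ultimately show ?thesis by blast
qed

end
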